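(* Let $(K,\leq)$ be a directed set and let $N=\{n_{ba}\in\mathbb{N}\mid a,b\in K,\ a\leq b\}$ be a set (indexed family) of natural numbers satisfying the factorization equalities $n_{ca}=n_{cb}\cdot n_{ba}$ for all $a,b,c\in K$ with $a\leq b$ and $b\leq c$. Let $\mathcal{F}=(K,\{\mathcal{T}_a\},\{\sigma_{ba}\})$ be the inductive system of Toeplitz algebras over $K$ defined by $N$. Then there exists a sequence $M=(m_1,m_2,\ldots)$ of natural numbers, with associated subgroup $\mathbb{Q}_M\subset\mathbb{Q}$, such that the reduced semigroup $C^*$-algebra of the semigroup $\mathbb{Q}_M^+$ is isomorphic, in the category of unital $C^*$-algebras and unital $*$-homomorphisms, to the inductive limit of $\mathcal{F}$: $$C^*_r(\mathbb{Q}_M^+)\simeq\varinjlim\mathcal{F}.$$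
   Context: $\mathbb{N}$ denotes the positive integers. A directed set is a (nonempty) partially ordered set in which every two elements have a common upper bound. For a sequence $M=(m_1,m_2,\ldots)$ with $m_s\in\mathbb{N}$, $\mathbb{Q}_M:=\left\{\frac{m}{m_1m_2\cdots m_s}\mid m\in\mathbb{Z},\ s\in\mathbb{N}\right\}$, a subgroup of the additive group $\mathbb{Q}$. For a subgroup $\Gamma\subset\mathbb{Q}$ put $\Gamma^+:=\Gamma\cap[0,+\infty)$, an additive semigroup. Let $\{e_g\mid g\in\Gamma^+\}$ be the canonical orthonormal basis of the Hilbert space $l^2(\Gamma^+)$ of square summable complex-valued functions on $\Gamma^+$. For $g\in\Gamma^+$ let $V_g\in B(l^2(\Gamma^+))$ be the isometry with $V_ge_h=e_{g+h}$ for $h\in\Gamma^+$. The reduced semigroup $C^*$-algebra $C^*_r(\Gamma^+)$ is the $C^*$-subalgebra of $B(l^2(\Gamma^+))$ generated by $\{V_g\mid g\in\Gamma^+\}$. For $\Gamma=\mathbb{Z}$ write $\mathcal{T}:=C^*_r(\mathbb{Z}^+)$ (the Toeplitz algebra) and $T:=V_1$, so $T^n=V_n$. Known fact (consequence of Coburn's theorem): for every $n\in\mathbb{N}$ there is a unique unital $*$-homomorphism $\varphi:\mathcal{T}\to\mathcal{T}$ with $\varphi(T)=T^n$, and it is isometric. The inductive system of Toeplitz algebras over $K$ defined by $N$ is $\mathcal{F}=(K,\{\mathcal{T}_a\},\{\sigma_{ba}\})$, where $\mathcal{T}_a=\mathcal{T}$ for all $a\in K$ and, for $a\leq b$, $\sigma_{ba}:\mathcal{T}_a\to\mathcal{T}_b$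 is the unique unital $*$-homomorphism with $\sigma_{ba}(T)=T^{n_{ba}}$. Then $\sigma_{aa}=\mathrm{id}$ and $\sigma_{ca}=\sigma_{cb}\circ\sigma_{ba}$ for $a\leq b\leq c$. The inductive limit $\varinjlim\mathcal{F}$ of an inductive system $(K,\{\mathfrak{A}_a\},\{\sigma_{ba}\})$ of unital $C^*$-algebras with unital injective connecting $*$-homomorphisms over a directed set $K$ is a unital $C^*$-algebra $\mathfrak{A}$ together with unital injective $*$-homomorphisms $\sigma^K_a:\mathfrak{A}_a\to\mathfrak{A}$ $(a\in K)$ such that $\sigma^K_a=\sigma^K_b\circ\sigma_{ba}$ whenever $a\leq b$, and $\mathfrak{A}$ is the norm closure of $\bigcup_{a\in K}\sigma^K_a(\mathfrak{A}_a)$. It always exists and is unique up to a unique $*$-isomorphism compatible with the maps $\sigma^K_a$. *)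

theory Defs
  imports "HOL-Analysis.Analysis" "HOL-Algebra.Algebra" "HOL-Algebra.Algebraic_Closure_Type"
begin

section \<open>Unital \<open>C\<^sup>*\<close>-algebras\<close>

record 'a cstar_algebra = "(complex, 'a) module" +
  adj :: "'a \<Rightarrow> 'a"
  cnorm :: "'a \<Rightarrow> real"

text \<open>The constant value off the carrier is needed because \<^locale>\<open>Metric_space\<close> asks for
  a distance that is nonnegative and symmetric on the whole type.\<close>
definition cstar_dist :: "('a, 'm) cstar_algebra_scheme \<Rightarrow> 'a \<Rightarrow> 'a \<Rightarrow> real" where
  "cstar_dist A x y =
     (if x \<in> carrier A \<and> y \<in> carrier A then cnorm A (x \<ominus>\<^bsub>A\<^esub> y) else 0)"

abbreviation cstar_topology :: "('a, 'm) cstar_algebra_scheme \<Rightarrow> 'a topology" where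
  "cstar_topology A \<equiv> Metric_space.mtopology (carrier A) (cstar_dist A)"

text \<open>The zero algebra is not excluded.\<close>
definition unital_cstar_algebra :: "('a, 'm) cstar_algebra_scheme \<Rightarrow> bool" where
  "unital_cstar_algebra A \<longleftrightarrow>
     ring A \<and> Module.module (ring_of_type_algebra :: complex ring) A \<and>
     (\<forall>c. \<forall>x\<in>carrier A. \<forall>y\<in>carrier A.
        (c \<odot>\<^bsub>A\<^esub> x) \<otimes>\<^bsub>A\<^esub> y = c \<odot>\<^bsub>A\<^esub> (x \<otimes>\<^bsub>A\<^esub> y) \<and>
        x \<otimes>\<^bsub>A\<^esub> (c \<odot>\<^bsub>A\<^esub> y) = c \<odot>\<^bsub>A\<^esub> (x \<otimes>\<^bsub>A\<^esub> y)) \<and>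
     (\<forall>x\<in>carrier A. adj A x \<in> carrier A \<and> adj A (adj A x) = x) \<and>
     (\<forall>x\<in>carrier A. \<forall>y\<in>carrier A.
        adj A (x \<oplus>\<^bsub>A\<^esub> y) = adj A x \<oplus>\<^bsub>A\<^esub> adj A y \<and>
        adj A (x \<otimes>\<^bsub>A\<^esub> y) = adj A y \<otimes>\<^bsub>A\<^esub> adj A x) \<and>
     (\<forall>c. \<forall>x\<in>carrier A. adj A (c \<odot>\<^bsub>A\<^esub> x) = cnj c \<odot>\<^bsub>A\<^esub> adj A x) \<and>
     (\<forall>x\<in>carrier A. 0 \<le> cnorm A x \<and> (cnorm A x = 0 \<longleftrightarrow> x = \<zero>\<^bsub>A\<^esub>)) \<and>
     (\<forall>c. \<forall>x\<in>carrier A. cnorm A (c \<odot>\<^bsub>A\<^esub> x) = cmod c * cnorm A x) \<and>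
     (\<forall>x\<in>carrier A. \<forall>y\<in>carrier A.
        cnorm A (x \<oplus>\<^bsub>A\<^esub> y) \<le> cnorm A x + cnorm A y \<and>
        cnorm A (x \<otimes>\<^bsub>A\<^esub> y) \<le> cnorm A x * cnorm A y) \<and>
     (\<forall>x\<in>carrier A. cnorm A (adj A x \<otimes>\<^bsub>A\<^esub> x) = (cnorm A x)\<^sup>2) \<and>
     Metric_space.mcomplete (carrier A) (cstar_dist A)"

definition unital_star_hom ::
    "('a, 'm) cstar_algebra_scheme \<Rightarrow> ('b, 'n) cstar_algebra_scheme \<Rightarrow> ('a \<Rightarrow> 'b) set" where
  "unital_star_hom A B =
     {\<phi> \<in> ring_hom A B.
        (\<forall>c. \<forall>x\<in>carrier A. \<phi> (c \<odot>\<^bsub>A\<^esub> x) = c \<odot>\<^bsub>B\<^esub> \<phi> x) \<and>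
        (\<forall>x\<in>carrier A. \<phi> (adj A x) = adj B (\<phi> x))}"

definition cstar_isomorphic ::
    "('a, 'm) cstar_algebra_scheme \<Rightarrow> ('b, 'n) cstar_algebra_scheme \<Rightarrow> bool" where
  "cstar_isomorphic A B \<longleftrightarrow>
     (\<exists>\<phi> \<in> unital_star_hom A B. bij_betw \<phi> (carrier A) (carrier B))"

definition cstar_subalgebra :: "'a set \<Rightarrow> ('a, 'm) cstar_algebra_scheme \<Rightarrow> bool" where
  "cstar_subalgebra C A \<longleftrightarrow>
     C \<subseteq> carrier A \<and> \<zero>\<^bsub>A\<^esub> \<in> C \<and>
     (\<forall>x\<in>C. \<forall>y\<in>C. x \<oplus>\<^bsub>A\<^esub> y \<in> C \<and> x \<otimes>\<^bsub>A\<^esub> y \<in> C) \<and>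
     (\<forall>c. \<forall>x\<in>C. c \<odot>\<^bsub>A\<^esub> x \<in> C) \<and>
     (\<forall>x\<in>C. adj A x \<in> C) \<and>
     closedin (cstar_topology A) C"

definition cstar_generated ::
    "('a, 'm) cstar_algebra_scheme \<Rightarrow> 'a set \<Rightarrow> ('a, 'm) cstar_algebra_scheme" where
  "cstar_generated A S = A\<lparr>carrier := \<Inter>{C. cstar_subalgebra C A \<and> S \<subseteq> C}\<rparr>"


section \<open>Inductive limits\<close>

definition directed_set :: "'k set \<Rightarrow> ('k \<times> 'k) set \<Rightarrow> bool" where
  "directed_set K r \<longleftrightarrow>
     K \<noteq> {} \<and> partial_order_on K r \<and>
     (\<forall>a\<in>K. \<forall>b\<in>K. \<exists>c\<in>K. (a, c) \<in> r \<and> (b, c) \<in> r)"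

text \<open>\<open>\<sigma> b a\<close>, for \<open>(a, b) \<in> r\<close>, is the connecting morphism from \<open>A a\<close> to \<open>A b\<close>;
  \<open>\<tau> a\<close> is the canonical morphism from \<open>A a\<close> to \<open>L\<close>.\<close>
definition inductive_limit ::
    "'k set \<Rightarrow> ('k \<times> 'k) set \<Rightarrow> ('k \<Rightarrow> 'a cstar_algebra) \<Rightarrow> ('k \<Rightarrow> 'k \<Rightarrow> 'a \<Rightarrow> 'a) \<Rightarrow>
     'b cstar_algebra \<Rightarrow> ('k \<Rightarrow> 'a \<Rightarrow> 'b) \<Rightarrow> bool" where
  "inductive_limit K r A \<sigma> L \<tau> \<longleftrightarrow>
     unital_cstar_algebra L \<and>
     (\<forall>a\<in>K. \<tau> a \<in> unital_star_hom (A a) L \<and> inj_on (\<tau> a) (carrier (A a))) \<and>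
     (\<forall>(a, b)\<in>r. \<forall>x\<in>carrier (A a). \<tau> a x = \<tau> b (\<sigma> b a x)) \<and>
     carrier L = cstar_topology L closure_of (\<Union>a\<in>K. \<tau> a ` carrier (A a))"


section \<open>Bounded operators on \<open>l\<^sup>2(S)\<close>\<close>

text \<open>Functions on \<open>S\<close> are represented by functions on the whole type vanishing off \<open>S\<close>.\<close>
definition l2 :: "'i set \<Rightarrow> ('i \<Rightarrow> complex) set" where
  "l2 S = {f. (\<forall>x. x \<notin> S \<longrightarrow> f x = 0) \<and> (\<lambda>x. (cmod (f x))\<^sup>2) summable_on S}"

definition l2_norm :: "'i set \<Rightarrow> ('i \<Rightarrow> complex) \<Rightarrow> real" where
  "l2_norm S f = sqrt (\<Sum>\<^sub>\<infinity>x\<in>S. (cmod (f x))\<^sup>2)"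

definition l2_inner :: "'i set \<Rightarrow> ('i \<Rightarrow> complex) \<Rightarrow> ('i \<Rightarrow> complex) \<Rightarrow> complex" where
  "l2_inner S f g = (\<Sum>\<^sub>\<infinity>x\<in>S. f x * cnj (g x))"

definition l2_basis :: "'i \<Rightarrow> 'i \<Rightarrow> complex" where
  "l2_basis h = (\<lambda>x. if x = h then 1 else 0)"

type_synonym 'i operator = "('i \<Rightarrow> complex) \<Rightarrow> ('i \<Rightarrow> complex)"

text \<open>The value \<open>0\<close> off \<open>l2 S\<close> makes equality of operators coincide with equality of functions.\<close>
definition bounded_ops :: "'i set \<Rightarrow> 'i operator set" where
  "bounded_ops S = {A.
     (\<forall>f\<in>l2 S. A f \<in> l2 S) \<and>
     (\<forall>f\<in>l2 S. \<forall>g\<in>l2 S. A (\<lambda>x. f x + g x) = (\<lambda>x. A f x + A g x)) \<and>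
     (\<forall>c. \<forall>f\<in>l2 S. A (\<lambda>x. c * f x) = (\<lambda>x. c * A f x)) \<and>
     (\<exists>C. \<forall>f\<in>l2 S. l2_norm S (A f) \<le> C * l2_norm S f) \<and>
     (\<forall>f. f \<notin> l2 S \<longrightarrow> A f = (\<lambda>x. 0))}"

definition op_adjoint :: "'i set \<Rightarrow> 'i operator \<Rightarrow> 'i operator" where
  "op_adjoint S A = (THE B. B \<in> bounded_ops S \<and>
     (\<forall>f\<in>l2 S. \<forall>g\<in>l2 S. l2_inner S (A f) g = l2_inner S f (B g)))"

definition op_norm :: "'i set \<Rightarrow> 'i operator \<Rightarrow> real" where
  "op_norm S A = (SUP f\<in>{f \<in> l2 S. l2_norm S f \<le> 1}. l2_norm S (A f))"

definition op_algebra :: "'i set \<Rightarrow> 'i operator cstar_algebra" where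
  "op_algebra S = \<lparr>
     carrier = bounded_ops S,
     monoid.mult = (\<lambda>A B. A \<circ> B),
     monoid.one = (\<lambda>f. if f \<in> l2 S then f else (\<lambda>x. 0)),
     ring.zero = (\<lambda>f x. 0),
     ring.add = (\<lambda>A B f x. A f x + B f x),
     module.smult = (\<lambda>c A f x. c * A f x),
     adj = op_adjoint S,
     cnorm = op_norm S\<rparr>"


section \<open>Reduced semigroup \<open>C\<^sup>*\<close>-algebras of positive cones in the rationals\<close>

definition pos_cone :: "rat set \<Rightarrow> rat set" where
  "pos_cone \<Gamma> = {g \<in> \<Gamma>. 0 \<le> g}"

text \<open>Since \<open>f\<close> vanishes off the cone, \<open>f (x - g)\<close> is the coordinate of the translate of \<open>f\<close>
  by \<open>g\<close>, being \<open>0\<close> if \<open>x - g\<close> is not in the cone; see \<open>shift_basis\<close> below.\<close>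
definition shift :: "rat set \<Rightarrow> rat \<Rightarrow> rat operator" where
  "shift \<Gamma> g = (\<lambda>f. if f \<in> l2 (pos_cone \<Gamma>) then (\<lambda>x. f (x - g)) else (\<lambda>x. 0))"

lemma l2_basis_in_l2: "h \<in> S \<Longrightarrow> l2_basis h \<in> l2 S"
proof -
  assume "h \<in> S"
  moreover have "(\<lambda>x. (cmod (l2_basis h x))\<^sup>2) summable_on S"
    by (rule finite_nonzero_values_imp_summable_on, rule finite_subset[of _ "{h}"])
       (auto simp: l2_basis_def)
  ultimately show ?thesis by (auto simp: l2_def l2_basis_def)
qed

lemma shift_basis:
  "h \<in> pos_cone \<Gamma> \<Longrightarrow> shift \<Gamma> g (l2_basis h) = l2_basis (g + h)"
  using l2_basis_in_l2[of h "pos_cone \<Gamma>"] by (auto simp: shift_def l2_basis_def fun_eq_iff)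

definition reduced_cstar :: "rat set \<Rightarrow> rat operator cstar_algebra" where
  "reduced_cstar \<Gamma> =
     cstar_generated (op_algebra (pos_cone \<Gamma>)) (shift \<Gamma> ` pos_cone \<Gamma>)"

definition toeplitz :: "rat operator cstar_algebra" where
  "toeplitz = reduced_cstar \<int>"

definition toeplitz_gen :: "rat operator" where
  "toeplitz_gen = shift \<int> 1"

text \<open>Extensionality makes the morphism unique as a function on the whole type.\<close>
definition toeplitz_endo :: "nat \<Rightarrow> rat operator \<Rightarrow> rat operator" where
  "toeplitz_endo n = (THE \<phi>. \<phi> \<in> unital_star_hom toeplitz toeplitz \<and>
     \<phi> \<in> extensional (carrier toeplitz) \<and>
     \<phi> toeplitz_gen = toeplitz_gen [^]\<^bsub>toeplitz\<^esub> n)"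

text \<open>Sequences are indexed from \<open>1\<close>; the value \<open>M 0\<close> plays no role.\<close>
definition rat_group :: "(nat \<Rightarrow> nat) \<Rightarrow> rat set" where
  "rat_group M = {of_int m / of_nat (\<Prod>i=1..s. M i) | m s. s \<ge> 1}"

end

theory Submission
  imports Defs
begin

text \<open>
  Fix an index \<open>a\<^sub>0\<close> and put \<open>q\<^sub>a = n\<^sub>b\<^sub>a / n\<^sub>b\<^sub>a\<^sub>0\<close> for any \<open>b\<close> above \<open>a\<close> and \<open>a\<^sub>0\<close>; this does not depend
  on \<open>b\<close>, and \<open>q\<^sub>a = n\<^sub>b\<^sub>a q\<^sub>b\<close>. The directed union of the groups \<open>\<int> q\<^sub>a\<close> is some \<open>\<Gamma> = \<rat>\<^sub>M\<close>, since a
  sequence of indices cofinal for divisibility of the integers \<open>n\<^sub>b\<^sub>a\<^sub>0\<close> can be chosen. As the translates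
  of \<open>[0, q) \<inter> \<Gamma>\<close> by multiples of \<open>q\<close> tile \<open>\<Gamma>\<^sup>+\<close>, the isometry \<open>V\<^sub>q\<close> is a multiple of the unilateral
  shift, so \<open>T \<mapsto> V\<^sub>q\<close> is the restriction of an amplification \<open>X \<mapsto> 1 \<otimes> X\<close>; for \<open>q = q\<^sub>a\<close> these
  morphisms exhibit \<open>C\<^sup>*\<^sub>r(\<Gamma>\<^sup>+)\<close> as an inductive limit. Any two inductive limits are isomorphic
  because every injective morphism \<open>\<tau>\<close> of the Toeplitz algebra is isometric. It is contractive since a
  self-adjoint element of norm less than \<open>1\<close> is the real part of a unitary, and it does not decrease
  norms because \<open>\<tau>\<close> scales the norm of all rank one operators \<open>g \<otimes> e\<^sub>0\<^sup>*\<close> by the same constant.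
\<close>

section \<open>Norm calculus in \<open>C\<^sup>*\<close>-algebras\<close>

text \<open>The index set may be uncountable while \<open>M\<close> is a sequence. This is harmless
  because a group between the integers and the rationals is determined by its denominators, here
  divisors of the integers \<open>n b a0\<close>, of which there are only countably many. The choice
  of q_a gives the generator at \<open>a0\<close> the value 1, and q_a = n_ba q_b turns T ->
  T^{n_ba} into the identity V_{q_b}^{n_ba} = V_{q_a}. A limit algebra is known only through its
  axioms and may live on another type, so an isomorphism has to be extended by continuity from a
  union that carries algebraic data only. Norms must therefore be recovered from algebra. A single
  square root of 1 - x takes the place of functional calculus for the upper bound. The lower bound
  uses that the Toeplitz algebra contains \<open>rank_one g\<close> for every vector g, so that the
  norm of an operator can be read off from products inside the algebra. The existence half of
  Coburn's theorem, needed for the connecting maps, is the same amplification applied to the group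
  of integers with q = k.\<close>

text \<open>Completeness is split off because the norm calculus is needed to prove it.\<close>
locale pre_cstar_alg = ring A for A :: "('a, 'm) cstar_algebra_scheme" (structure) +
  assumes module_axioms: "Module.module (ring_of_type_algebra :: complex ring) A"
    and mult_smult_left:
      "x \<in> carrier A \<Longrightarrow> y \<in> carrier A \<Longrightarrow> ((c::complex) \<odot> x) \<otimes> y = c \<odot> (x \<otimes> y)"
    and mult_smult_right:
      "x \<in> carrier A \<Longrightarrow> y \<in> carrier A \<Longrightarrow> x \<otimes> ((c::complex) \<odot> y) = c \<odot> (x \<otimes> y)"
    and adj_closed [simp]: "x \<in> carrier A \<Longrightarrow> adj A x \<in> carrier A"
    and adj_adj [simp]: "x \<in> carrier A \<Longrightarrow> adj A (adj A x) = x"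
    and adj_add: "x \<in> carrier A \<Longrightarrow> y \<in> carrier A \<Longrightarrow> adj A (x \<oplus> y) = adj A x \<oplus> adj A y"
    and adj_mult: "x \<in> carrier A \<Longrightarrow> y \<in> carrier A \<Longrightarrow> adj A (x \<otimes> y) = adj A y \<otimes> adj A x"
    and adj_smult: "x \<in> carrier A \<Longrightarrow> adj A ((c::complex) \<odot> x) = cnj c \<odot> adj A x"
    and cnorm_nonneg [simp]: "x \<in> carrier A \<Longrightarrow> 0 \<le> cnorm A x"
    and cnorm_eq_0: "x \<in> carrier A \<Longrightarrow> cnorm A x = 0 \<longleftrightarrow> x = \<zero>"
    and cnorm_smult: "x \<in> carrier A \<Longrightarrow> cnorm A (c \<odot> x) = cmod c * cnorm A x"
    and cnorm_add: "x \<in> carrier A \<Longrightarrow> y \<in> carrier A \<Longrightarrow> cnorm A (x \<oplus> y) \<le> cnorm A x + cnorm A y"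
    and cnorm_mult: "x \<in> carrier A \<Longrightarrow> y \<in> carrier A \<Longrightarrow> cnorm A (x \<otimes> y) \<le> cnorm A x * cnorm A y"
    and cnorm_adj_mult: "x \<in> carrier A \<Longrightarrow> cnorm A (adj A x \<otimes> x) = (cnorm A x)\<^sup>2"
begin

lemma carrier_complex [simp]: "carrier (ring_of_type_algebra :: complex ring) = UNIV"
  and add_complex [simp]: "x \<oplus>\<^bsub>(ring_of_type_algebra :: complex ring)\<^esub> y = x + y"
  and mult_complex [simp]: "x \<otimes>\<^bsub>(ring_of_type_algebra :: complex ring)\<^esub> y = x * y"
  and one_complex [simp]: "\<one>\<^bsub>(ring_of_type_algebra :: complex ring)\<^esub> = 1"
  by (simp_all add: ring_of_type_algebra_def)

lemma smult_closed [simp]: "x \<in> carrier A \<Longrightarrow> (c::complex) \<odot> x \<in> carrier A"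
  using module.smult_closed[OF module_axioms] by simp

lemma smult_add_left: "x \<in> carrier A \<Longrightarrow> (c + d :: complex) \<odot> x = c \<odot> x \<oplus> d \<odot> x"
  using module.smult_l_distr[OF module_axioms, of c d x] by simp

lemma smult_add_right:
  "x \<in> carrier A \<Longrightarrow> y \<in> carrier A \<Longrightarrow> (c::complex) \<odot> (x \<oplus> y) = c \<odot> x \<oplus> c \<odot> y"
  using module.smult_r_distr[OF module_axioms, of c x y] by simp

lemma smult_smult: "x \<in> carrier A \<Longrightarrow> (c::complex) \<odot> (d \<odot> x) = (c * d) \<odot> x"
  using module.smult_assoc1[OF module_axioms, of c d x] by simp

lemma smult_1 [simp]: "x \<in> carrier A \<Longrightarrow> (1::complex) \<odot> x = x"
  using module.smult_one[OF module_axioms, of x] by simp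

lemma smult_0 [simp]: "x \<in> carrier A \<Longrightarrow> (0::complex) \<odot> x = \<zero>"
  using smult_add_left[of x 0 0] by (simp add: add.l_cancel_one')

lemma smult_minus_1: "x \<in> carrier A \<Longrightarrow> (-1::complex) \<odot> x = \<ominus> x"
  using smult_add_left[of x "-1" 1] by (simp add: minus_equality)

lemma cnorm_0 [simp]: "cnorm A \<zero> = 0"
  by (simp add: cnorm_eq_0)

lemma adj_one [simp]: "adj A \<one> = \<one>"
  using adj_mult[of \<one> "adj A \<one>"] by simp

lemma adj_minus_1: "x \<in> carrier A \<Longrightarrow> adj A (\<ominus> x) = \<ominus> adj A x"
  using adj_smult[of x "-1"] by (simp add: smult_minus_1)

lemma adj_minus: "x \<in> carrier A \<Longrightarrow> y \<in> carrier A \<Longrightarrow> adj A (x \<ominus> y) = adj A x \<ominus> adj A y"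
  by (simp add: a_minus_def adj_add adj_minus_1)

text \<open>In |y|^2 = |y^* y| <= |y^*| |y| one factor cancels; the same bound for the adjoint gives
  equality.\<close>

lemma cnorm_adj [simp]: "x \<in> carrier A \<Longrightarrow> cnorm A (adj A x) = cnorm A x"
proof -
  have le: "cnorm A y \<le> cnorm A (adj A y)" if "y \<in> carrier A" for y
  proof (cases "cnorm A y = 0")
    case False
    have "cnorm A y * cnorm A y \<le> cnorm A (adj A y) * cnorm A y"
      using cnorm_adj_mult[OF that] cnorm_mult[of "adj A y" y] that by (simp add: power2_eq_square)
    then show ?thesis using False cnorm_nonneg[OF that] by simp
  qed (use that in simp)
  assume "x \<in> carrier A"
  then show ?thesis using le[of x] le[of "adj A x"] by simp
qed

text \<open>The norm of the unit is an idempotent real, hence 0 or 1. The value 0 occurs in the zero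
  algebra, which the axioms admit.\<close>

lemma cnorm_one: "cnorm A \<one> \<le> 1"
proof -
  have "cnorm A \<one> * cnorm A \<one> = cnorm A \<one>"
    using cnorm_adj_mult[of \<one>] by (simp add: power2_eq_square)
  then show ?thesis by (metis cnorm_nonneg mult_cancel_right1 one_closed order_refl zero_le_one)
qed

lemma cnorm_minus: "x \<in> carrier A \<Longrightarrow> cnorm A (\<ominus> x) = cnorm A x"
  using cnorm_smult[of x "-1"] by (simp add: smult_minus_1)

lemma cnorm_minus_commute: "x \<in> carrier A \<Longrightarrow> y \<in> carrier A \<Longrightarrow> cnorm A (x \<ominus> y) = cnorm A (y \<ominus> x)"
  using cnorm_minus[of "x \<ominus> y"] by (simp add: minus_eq minus_add a_comm)

lemma minus_plus_minus:
  "x \<in> carrier A \<Longrightarrow> y \<in> carrier A \<Longrightarrow> z \<in> carrier A \<Longrightarrow> (x \<ominus> y) \<oplus> (y \<ominus> z) = x \<ominus> z"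
  by (simp add: minus_eq a_assoc r_neg1)

lemma cnorm_triangle:
  assumes "x \<in> carrier A" "y \<in> carrier A" "z \<in> carrier A"
  shows "cnorm A (x \<ominus> z) \<le> cnorm A (x \<ominus> y) + cnorm A (y \<ominus> z)"
  using cnorm_add[of "x \<ominus> y" "y \<ominus> z"] assms by (simp add: minus_plus_minus)

lemma cnorm_diff_le:
  assumes "x \<in> carrier A" "y \<in> carrier A"
  shows "\<bar>cnorm A x - cnorm A y\<bar> \<le> cnorm A (x \<ominus> y)"
  using cnorm_triangle[of x y \<zero>] cnorm_triangle[of y x \<zero>] cnorm_minus_commute[of x y] assms
  by (simp add: minus_eq)

sublocale Metric_space "carrier A" "cstar_dist A"
proof
  fix x y
  show "0 \<le> cstar_dist A x y" by (simp add: cstar_dist_def)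
  show "cstar_dist A x y = cstar_dist A y x" by (simp add: cstar_dist_def cnorm_minus_commute)
  show "cstar_dist A x y = 0 \<longleftrightarrow> x = y" if "x \<in> carrier A" "y \<in> carrier A"
    using that by (simp add: cstar_dist_def cnorm_eq_0)
  show "cstar_dist A x z \<le> cstar_dist A x y + cstar_dist A y z"
    if "x \<in> carrier A" "y \<in> carrier A" "z \<in> carrier A" for z
    using that by (simp add: cstar_dist_def cnorm_triangle)
qed

section \<open>Norm convergence of sequences\<close>

definition conv :: "(nat \<Rightarrow> 'a) \<Rightarrow> 'a \<Rightarrow> bool" where
  "conv s x \<longleftrightarrow> range s \<subseteq> carrier A \<and> x \<in> carrier A \<and> (\<lambda>n. cnorm A (s n \<ominus> x)) \<longlonglongrightarrow> 0"

lemma convD: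
  assumes "conv s x"
  shows "s n \<in> carrier A" "x \<in> carrier A" "(\<lambda>n. cnorm A (s n \<ominus> x)) \<longlonglongrightarrow> 0"
  using assms by (auto simp: conv_def)

lemma convI_le:
  assumes "\<And>n. s n \<in> carrier A" "x \<in> carrier A" "\<And>n. cnorm A (s n \<ominus> x) \<le> f n" "f \<longlonglongrightarrow> 0"
  shows "conv s x"
proof -
  have "(\<lambda>n. cnorm A (s n \<ominus> x)) \<longlonglongrightarrow> 0"
    by (rule tendsto_sandwich[of "\<lambda>_. 0" _ _ f]) (use assms in auto)
  then show ?thesis using assms by (auto simp: conv_def)
qed

lemma conv_iff_limitin: "range s \<subseteq> carrier A \<Longrightarrow> conv s x \<longleftrightarrow> limitin mtopology s x sequentially"
proof -
  assume s: "range s \<subseteq> carrier A"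
  have "cstar_dist A (s n) x = cnorm A (s n \<ominus> x)" if "x \<in> carrier A" for n
    using that s by (auto simp: cstar_dist_def)
  then show ?thesis using s
    by (auto simp: limitin_metric_dist_null conv_def image_subset_iff)
qed

lemma closedin_iff_conv:
  "closedin mtopology C \<longleftrightarrow> C \<subseteq> carrier A \<and> (\<forall>s x. range s \<subseteq> C \<longrightarrow> conv s x \<longrightarrow> x \<in> C)"
proof -
  have "range s \<subseteq> C \<and> limitin mtopology s x sequentially \<longleftrightarrow> range s \<subseteq> C \<and> conv s x"
    if "C \<subseteq> carrier A" for s x
    using conv_iff_limitin[OF subset_trans[OF _ that], of s x] by blast
  then show ?thesis
    unfolding metric_closedin_iff_sequentially_closed by meson
qed

lemma closure_of_iff_conv:
  assumes "C \<subseteq> carrier A"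
  shows "mtopology closure_of C = {x. \<exists>s. range s \<subseteq> C \<and> conv s x}"
proof (intro equalityI subsetI)
  fix x assume x: "x \<in> mtopology closure_of C"
  then have xA: "x \<in> carrier A" and "\<And>r. r > 0 \<Longrightarrow> \<exists>y\<in>C. cnorm A (x \<ominus> y) < r"
    using assms by (force simp: metric_closure_of cstar_dist_def subset_iff)+
  then have "\<exists>y\<in>C. cnorm A (x \<ominus> y) < inverse (Suc n)" for n by simp
  then obtain s where s: "\<And>n. s n \<in> C" "\<And>n. cnorm A (x \<ominus> s n) < inverse (Suc n)" by metis
  have "conv s x"
    by (rule convI_le[OF _ _ _ LIMSEQ_inverse_real_of_nat])
       (use s assms xA in \<open>auto simp: cnorm_minus_commute subset_iff less_imp_le\<close>)
  then show "x \<in> {x. \<exists>s. range s \<subseteq> C \<and> conv s x}" using s by auto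
next
  fix x assume "x \<in> {x. \<exists>s. range s \<subseteq> C \<and> conv s x}"
  then obtain s where s: "range s \<subseteq> C" "conv s x" by auto
  have "\<exists>y\<in>C. y \<in> mball x r" if "r > 0" for r
  proof -
    have "\<forall>\<^sub>F n in sequentially. cnorm A (s n \<ominus> x) < r"
      using convD(3)[OF s(2)] that by (rule order_tendstoD)
    then obtain n where "cnorm A (s n \<ominus> x) < r" by (auto simp: eventually_sequentially)
    then have "s n \<in> mball x r"
      using convD(1,2)[OF s(2)] by (simp add: cstar_dist_def cnorm_minus_commute)
    then show ?thesis using s by auto
  qed
  then show "x \<in> mtopology closure_of C" using convD(2)[OF s(2)] by (simp add: metric_closure_of)
qed

lemma conv_const: "x \<in> carrier A \<Longrightarrow> conv (\<lambda>_. x) x"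
  by (auto simp: conv_def minus_eq r_neg)

lemma conv_add:
  assumes "conv s x" "conv t y"
  shows "conv (\<lambda>n. s n \<oplus> t n) (x \<oplus> y)"
proof (rule convI_le)
  fix n
  have "(s n \<oplus> t n) \<ominus> (x \<oplus> y) = (s n \<ominus> x) \<oplus> (t n \<ominus> y)"
    using convD(1,2)[OF assms(1)] convD(1,2)[OF assms(2)]
    by (simp add: minus_eq minus_add a_ac)
  then show "cnorm A ((s n \<oplus> t n) \<ominus> (x \<oplus> y)) \<le> cnorm A (s n \<ominus> x) + cnorm A (t n \<ominus> y)"
    using convD(1,2)[OF assms(1)] convD(1,2)[OF assms(2)] by (simp add: cnorm_add)
  show "(\<lambda>n. cnorm A (s n \<ominus> x) + cnorm A (t n \<ominus> y)) \<longlonglongrightarrow> 0"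
    using tendsto_add[OF convD(3)[OF assms(1)] convD(3)[OF assms(2)]] by simp
qed (use convD(1,2) assms in auto)

lemma smult_minus:
  assumes "x \<in> carrier A" "y \<in> carrier A"
  shows "(c::complex) \<odot> (x \<ominus> y) = c \<odot> x \<ominus> c \<odot> y"
proof -
  have "c \<odot> (\<ominus> y) = \<ominus> (c \<odot> y)"
    using assms by (simp add: smult_minus_1[symmetric] smult_smult)
  then show ?thesis using assms by (simp add: minus_eq smult_add_right)
qed

lemma conv_smult:
  assumes "conv s x"
  shows "conv (\<lambda>n. c \<odot> s n) (c \<odot> x)"
proof (rule convI_le)
  show "cnorm A (c \<odot> s n \<ominus> c \<odot> x) \<le> cmod c * cnorm A (s n \<ominus> x)" for n
    using convD(1,2)[OF assms] by (simp add: smult_minus[symmetric] cnorm_smult)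
  show "(\<lambda>n. cmod c * cnorm A (s n \<ominus> x)) \<longlonglongrightarrow> 0"
    using tendsto_mult_left[OF convD(3)[OF assms], of "cmod c"] by simp
qed (use convD(1,2) assms in auto)

lemma conv_adj:
  assumes "conv s x"
  shows "conv (\<lambda>n. adj A (s n)) (adj A x)"
proof (rule convI_le)
  show "cnorm A (adj A (s n) \<ominus> adj A x) \<le> cnorm A (s n \<ominus> x)" for n
    using convD(1,2)[OF assms] by (simp add: adj_minus[symmetric])
qed (use convD assms in auto)

lemma conv_cnorm:
  assumes "conv s x"
  shows "(\<lambda>n. cnorm A (s n)) \<longlonglongrightarrow> cnorm A x"
proof -
  have "(\<lambda>n. cnorm A (s n) - cnorm A x) \<longlonglongrightarrow> 0"
    by (rule tendsto_rabs_zero_cancel, rule tendsto_sandwich[of "\<lambda>_. 0" _ _ "\<lambda>n. cnorm A (s n \<ominus> x)"])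
       (use convD[OF assms] cnorm_diff_le in auto)
  then show ?thesis by (simp add: LIM_zero_iff)
qed

lemma conv_mult:
  assumes "conv s x" "conv t y"
  shows "conv (\<lambda>n. s n \<otimes> t n) (x \<otimes> y)"
proof (rule convI_le)
  fix n
  note * = convD(1,2)[OF assms(1)] convD(1,2)[OF assms(2)]
  \<comment> \<open>The splitting s t - x y = (s - x) t + x (t - y) keeps the order of factors. The
    norms of \<open>t n\<close> converge, so the first term still tends to 0.\<close>
  have "(s n \<otimes> t n) \<ominus> (x \<otimes> y) = (s n \<ominus> x) \<otimes> t n \<oplus> x \<otimes> (t n \<ominus> y)"
    using * by (simp add: minus_eq l_distr r_distr l_minus r_minus a_assoc r_neg1)
  then have "cnorm A ((s n \<otimes> t n) \<ominus> (x \<otimes> y)) \<le> cnorm A ((s n \<ominus> x) \<otimes> t n) + cnorm A (x \<otimes> (t n \<ominus> y))"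
    using * by (simp add: cnorm_add)
  also have "\<dots> \<le> cnorm A (s n \<ominus> x) * cnorm A (t n) + cnorm A x * cnorm A (t n \<ominus> y)"
    using * by (intro add_mono cnorm_mult) auto
  finally show "cnorm A ((s n \<otimes> t n) \<ominus> (x \<otimes> y)) \<le> cnorm A (s n \<ominus> x) * cnorm A (t n) + cnorm A x * cnorm A (t n \<ominus> y)" .
next
  show "(\<lambda>n. cnorm A (s n \<ominus> x) * cnorm A (t n) + cnorm A x * cnorm A (t n \<ominus> y)) \<longlonglongrightarrow> 0"
    using tendsto_add[OF tendsto_mult[OF convD(3)[OF assms(1)] conv_cnorm[OF assms(2)]]
      tendsto_mult_left[OF convD(3)[OF assms(2)], of "cnorm A x"]] by simp
qed (use convD(1,2) assms in auto)

lemma conv_minus: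
  assumes "conv s x" "conv t y"
  shows "conv (\<lambda>n. s n \<ominus> t n) (x \<ominus> y)"
proof -
  have "conv (\<lambda>n. s n \<oplus> (-1::complex) \<odot> t n) (x \<oplus> (-1::complex) \<odot> y)"
    by (intro conv_add conv_smult assms)
  then show ?thesis using convD(1,2)[OF assms(2)] by (simp add: smult_minus_1 minus_eq)
qed

lemma conv_unique:
  assumes "conv s x" "conv s y"
  shows "x = y"
proof -
  have "(\<lambda>n. cnorm A (s n \<ominus> s n)) \<longlonglongrightarrow> cnorm A (x \<ominus> y)"
    by (intro conv_cnorm conv_minus assms)
  moreover have "s n \<ominus> s n = \<zero>" for n using convD(1)[OF assms(1)] by simp
  ultimately have "cnorm A (x \<ominus> y) = 0" by (simp add: LIMSEQ_const_iff)
  then show ?thesis using convD(2) assms by (simp add: cnorm_eq_0)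
qed

lemma conv_Cauchy:
  assumes "conv s x" "e > 0"
  shows "\<exists>N. \<forall>m\<ge>N. \<forall>n\<ge>N. cnorm A (s m \<ominus> s n) < e"
proof -
  have "\<forall>\<^sub>F n in sequentially. cnorm A (s n \<ominus> x) < e/2"
    using convD(3)[OF assms(1)] assms(2) by (intro order_tendstoD) auto
  then obtain N where N: "\<And>n. n \<ge> N \<Longrightarrow> cnorm A (s n \<ominus> x) < e/2"
    by (auto simp: eventually_sequentially)
  have "cnorm A (s m \<ominus> s n) < e" if "m \<ge> N" "n \<ge> N" for m n
    using N[OF that(1)] N[OF that(2)] cnorm_triangle[of "s m" x "s n"] convD(1,2)[OF assms(1)]
      cnorm_minus_commute[of x "s n"] by auto
  then show ?thesis by blast
qed

text \<open>Completeness is the one axiom missing from the locale. It is reduced to Cauchy sequences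
  measured by norms of differences, the form in which it is checked for operator algebras and for
  subalgebras.\<close>

lemma unital_cstar_algebraI:
  assumes "\<And>s. (\<And>n. s n \<in> carrier A) \<Longrightarrow>
      (\<And>e. e > 0 \<Longrightarrow> \<exists>N. \<forall>m\<ge>N. \<forall>n\<ge>N. cnorm A (s m \<ominus> s n) < e) \<Longrightarrow> \<exists>x. conv s x"
  shows "unital_cstar_algebra A"
proof -
  have "mcomplete"
    unfolding mcomplete_def
  proof (intro allI impI)
    fix s assume s: "MCauchy s"
    then have r: "range s \<subseteq> carrier A" by (simp add: MCauchy_def)
    have "\<exists>N. \<forall>m\<ge>N. \<forall>n\<ge>N. cnorm A (s m \<ominus> s n) < e" if "e > 0" for e
    proof -
      have "\<exists>N. \<forall>m n. N \<le> m \<longrightarrow> N \<le> n \<longrightarrow> cstar_dist A (s m) (s n) < e"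
        using s that by (simp add: MCauchy_def)
      moreover have "cstar_dist A (s m) (s n) = cnorm A (s m \<ominus> s n)" for m n
        using r by (auto simp: cstar_dist_def)
      ultimately show ?thesis by simp
    qed
    moreover have "s n \<in> carrier A" for n using r by auto
    ultimately have "\<exists>x. conv s x" using assms by presburger
    then obtain x where "conv s x" ..
    then show "\<exists>x. limitin mtopology s x sequentially" using r conv_iff_limitin by blast
  qed
  moreover have "ring A" by unfold_locales
  ultimately show ?thesis
    using module_axioms
    by (simp add: unital_cstar_algebra_def mult_smult_left mult_smult_right adj_smult
        cnorm_eq_0 cnorm_smult cnorm_adj_mult cnorm_add cnorm_mult adj_add adj_mult)
qed

end

locale cstar_alg = pre_cstar_alg A for A :: "('a, 'm) cstar_algebra_scheme" (structure) +
  assumes cstar_complete: "mcomplete"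

lemma cstar_algI: "unital_cstar_algebra A \<Longrightarrow> cstar_alg A"
  unfolding unital_cstar_algebra_def
  by (intro cstar_alg.intro pre_cstar_alg.intro pre_cstar_alg_axioms.intro cstar_alg_axioms.intro) blast+

lemma (in cstar_alg) Cauchy_conv:
  assumes "\<And>n. s n \<in> carrier A"
    and "\<And>e. e > 0 \<Longrightarrow> \<exists>N. \<forall>m\<ge>N. \<forall>n\<ge>N. cnorm A (s m \<ominus> s n) < e"
  obtains x where "conv s x"
proof -
  have "cstar_dist A (s m) (s n) = cnorm A (s m \<ominus> s n)" for m n
    using assms(1) by (simp add: cstar_dist_def)
  then have "MCauchy s"
    unfolding MCauchy_def image_subset_iff using assms by simp
  then have "\<exists>x. limitin mtopology s x sequentially"
    using cstar_complete[unfolded mcomplete_def, rule_format, of s] by simp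
  then obtain x where "limitin mtopology s x sequentially" ..
  moreover have "range s \<subseteq> carrier A" using assms(1) by blast
  ultimately show ?thesis using that[of x] conv_iff_limitin[of s x] by simp
qed

lemma (in cstar_alg) unital: "unital_cstar_algebra A"
  by (rule unital_cstar_algebraI) (metis Cauchy_conv)

section \<open>Closed star subalgebras and the algebra generated by a set\<close>

context pre_cstar_alg
begin

lemma cstar_subalgebra_iff_conv:
  "cstar_subalgebra C A \<longleftrightarrow>
     C \<subseteq> carrier A \<and> \<zero> \<in> C \<and>
     (\<forall>x\<in>C. \<forall>y\<in>C. x \<oplus> y \<in> C \<and> x \<otimes> y \<in> C) \<and>
     (\<forall>c::complex. \<forall>x\<in>C. c \<odot> x \<in> C) \<and> (\<forall>x\<in>C. adj A x \<in> C) \<and>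
     (\<forall>s x. range s \<subseteq> C \<longrightarrow> conv s x \<longrightarrow> x \<in> C)"
  by (auto simp: cstar_subalgebra_def closedin_iff_conv)

lemma cstar_subalgebra_carrier: "cstar_subalgebra (carrier A) A"
  by (auto simp: cstar_subalgebra_iff_conv dest: convD)

lemma cstar_subalgebra_Inter:
  assumes "\<C> \<noteq> {}" "\<And>C. C \<in> \<C> \<Longrightarrow> cstar_subalgebra C A"
  shows "cstar_subalgebra (\<Inter>\<C>) A"
proof -
  note * = assms(2)[unfolded cstar_subalgebra_iff_conv]
  show ?thesis
    unfolding cstar_subalgebra_iff_conv
  proof (intro conjI allI impI ballI)
    show "\<Inter>\<C> \<subseteq> carrier A" using assms(1) * by blast
  next
    fix s x assume "range s \<subseteq> \<Inter>\<C>" "conv s x"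
    then show "x \<in> \<Inter>\<C>" using * by (meson Inter_iff le_Inf_iff)
  qed (use * in \<open>meson Inter_iff\<close>)+
qed

lemma cstar_subalgebra_generated:
  "S \<subseteq> carrier A \<Longrightarrow> cstar_subalgebra (carrier (cstar_generated A S)) A"
  unfolding cstar_generated_def
  by simp (rule cstar_subalgebra_Inter, use cstar_subalgebra_carrier in auto)

text \<open>The operations are sequentially continuous and so extend to the closure. Later
  \<open>D\<close> is the union of the images of the Toeplitz algebras under the canonical
  morphisms.\<close>

lemma cstar_subalgebra_closure:
  assumes D: "D \<subseteq> carrier A" "\<zero> \<in> D"
    and "\<And>x y. x \<in> D \<Longrightarrow> y \<in> D \<Longrightarrow> x \<oplus> y \<in> D"
    and "\<And>x y. x \<in> D \<Longrightarrow> y \<in> D \<Longrightarrow> x \<otimes> y \<in> D"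
    and "\<And>(c::complex) x. x \<in> D \<Longrightarrow> c \<odot> x \<in> D"
    and "\<And>x. x \<in> D \<Longrightarrow> adj A x \<in> D"
  shows "cstar_subalgebra (mtopology closure_of D) A"
proof -
  let ?C = "{x. \<exists>s. range s \<subseteq> D \<and> conv s x}"
  have eq: "mtopology closure_of D = ?C" using D(1) by (rule closure_of_iff_conv)
  show ?thesis
    unfolding cstar_subalgebra_def
  proof (intro conjI ballI allI)
    show "mtopology closure_of D \<subseteq> carrier A" unfolding eq using convD(2) by blast
    show "\<zero> \<in> mtopology closure_of D"
      unfolding eq using D conv_const[of \<zero>] by (auto intro!: exI[of _ "\<lambda>_. \<zero>"])
    show "closedin mtopology (mtopology closure_of D)" by simp
  next
    fix x y assume "x \<in> mtopology closure_of D" "y \<in> mtopology closure_of D"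
    then obtain s t where *: "range s \<subseteq> D" "conv s x" "range t \<subseteq> D" "conv t y"
      unfolding eq by blast
    show "x \<oplus> y \<in> mtopology closure_of D" unfolding eq
      using * assms(3) conv_add[of s x t y] by (auto intro!: exI[of _ "\<lambda>n. s n \<oplus> t n"])
    show "x \<otimes> y \<in> mtopology closure_of D" unfolding eq
      using * assms(4) conv_mult[of s x t y] by (auto intro!: exI[of _ "\<lambda>n. s n \<otimes> t n"])
    show "c \<odot> x \<in> mtopology closure_of D" for c :: complex unfolding eq
      using * assms(5) conv_smult[of s x] by (auto intro!: exI[of _ "\<lambda>n. c \<odot> s n"])
    show "adj A x \<in> mtopology closure_of D" unfolding eq
      using * assms(6) conv_adj[of s x] by (auto intro!: exI[of _ "\<lambda>n. adj A (s n)"])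
  qed
qed

end

lemma cstar_generated_least:
  "cstar_subalgebra C A \<Longrightarrow> S \<subseteq> C \<Longrightarrow> carrier (cstar_generated A S) \<subseteq> C"
  and cstar_generated_superset: "S \<subseteq> carrier (cstar_generated A S)"
  by (auto simp: cstar_generated_def)

text \<open>Only the carrier shrinks, so facts about records
  \<open>A\<lparr>carrier := C\<rparr>\<close> apply to generated algebras.\<close>

lemma cstar_generated_eq: "cstar_generated A S = A\<lparr>carrier := carrier (cstar_generated A S)\<rparr>"
  by (simp add: cstar_generated_def)

context cstar_alg
begin

context
  fixes C
  assumes C: "cstar_subalgebra C A" and one_C: "\<one> \<in> C"
begin

lemma subalg_closed:
  shows "C \<subseteq> carrier A" "\<zero> \<in> C" "x \<in> C \<Longrightarrow> y \<in> C \<Longrightarrow> x \<oplus> y \<in> C" "x \<in> C \<Longrightarrow> y \<in> C \<Longrightarrow> x \<otimes> y \<in> C"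
    "x \<in> C \<Longrightarrow> (c::complex) \<odot> x \<in> C" "x \<in> C \<Longrightarrow> adj A x \<in> C" "x \<in> C \<Longrightarrow> x \<in> carrier A"
  using C by (auto simp: cstar_subalgebra_def)

lemma subalg_ring: "ring (A\<lparr>carrier := C\<rparr>)"
proof (intro ringI abelian_groupI monoidI)
  fix x assume "x \<in> carrier (A\<lparr>carrier := C\<rparr>)"
  then have x: "x \<in> C" by simp
  have "(-1::complex) \<odot> x \<in> C" by (rule subalg_closed(5)[OF x])
  moreover have "(-1::complex) \<odot> x \<oplus> x = \<zero>"
    using subalg_closed(7)[OF x] by (simp add: smult_minus_1 l_neg)
  ultimately show "\<exists>y\<in>carrier (A\<lparr>carrier := C\<rparr>). y \<oplus>\<^bsub>A\<lparr>carrier := C\<rparr>\<^esub> x = \<zero>\<^bsub>A\<lparr>carrier := C\<rparr>\<^esub>" by auto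
qed (use subalg_closed one_C in \<open>auto simp: a_ac m_assoc l_distr r_distr\<close>)

text \<open>Subtraction is no record field: it is defined through inverses searched for inside the
  carrier, so shrinking the carrier might change it. It does not, because the multiple of
  \<open>y\<close> by -1 lies in \<open>C\<close>.\<close>

lemma subalg_minus: "x \<in> C \<Longrightarrow> y \<in> C \<Longrightarrow> x \<ominus>\<^bsub>A\<lparr>carrier := C\<rparr>\<^esub> y = x \<ominus> y"
proof -
  interpret C: ring "A\<lparr>carrier := C\<rparr>" by (rule subalg_ring)
  assume xy: "x \<in> C" "y \<in> C"
  have "(\<ominus> y) \<in> C" using subalg_closed(5)[OF xy(2), of "-1"] subalg_closed(7)[OF xy(2)]
    by (simp add: smult_minus_1)
  then have "\<ominus>\<^bsub>A\<lparr>carrier := C\<rparr>\<^esub> y = \<ominus> y"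
    using xy subalg_closed(7) by (intro C.minus_equality) (auto simp: l_neg)
  then show ?thesis by (simp add: a_minus_def)
qed

lemma subalg_pre: "pre_cstar_alg (A\<lparr>carrier := C\<rparr>)"
proof (intro pre_cstar_alg.intro pre_cstar_alg_axioms.intro subalg_ring)
  interpret C: ring "A\<lparr>carrier := C\<rparr>" by (rule subalg_ring)
  show "Module.module (ring_of_type_algebra :: complex ring) (A\<lparr>carrier := C\<rparr>)"
    by (rule moduleI[OF cring_from_type_algebra C.abelian_group_axioms])
       (use subalg_closed in \<open>auto simp: smult_add_left smult_add_right smult_smult\<close>)
qed (use subalg_closed in \<open>auto simp: mult_smult_left mult_smult_right adj_add adj_mult adj_smult
    cnorm_eq_0 cnorm_smult cnorm_add cnorm_mult cnorm_adj_mult\<close>)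

lemma subalg_conv: "range s \<subseteq> C \<Longrightarrow> x \<in> C \<Longrightarrow> pre_cstar_alg.conv (A\<lparr>carrier := C\<rparr>) s x \<longleftrightarrow> conv s x"
proof -
  interpret C: pre_cstar_alg "A\<lparr>carrier := C\<rparr>" by (rule subalg_pre)
  assume "range s \<subseteq> C" "x \<in> C"
  then show ?thesis using subalg_closed(1)
    by (auto simp: C.conv_def conv_def subalg_minus image_subset_iff)
qed

text \<open>A Cauchy sequence in \<open>C\<close> converges in \<open>A\<close>, and its limit stays
  in the closed set \<open>C\<close>.\<close>

lemma subalg_cstar: "cstar_alg (A\<lparr>carrier := C\<rparr>)"
proof -
  interpret C: pre_cstar_alg "A\<lparr>carrier := C\<rparr>" by (rule subalg_pre)
  show ?thesis
  proof (rule cstar_algI, rule C.unital_cstar_algebraI)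
    fix s :: "nat \<Rightarrow> 'a"
    assume s: "\<And>n. s n \<in> carrier (A\<lparr>carrier := C\<rparr>)"
      "\<And>e. e > 0 \<Longrightarrow> \<exists>N. \<forall>m\<ge>N. \<forall>n\<ge>N. cnorm (A\<lparr>carrier := C\<rparr>) (s m \<ominus>\<^bsub>A\<lparr>carrier := C\<rparr>\<^esub> s n) < e"
    have sC: "s n \<in> C" for n using s(1) by simp
    have "\<exists>N. \<forall>m\<ge>N. \<forall>n\<ge>N. cnorm A (s m \<ominus> s n) < e" if "e > 0" for e
      using s(2)[OF that] sC by (simp add: subalg_minus)
    then obtain x where x: "conv s x" using Cauchy_conv[of s] sC subalg_closed(7) by blast
    moreover have "range s \<subseteq> C" using sC by blast
    then have "x \<in> C" using C x unfolding cstar_subalgebra_iff_conv by meson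
    ultimately show "\<exists>x. C.conv s x" using subalg_conv[of s x] sC by auto
  qed
qed

end

section \<open>Square roots by fixed point iteration\<close>

lemma conv_Suc: "conv s x \<Longrightarrow> conv (\<lambda>n. s (Suc n)) x"
  unfolding conv_def using LIMSEQ_Suc[of "\<lambda>n. cnorm A (s n \<ominus> x)"] by auto

lemma geometric_conv:
  assumes s: "\<And>n. s n \<in> carrier A" and q: "0 \<le> q" "q < 1"
    and step: "\<And>n. cnorm A (s (Suc n) \<ominus> s n) \<le> q ^ n"
  obtains x where "conv s x"
proof -
  have bound: "cnorm A (s (n + k) \<ominus> s n) \<le> q ^ n * (1 - q ^ k) / (1 - q)" for n k
  proof (induction k)
    case 0
    then show ?case using s[of n] by (simp add: minus_eq r_neg)
  next
    case (Suc k)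
    have "cnorm A (s (n + Suc k) \<ominus> s n) \<le> cnorm A (s (Suc (n + k)) \<ominus> s (n + k)) + cnorm A (s (n + k) \<ominus> s n)"
      using cnorm_triangle[of "s (Suc (n + k))" "s (n + k)" "s n"] s by simp
    also have "\<dots> \<le> q ^ (n + k) + q ^ n * (1 - q ^ k) / (1 - q)"
      by (intro add_mono step Suc.IH)
    also have "\<dots> = q ^ n * (1 - q ^ Suc k) / (1 - q)"
      using q by (simp add: field_simps power_add)
    finally show ?case .
  qed
  have le: "cnorm A (s m \<ominus> s n) \<le> q ^ n / (1 - q)" if "n \<le> m" for m n
  proof -
    have "cnorm A (s m \<ominus> s n) \<le> q ^ n * (1 - q ^ (m - n)) / (1 - q)"
      using bound[of n "m - n"] that by simp
    also have "\<dots> \<le> q ^ n * 1 / (1 - q)"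
      using q by (intro divide_right_mono mult_left_mono) auto
    finally show ?thesis by simp
  qed
  have "\<exists>N. \<forall>m\<ge>N. \<forall>n\<ge>N. cnorm A (s m \<ominus> s n) < e" if e: "e > 0" for e
  proof -
    have "(\<lambda>n. q ^ n / (1 - q)) \<longlonglongrightarrow> 0 / (1 - q)"
      using q by (intro tendsto_divide LIMSEQ_realpow_zero tendsto_const) auto
    then have "\<forall>\<^sub>F n in sequentially. q ^ n / (1 - q) < e"
      using e by (intro order_tendstoD) auto
    then obtain N where N: "\<And>n. n \<ge> N \<Longrightarrow> q ^ n / (1 - q) < e" by (auto simp: eventually_sequentially)
    have "cnorm A (s m \<ominus> s n) < e" if "m \<ge> N" "n \<ge> N" for m n
    proof (cases "n \<le> m")
      case True
      then show ?thesis using le[OF True] N[OF that(2)] by simp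
    next
      case False
      then show ?thesis using le[of m n] N[OF that(1)] cnorm_minus_commute[of "s m" "s n"] s by simp
    qed
    then show ?thesis by blast
  qed
  then show ?thesis using Cauchy_conv[of s] s that by blast
qed

text \<open>With \<open>b = 1 - y\<close>, the equation \<open>b\<^sup>2 = 1 - x\<close> becomes the fixed point equation
  \<open>y = (x + y\<^sup>2) / 2\<close>, a contraction on the ball of radius \<open>\<parallel>x\<parallel>\<close>.\<close>
lemma square_root_of_one_minus:
  assumes x: "x \<in> carrier A" "adj A x = x" "cnorm A x < 1"
  obtains b where "b \<in> carrier A" "adj A b = b" "b \<otimes> b = \<one> \<ominus> x"
    "\<And>a. a \<in> carrier A \<Longrightarrow> a \<otimes> x = x \<otimes> a \<Longrightarrow> a \<otimes> b = b \<otimes> a"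
proof -
  define q where "q = cnorm A x"
  have q: "0 \<le> q" "q < 1" using x by (auto simp: q_def)
  define y where "y = rec_nat \<zero> (\<lambda>_ z. (1/2::complex) \<odot> (x \<oplus> z \<otimes> z))"
  have y0: "y 0 = \<zero>" and yS: "y (Suc n) = (1/2::complex) \<odot> (x \<oplus> y n \<otimes> y n)" for n
    by (simp_all add: y_def)
  have yc [simp]: "y n \<in> carrier A" for n by (induction n) (use x in \<open>auto simp: y0 yS\<close>)
  have zero_adj: "adj A \<zero> = \<zero>" using adj_smult[of \<zero> 0] by simp
  have y_adj: "adj A (y n) = y n" for n
    by (induction n) (use x in \<open>auto simp: y0 yS adj_smult adj_add adj_mult zero_adj\<close>)
  \<comment> \<open>The iterates are polynomials in \<open>x\<close>, so whatever commutes with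
    \<open>x\<close> commutes with them and with their limit. This is what later makes a
    self-adjoint \<open>a\<close> commute with the root of 1 - a^2.\<close>
  have y_comm: "a \<otimes> y n = y n \<otimes> a" if a: "a \<in> carrier A" "a \<otimes> x = x \<otimes> a" for a n
  proof (induction n)
    case (Suc n)
    have "a \<otimes> (y n \<otimes> y n) = (a \<otimes> y n) \<otimes> y n" using a by (simp add: m_assoc)
    also have "\<dots> = (y n \<otimes> a) \<otimes> y n" by (simp only: Suc.IH)
    also have "\<dots> = y n \<otimes> (a \<otimes> y n)" using a by (simp add: m_assoc)
    also have "\<dots> = y n \<otimes> (y n \<otimes> a)" by (simp only: Suc.IH)
    also have "\<dots> = (y n \<otimes> y n) \<otimes> a" using a by (simp add: m_assoc)
    finally show ?case using a x by (simp add: yS mult_smult_left mult_smult_right r_distr l_distr)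
  qed (use a in \<open>simp add: y0\<close>)
  have y_le: "cnorm A (y n) \<le> q" for n
  proof (induction n)
    case (Suc n)
    have "cnorm A (y (Suc n)) = 1/2 * cnorm A (x \<oplus> y n \<otimes> y n)" using x by (simp add: yS cnorm_smult)
    also have "\<dots> \<le> 1/2 * (cnorm A x + cnorm A (y n) * cnorm A (y n))"
      using x cnorm_add[of x "y n \<otimes> y n"] cnorm_mult[of "y n" "y n"] by simp
    also have "\<dots> \<le> 1/2 * (q + 1 * q)"
      using Suc q by (intro mult_left_mono add_mono mult_mono) (auto simp: q_def)
    finally show ?case by simp
  qed (simp add: y0 q)
  have y_step: "cnorm A (y (Suc n) \<ominus> y n) \<le> q ^ n" for n
  proof (induction n)
    case 0
    have "y (Suc 0) \<ominus> y 0 = y (Suc 0)" by (simp add: y0 minus_eq)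
    then show ?case using y_le[of "Suc 0"] q by simp
  next
    case (Suc n)
    let ?d = "y (Suc n) \<ominus> y n"
    have "y (Suc (Suc n)) \<ominus> y (Suc n) =
        (1/2::complex) \<odot> ((x \<oplus> y (Suc n) \<otimes> y (Suc n)) \<ominus> (x \<oplus> y n \<otimes> y n))"
      using x by (simp add: yS[of "Suc n"] yS[of n] smult_minus)
    \<comment> \<open>Noncommutative difference of squares: u u - v v = u (u - v) + (u - v) v. As
      all iterates have norm at most \<open>q\<close>, the map contracts by the factor
      \<open>q\<close>.\<close>
    also have "(x \<oplus> y (Suc n) \<otimes> y (Suc n)) \<ominus> (x \<oplus> y n \<otimes> y n) = y (Suc n) \<otimes> ?d \<oplus> ?d \<otimes> y n"
      using x(1) yc[of n] yc[of "Suc n"] by algebra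
    finally have "cnorm A (y (Suc (Suc n)) \<ominus> y (Suc n)) = 1/2 * cnorm A (y (Suc n) \<otimes> ?d \<oplus> ?d \<otimes> y n)"
      by (simp add: cnorm_smult)
    also have "\<dots> \<le> 1/2 * (cnorm A (y (Suc n)) * cnorm A ?d + cnorm A ?d * cnorm A (y n))"
      using cnorm_add[of "y (Suc n) \<otimes> ?d" "?d \<otimes> y n"] cnorm_mult[of "y (Suc n)" ?d] cnorm_mult[of ?d "y n"]
      by simp
    also have "\<dots> \<le> 1/2 * (q * cnorm A ?d + cnorm A ?d * q)"
      using y_le[of n] y_le[of "Suc n"] q by (intro mult_left_mono add_mono mult_mono) auto
    also have "\<dots> = q * cnorm A ?d" by simp
    also have "\<dots> \<le> q * q ^ n" using Suc q by (intro mult_left_mono)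
    finally show ?case by simp
  qed
  obtain l where l: "conv y l" using geometric_conv[OF yc q y_step] .
  note lc [simp] = convD(2)[OF l]
  have l_eq: "l = (1/2::complex) \<odot> (x \<oplus> l \<otimes> l)"
  proof (rule conv_unique[OF conv_Suc[OF l]])
    show "conv (\<lambda>n. y (Suc n)) ((1/2::complex) \<odot> (x \<oplus> l \<otimes> l))"
      unfolding yS by (intro conv_smult conv_add conv_mult conv_const l x)
  qed
  have l_adj: "adj A l = l"
    using conv_unique[OF conv_adj[OF l]] l by (simp add: y_adj)
  have l_comm: "a \<otimes> l = l \<otimes> a" if a: "a \<in> carrier A" "a \<otimes> x = x \<otimes> a" for a
  proof (rule conv_unique)
    show "conv (\<lambda>n. a \<otimes> y n) (a \<otimes> l)" by (intro conv_mult conv_const l a)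
    show "conv (\<lambda>n. a \<otimes> y n) (l \<otimes> a)" unfolding y_comm[OF a] by (intro conv_mult conv_const l a)
  qed
  have "l \<oplus> l = (2::complex) \<odot> l" using smult_add_left[of l 1 1] by simp
  also have "\<dots> = x \<oplus> l \<otimes> l"
    by (subst l_eq) (use x in \<open>simp add: smult_smult\<close>)
  finally have ll: "x = (l \<oplus> l) \<ominus> l \<otimes> l" using x(1) lc by algebra
  show ?thesis
  proof
    show "\<one> \<ominus> l \<in> carrier A" by simp
    show "adj A (\<one> \<ominus> l) = \<one> \<ominus> l" by (simp add: adj_minus l_adj)
    have "(\<one> \<ominus> l) \<otimes> (\<one> \<ominus> l) = \<one> \<ominus> ((l \<oplus> l) \<ominus> l \<otimes> l)"
      by (simp add: minus_eq l_distr r_distr l_minus r_minus minus_add a_ac)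
    then show "(\<one> \<ominus> l) \<otimes> (\<one> \<ominus> l) = \<one> \<ominus> x" using ll by simp
    fix a assume a: "a \<in> carrier A" "a \<otimes> x = x \<otimes> a"
    have "a \<otimes> (\<one> \<ominus> l) = a \<ominus> a \<otimes> l" using a(1) by (simp add: minus_eq r_distr r_minus)
    also have "\<dots> = a \<ominus> l \<otimes> a" using l_comm[OF a] by simp
    also have "\<dots> = (\<one> \<ominus> l) \<otimes> a" using a(1) by (simp add: minus_eq l_distr l_minus)
    finally show "a \<otimes> (\<one> \<ominus> l) = (\<one> \<ominus> l) \<otimes> a" .
  qed
qed

end

section \<open>Unital star homomorphisms\<close>

locale star_hom = A: cstar_alg A + B: cstar_alg B
  for A :: "('a, 'm) cstar_algebra_scheme" and B :: "('b, 'n) cstar_algebra_scheme" +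
  fixes \<phi>
  assumes hom: "\<phi> \<in> unital_star_hom A B"
begin

lemma hom_closed [simp]: "x \<in> carrier A \<Longrightarrow> \<phi> x \<in> carrier B"
  and hom_add: "x \<in> carrier A \<Longrightarrow> y \<in> carrier A \<Longrightarrow> \<phi> (x \<oplus>\<^bsub>A\<^esub> y) = \<phi> x \<oplus>\<^bsub>B\<^esub> \<phi> y"
  and hom_mult: "x \<in> carrier A \<Longrightarrow> y \<in> carrier A \<Longrightarrow> \<phi> (x \<otimes>\<^bsub>A\<^esub> y) = \<phi> x \<otimes>\<^bsub>B\<^esub> \<phi> y"
  and hom_one [simp]: "\<phi> \<one>\<^bsub>A\<^esub> = \<one>\<^bsub>B\<^esub>"
  and hom_smult: "x \<in> carrier A \<Longrightarrow> \<phi> (c \<odot>\<^bsub>A\<^esub> x) = c \<odot>\<^bsub>B\<^esub> \<phi> x"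
  and hom_adj: "x \<in> carrier A \<Longrightarrow> \<phi> (adj A x) = adj B (\<phi> x)"
  using hom by (auto simp: unital_star_hom_def ring_hom_def)

lemma hom_minus: "x \<in> carrier A \<Longrightarrow> y \<in> carrier A \<Longrightarrow> \<phi> (x \<ominus>\<^bsub>A\<^esub> y) = \<phi> x \<ominus>\<^bsub>B\<^esub> \<phi> y"
  using hom_add[of x "(-1) \<odot>\<^bsub>A\<^esub> y"] hom_smult[of y "-1"]
  by (simp add: A.smult_minus_1 B.smult_minus_1 a_minus_def)

lemma hom_zero [simp]: "\<phi> \<zero>\<^bsub>A\<^esub> = \<zero>\<^bsub>B\<^esub>"
  using hom_smult[of "\<zero>\<^bsub>A\<^esub>" 0] by simp

text \<open>For \<open>b = sqrt (1 - a\<^sup>2)\<close> the element \<open>u = a + \<i> b\<close> is unitary, and \<open>\<phi> a\<close> is the real part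
  of the unitary \<open>\<phi> u\<close>.\<close>
lemma cnorm_hom_selfadjoint_le_1:
  assumes a: "a \<in> carrier A" "adj A a = a" "cnorm A a < 1"
  shows "cnorm B (\<phi> a) \<le> 1"
proof -
  let ?x = "a \<otimes>\<^bsub>A\<^esub> a"
  have "cnorm A ?x \<le> cnorm A a * cnorm A a" using a by (simp add: A.cnorm_mult)
  also have "\<dots> < 1" using a A.cnorm_nonneg[OF a(1)] by (metis mult_le_one le_less_trans less_imp_le mult_left_le)
  finally have "cnorm A ?x < 1" .
  moreover have "?x \<in> carrier A" "adj A ?x = ?x" using a by (simp_all add: A.adj_mult)
  ultimately obtain b where b: "b \<in> carrier A" "adj A b = b" "b \<otimes>\<^bsub>A\<^esub> b = \<one>\<^bsub>A\<^esub> \<ominus>\<^bsub>A\<^esub> ?x"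
    "\<And>c. c \<in> carrier A \<Longrightarrow> c \<otimes>\<^bsub>A\<^esub> ?x = ?x \<otimes>\<^bsub>A\<^esub> c \<Longrightarrow> c \<otimes>\<^bsub>A\<^esub> b = b \<otimes>\<^bsub>A\<^esub> c"
    using A.square_root_of_one_minus by metis
  have ab: "a \<otimes>\<^bsub>A\<^esub> b = b \<otimes>\<^bsub>A\<^esub> a" using b(4)[of a] a by (simp add: A.m_assoc)
  define u where "u = a \<oplus>\<^bsub>A\<^esub> \<i> \<odot>\<^bsub>A\<^esub> b"
  have u: "u \<in> carrier A" using a b(1) by (simp add: u_def)
  have adj_u: "adj A u = a \<oplus>\<^bsub>A\<^esub> (- \<i>) \<odot>\<^bsub>A\<^esub> b" using a b(1,2) by (simp add: u_def A.adj_add A.adj_smult)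
  have ba: "b \<otimes>\<^bsub>A\<^esub> a \<in> carrier A" using a b(1) by simp
  have cancel: "\<i> \<odot>\<^bsub>A\<^esub> (b \<otimes>\<^bsub>A\<^esub> a) \<oplus>\<^bsub>A\<^esub> (- \<i>) \<odot>\<^bsub>A\<^esub> (b \<otimes>\<^bsub>A\<^esub> a) = \<zero>\<^bsub>A\<^esub>"
    using A.smult_add_left[OF ba, of "\<i>" "- \<i>"] ba by simp
  \<comment> \<open>Since \<open>a\<close> and \<open>b\<close> commute, the cross terms of u^* u
    cancel and a^2 + b^2 = 1 remains.\<close>
  have "adj A u \<otimes>\<^bsub>A\<^esub> u = (?x \<oplus>\<^bsub>A\<^esub> \<i> \<odot>\<^bsub>A\<^esub> (b \<otimes>\<^bsub>A\<^esub> a)) \<oplus>\<^bsub>A\<^esub> ((- \<i>) \<odot>\<^bsub>A\<^esub> (b \<otimes>\<^bsub>A\<^esub> a) \<oplus>\<^bsub>A\<^esub> b \<otimes>\<^bsub>A\<^esub> b)"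
    unfolding adj_u unfolding u_def using a(1) b(1)
    by (simp add: A.l_distr A.r_distr A.mult_smult_left A.mult_smult_right A.smult_smult
        A.smult_add_right ab A.a_ac)
  also have "\<dots> = ?x \<oplus>\<^bsub>A\<^esub> ((\<i> \<odot>\<^bsub>A\<^esub> (b \<otimes>\<^bsub>A\<^esub> a) \<oplus>\<^bsub>A\<^esub> (- \<i>) \<odot>\<^bsub>A\<^esub> (b \<otimes>\<^bsub>A\<^esub> a)) \<oplus>\<^bsub>A\<^esub> b \<otimes>\<^bsub>A\<^esub> b)"
    using a b(1) by (simp add: A.a_assoc)
  also have "\<dots> = ?x \<oplus>\<^bsub>A\<^esub> (\<one>\<^bsub>A\<^esub> \<ominus>\<^bsub>A\<^esub> ?x)" unfolding cancel b(3) using a by simp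
  also have "\<dots> = \<one>\<^bsub>A\<^esub>" using a by (simp add: a_minus_def A.a_lcomm[of ?x] A.r_neg)
  finally have "(cnorm B (\<phi> u))\<^sup>2 = cnorm B \<one>\<^bsub>B\<^esub>"
    using u by (simp add: B.cnorm_adj_mult[symmetric] hom_adj[symmetric] hom_mult[symmetric])
  then have phi_u: "cnorm B (\<phi> u) \<le> 1"
    using B.cnorm_one by (metis abs_le_square_iff abs_of_nonneg abs_1 one_power2 B.cnorm_nonneg hom_closed u abs_ge_self order_trans)
  have "u \<oplus>\<^bsub>A\<^esub> adj A u = a \<oplus>\<^bsub>A\<^esub> (a \<oplus>\<^bsub>A\<^esub> (\<i> \<odot>\<^bsub>A\<^esub> b \<oplus>\<^bsub>A\<^esub> (- \<i>) \<odot>\<^bsub>A\<^esub> b))"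
    unfolding adj_u unfolding u_def using a(1) b(1) by (simp add: A.a_ac)
  also have "\<i> \<odot>\<^bsub>A\<^esub> b \<oplus>\<^bsub>A\<^esub> (- \<i>) \<odot>\<^bsub>A\<^esub> b = \<zero>\<^bsub>A\<^esub>"
    using A.smult_add_left[OF b(1), of "\<i>" "- \<i>"] b(1) by simp
  finally have "u \<oplus>\<^bsub>A\<^esub> adj A u = 2 \<odot>\<^bsub>A\<^esub> a"
    using a A.smult_add_left[OF a(1), of 1 1] by simp
  then have "a = (1/2) \<odot>\<^bsub>A\<^esub> (u \<oplus>\<^bsub>A\<^esub> adj A u)" using a by (simp add: A.smult_smult)
  then have "cnorm B (\<phi> a) = cnorm B ((1/2) \<odot>\<^bsub>B\<^esub> (\<phi> u \<oplus>\<^bsub>B\<^esub> adj B (\<phi> u)))"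
    using u by (simp add: hom_smult hom_add hom_adj)
  also have "\<dots> \<le> 1/2 * (cnorm B (\<phi> u) + cnorm B (adj B (\<phi> u)))"
    using u B.cnorm_add[of "\<phi> u" "adj B (\<phi> u)"] by (simp add: B.cnorm_smult)
  also have "\<dots> \<le> 1" using phi_u u by simp
  finally show ?thesis .
qed

text \<open>The C*-identity reduces everything to the self-adjoint element x^* x. For self-adjoint
  \<open>a\<close>, scaling by 1 / t for each t above the norm provides the strict inequality that
  the square root needs; the bound by all such t gives the bound by the norm.\<close>

theorem cnorm_hom_le:
  assumes x: "x \<in> carrier A"
  shows "cnorm B (\<phi> x) \<le> cnorm A x"
proof -
  have selfadjoint: "cnorm B (\<phi> a) \<le> cnorm A a" if a: "a \<in> carrier A" "adj A a = a" for a
  proof (rule dense_ge)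
    fix t assume t: "cnorm A a < t"
    with A.cnorm_nonneg[OF a(1)] have t0: "t > 0" by linarith
    let ?b = "complex_of_real (1/t) \<odot>\<^bsub>A\<^esub> a"
    have "cnorm B (\<phi> ?b) \<le> 1"
    proof (rule cnorm_hom_selfadjoint_le_1)
      have "cnorm A ?b = 1/t * cnorm A a" using a t0 by (simp only: A.cnorm_smult norm_of_real) simp
      then show "cnorm A ?b < 1" using t t0 by simp
    qed (use a in \<open>simp_all add: A.adj_smult\<close>)
    moreover have "cnorm B (\<phi> ?b) = 1/t * cnorm B (\<phi> a)"
      using a t0 by (simp only: hom_smult B.cnorm_smult norm_of_real hom_closed) simp
    ultimately have "1/t * cnorm B (\<phi> a) \<le> 1" by simp
    then show "cnorm B (\<phi> a) \<le> t" using t0 by (simp add: pos_divide_le_eq)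
  qed
  have "(cnorm B (\<phi> x))\<^sup>2 = cnorm B (\<phi> (adj A x \<otimes>\<^bsub>A\<^esub> x))"
    using x by (simp add: hom_mult hom_adj B.cnorm_adj_mult)
  also have "\<dots> \<le> cnorm A (adj A x \<otimes>\<^bsub>A\<^esub> x)"
    using x by (intro selfadjoint) (simp_all add: A.adj_mult)
  also have "\<dots> = (cnorm A x)\<^sup>2" using x by (rule A.cnorm_adj_mult)
  finally show ?thesis using x by (simp add: power2_le_iff_abs_le)
qed

lemma hom_conv:
  assumes "A.conv s x"
  shows "B.conv (\<lambda>n. \<phi> (s n)) (\<phi> x)"
proof (rule B.convI_le[OF _ _ _ A.convD(3)[OF assms]])
  show "cnorm B (\<phi> (s n) \<ominus>\<^bsub>B\<^esub> \<phi> x) \<le> cnorm A (s n \<ominus>\<^bsub>A\<^esub> x)" for n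
    using A.convD(1,2)[OF assms] by (simp add: hom_minus[symmetric] cnorm_hom_le)
qed (use A.convD(1,2)[OF assms] in auto)

lemma cstar_subalgebra_preimage:
  assumes "cstar_subalgebra C B"
  shows "cstar_subalgebra {x \<in> carrier A. \<phi> x \<in> C} A"
proof -
  note C = assms[unfolded B.cstar_subalgebra_iff_conv]
  have "\<phi> x \<in> C" if "range s \<subseteq> {x \<in> carrier A. \<phi> x \<in> C}" "A.conv s x" for s x
  proof -
    have "range (\<lambda>n. \<phi> (s n)) \<subseteq> C" using that(1) by auto
    then show ?thesis using C hom_conv[OF that(2)] by blast
  qed
  then show ?thesis
    using C A.convD(2)
    by (auto simp: A.cstar_subalgebra_iff_conv hom_add hom_mult hom_smult hom_adj)
qed

text \<open>Continuity closes the set of agreement under limits; this turns agreement on generators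
  into agreement everywhere.\<close>

lemma cstar_subalgebra_equalizer:
  assumes "\<psi> \<in> unital_star_hom A B"
  shows "cstar_subalgebra {x \<in> carrier A. \<phi> x = \<psi> x} A"
proof -
  interpret psi: star_hom A B \<psi> by unfold_locales (rule assms)
  have "\<phi> x = \<psi> x" if "range s \<subseteq> {x \<in> carrier A. \<phi> x = \<psi> x}" "A.conv s x" for s x
  proof -
    have "(\<lambda>n. \<phi> (s n)) = (\<lambda>n. \<psi> (s n))" using that(1) by auto
    then show ?thesis
      using hom_conv[OF that(2)] psi.hom_conv[OF that(2)] B.conv_unique by metis
  qed
  then show ?thesis
    using A.convD(2)
    by (auto simp: A.cstar_subalgebra_iff_conv hom_add hom_mult hom_smult hom_adj
        psi.hom_add psi.hom_mult psi.hom_smult psi.hom_adj)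
qed

end

text \<open>The isomorphism is the closure of the graph of \<open>\<psi>\<close>.\<close>
lemma cstar_isomorphic_of_dense_isometry:
  assumes A: "cstar_alg A" and B: "cstar_alg B"
    and D: "D \<subseteq> carrier A" "\<one>\<^bsub>A\<^esub> \<in> D"
    and D_add: "\<And>x y. x \<in> D \<Longrightarrow> y \<in> D \<Longrightarrow> x \<oplus>\<^bsub>A\<^esub> y \<in> D \<and> \<psi> (x \<oplus>\<^bsub>A\<^esub> y) = \<psi> x \<oplus>\<^bsub>B\<^esub> \<psi> y"
    and D_mult: "\<And>x y. x \<in> D \<Longrightarrow> y \<in> D \<Longrightarrow> x \<otimes>\<^bsub>A\<^esub> y \<in> D \<and> \<psi> (x \<otimes>\<^bsub>A\<^esub> y) = \<psi> x \<otimes>\<^bsub>B\<^esub> \<psi> y"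
    and D_smult: "\<And>(c::complex) x. x \<in> D \<Longrightarrow> c \<odot>\<^bsub>A\<^esub> x \<in> D \<and> \<psi> (c \<odot>\<^bsub>A\<^esub> x) = c \<odot>\<^bsub>B\<^esub> \<psi> x"
    and D_adj: "\<And>x. x \<in> D \<Longrightarrow> adj A x \<in> D \<and> \<psi> (adj A x) = adj B (\<psi> x)"
    and psi_one: "\<psi> \<one>\<^bsub>A\<^esub> = \<one>\<^bsub>B\<^esub>"
    and psi: "\<And>x. x \<in> D \<Longrightarrow> \<psi> x \<in> carrier B" "\<And>x. x \<in> D \<Longrightarrow> cnorm B (\<psi> x) = cnorm A x"
    and dense_A: "carrier A = cstar_topology A closure_of D"
    and dense_B: "carrier B = cstar_topology B closure_of (\<psi> ` D)"
  shows "cstar_isomorphic A B"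
proof -
  interpret A: cstar_alg A by (rule A)
  interpret B: cstar_alg B by (rule B)
  have DA: "x \<in> carrier A" if "x \<in> D" for x using that D by blast
  define G where "G x y \<longleftrightarrow> (\<exists>s. range s \<subseteq> D \<and> A.conv s x \<and> B.conv (\<lambda>n. \<psi> (s n)) y)" for x y
  have D_minus: "x \<ominus>\<^bsub>A\<^esub> y \<in> D \<and> \<psi> (x \<ominus>\<^bsub>A\<^esub> y) = \<psi> x \<ominus>\<^bsub>B\<^esub> \<psi> y" if "x \<in> D" "y \<in> D" for x y
    using D_add[OF that(1) conjunct1[OF D_smult[OF that(2), of "-1"]]] D_smult[OF that(2), of "-1"] that
    by (simp add: A.smult_minus_1 B.smult_minus_1 a_minus_def DA psi)
  have Cauchy: "cnorm B (\<psi> x \<ominus>\<^bsub>B\<^esub> \<psi> y) = cnorm A (x \<ominus>\<^bsub>A\<^esub> y)" if "x \<in> D" "y \<in> D" for x y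
    using D_minus[OF that] psi(2) by metis
  have G_carrier: "x \<in> carrier A" "y \<in> carrier B" if "G x y" for x y
    using that A.convD(2) B.convD(2) unfolding G_def by blast+
  \<comment> \<open>Isometry passes to the closure of the graph. Equal first components then force
    equal second ones and conversely, which gives a function and its injectivity at once.\<close>
  have G_dist: "cnorm B (y \<ominus>\<^bsub>B\<^esub> y') = cnorm A (x \<ominus>\<^bsub>A\<^esub> x')" if g: "G x y" "G x' y'" for x y x' y'
  proof -
    obtain s t where *: "range s \<subseteq> D" "A.conv s x" "B.conv (\<lambda>n. \<psi> (s n)) y"
      "range t \<subseteq> D" "A.conv t x'" "B.conv (\<lambda>n. \<psi> (t n)) y'"
      using g unfolding G_def by blast
    have "(\<lambda>n. cnorm B (\<psi> (s n) \<ominus>\<^bsub>B\<^esub> \<psi> (t n))) \<longlonglongrightarrow> cnorm B (y \<ominus>\<^bsub>B\<^esub> y')"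
      by (intro B.conv_cnorm B.conv_minus *)
    moreover have "(\<lambda>n. cnorm A (s n \<ominus>\<^bsub>A\<^esub> t n)) \<longlonglongrightarrow> cnorm A (x \<ominus>\<^bsub>A\<^esub> x')"
      by (intro A.conv_cnorm A.conv_minus *)
    moreover have "cnorm B (\<psi> (s n) \<ominus>\<^bsub>B\<^esub> \<psi> (t n)) = cnorm A (s n \<ominus>\<^bsub>A\<^esub> t n)" for n
      using * by (intro Cauchy) auto
    ultimately show ?thesis using LIMSEQ_unique by auto
  qed
  have G_fun: "y = y'" if "G x y" "G x y'" for x y y'
    using G_dist[OF that] G_carrier[OF that(1)] G_carrier[OF that(2)]
    by (simp add: A.minus_eq A.r_neg B.cnorm_eq_0)
  have G_inj: "x = x'" if "G x y" "G x' y" for x x' y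
    using G_dist[OF that] G_carrier[OF that(1)] G_carrier[OF that(2)]
    by (simp add: B.minus_eq B.r_neg A.cnorm_eq_0)
  have G_total: "\<exists>y. G x y" if x: "x \<in> carrier A" for x
  proof -
    obtain s where s: "range s \<subseteq> D" "A.conv s x"
      using x dense_A A.closure_of_iff_conv[OF D(1)] by auto
    then have sD: "s n \<in> D" for n by auto
    have "\<exists>N. \<forall>m\<ge>N. \<forall>n\<ge>N. cnorm B (\<psi> (s m) \<ominus>\<^bsub>B\<^esub> \<psi> (s n)) < e" if "e > 0" for e
      unfolding Cauchy[OF sD sD] using A.conv_Cauchy[OF s(2) that] .
    then obtain y where "B.conv (\<lambda>n. \<psi> (s n)) y" using B.Cauchy_conv[of "\<lambda>n. \<psi> (s n)"] psi(1)[OF sD] by metis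
    then show ?thesis using s unfolding G_def by blast
  qed
  \<comment> \<open>An approximating sequence in the image is lifted to \<open>D\<close>, where
    isometry makes it Cauchy; completeness of \<open>A\<close> then gives a preimage.\<close>
  have G_surj: "\<exists>x. G x y" if y: "y \<in> carrier B" for y
  proof -
    have "\<psi> ` D \<subseteq> carrier B" using psi(1) by blast
    then obtain t where t: "range t \<subseteq> \<psi> ` D" "B.conv t y"
      using y dense_B B.closure_of_iff_conv by auto
    then have "\<forall>n. \<exists>x\<in>D. t n = \<psi> x" by blast
    then obtain s where s: "\<And>n. s n \<in> D" "\<And>n. t n = \<psi> (s n)" by metis
    have "\<exists>N. \<forall>m\<ge>N. \<forall>n\<ge>N. cnorm A (s m \<ominus>\<^bsub>A\<^esub> s n) < e" if "e > 0" for e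
      using B.conv_Cauchy[OF t(2) that] unfolding s(2) Cauchy[OF s(1) s(1)] .
    then obtain x where "A.conv s x" using A.Cauchy_conv[of s] DA[OF s(1)] by metis
    moreover have "t = (\<lambda>n. \<psi> (s n))" using s(2) by auto
    ultimately show ?thesis using s(1) t(2) unfolding G_def by blast
  qed
  define \<Psi> where "\<Psi> x = (THE y. G x y)" for x
  have Psi_eq: "\<Psi> x = y" if "G x y" for x y
    unfolding \<Psi>_def using that G_fun by blast
  have Psi: "G x (\<Psi> x)" if "x \<in> carrier A" for x
    using G_total[OF that] Psi_eq by metis
  have G_add: "G (x \<oplus>\<^bsub>A\<^esub> x') (y \<oplus>\<^bsub>B\<^esub> y')" and G_mult: "G (x \<otimes>\<^bsub>A\<^esub> x') (y \<otimes>\<^bsub>B\<^esub> y')"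
    if g: "G x y" "G x' y'" for x y x' y'
  proof -
    obtain s t where *: "range s \<subseteq> D" "A.conv s x" "B.conv (\<lambda>n. \<psi> (s n)) y"
      "range t \<subseteq> D" "A.conv t x'" "B.conv (\<lambda>n. \<psi> (t n)) y'"
      using g unfolding G_def by blast
    then have D': "s n \<in> D" "t n \<in> D" for n by auto
    note add = D_add[OF D'] and mult = D_mult[OF D']
    show "G (x \<oplus>\<^bsub>A\<^esub> x') (y \<oplus>\<^bsub>B\<^esub> y')"
      unfolding G_def
      using add B.conv_add[OF *(3) *(6)] A.conv_add[OF *(2) *(5)]
      by (intro exI[of _ "\<lambda>n. s n \<oplus>\<^bsub>A\<^esub> t n"]) auto
    show "G (x \<otimes>\<^bsub>A\<^esub> x') (y \<otimes>\<^bsub>B\<^esub> y')"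
      unfolding G_def
      using mult B.conv_mult[OF *(3) *(6)] A.conv_mult[OF *(2) *(5)]
      by (intro exI[of _ "\<lambda>n. s n \<otimes>\<^bsub>A\<^esub> t n"]) auto
  qed
  have G_smult: "G (c \<odot>\<^bsub>A\<^esub> x) (c \<odot>\<^bsub>B\<^esub> y)" and G_adj: "G (adj A x) (adj B y)"
    if g: "G x y" for x y and c :: complex
  proof -
    obtain s where *: "range s \<subseteq> D" "A.conv s x" "B.conv (\<lambda>n. \<psi> (s n)) y"
      using g unfolding G_def by blast
    then have D': "s n \<in> D" for n by auto
    show "G (c \<odot>\<^bsub>A\<^esub> x) (c \<odot>\<^bsub>B\<^esub> y)"
      unfolding G_def
      using D_smult[OF D', of c] B.conv_smult[OF *(3)] A.conv_smult[OF *(2)]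
      by (intro exI[of _ "\<lambda>n. c \<odot>\<^bsub>A\<^esub> s n"]) auto
    show "G (adj A x) (adj B y)"
      unfolding G_def
      using D_adj[OF D'] B.conv_adj[OF *(3)] A.conv_adj[OF *(2)]
      by (intro exI[of _ "\<lambda>n. adj A (s n)"]) auto
  qed
  have G_one: "G \<one>\<^bsub>A\<^esub> \<one>\<^bsub>B\<^esub>"
    unfolding G_def using D(2) psi_one A.conv_const[of "\<one>\<^bsub>A\<^esub>"] B.conv_const[of "\<one>\<^bsub>B\<^esub>"]
    by (intro exI[of _ "\<lambda>_. \<one>\<^bsub>A\<^esub>"]) auto
  have "\<Psi> \<in> unital_star_hom A B"
    unfolding unital_star_hom_def ring_hom_def
    using Psi_eq[OF G_add[OF Psi Psi]] Psi_eq[OF G_mult[OF Psi Psi]] Psi_eq[OF G_smult[OF Psi]]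
      Psi_eq[OF G_adj[OF Psi]] Psi_eq[OF G_one] G_carrier(2)[OF Psi]
    by simp
  moreover have "bij_betw \<Psi> (carrier A) (carrier B)"
  proof (intro bij_betwI' )
    show "(\<Psi> x = \<Psi> y) = (x = y)" if "x \<in> carrier A" "y \<in> carrier A" for x y
      using G_inj[of x "\<Psi> x" y] Psi[OF that(1)] Psi[OF that(2)] by auto
    show "\<Psi> x \<in> carrier B" if "x \<in> carrier A" for x using G_carrier(2)[OF Psi[OF that]] .
    show "\<exists>x\<in>carrier A. y = \<Psi> x" if "y \<in> carrier B" for y
      using G_surj[OF that] Psi_eq G_carrier(1) by blast
  qed
  ultimately show ?thesis unfolding cstar_isomorphic_def by blast
qed

section \<open>The Hilbert space \<open>l\<^sup>2(S)\<close>\<close>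

lemma l2_off: "f \<in> l2 S \<Longrightarrow> x \<notin> S \<Longrightarrow> f x = 0"
  by (simp add: l2_def)

lemma l2_eqI: "f \<in> l2 S \<Longrightarrow> g \<in> l2 S \<Longrightarrow> (\<And>x. x \<in> S \<Longrightarrow> f x = g x) \<Longrightarrow> f = g"
  by (rule ext) (metis l2_off)

lemma l2_norm_nonneg [simp]: "0 \<le> l2_norm S f"
  by (simp add: l2_norm_def infsum_nonneg)

lemma l2_norm_square: "(l2_norm S f)\<^sup>2 = (\<Sum>\<^sub>\<infinity>x\<in>S. (cmod (f x))\<^sup>2)"
  by (simp add: l2_norm_def infsum_nonneg)

lemma L2_set_le_l2_norm:
  assumes "f \<in> l2 S" "finite F" "F \<subseteq> S"
  shows "L2_set (\<lambda>x. cmod (f x)) F \<le> l2_norm S f"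
proof -
  have "(\<Sum>x\<in>F. (cmod (f x))\<^sup>2) \<le> (\<Sum>\<^sub>\<infinity>x\<in>S. (cmod (f x))\<^sup>2)"
    using assms by (intro finite_sum_le_infsum) (auto simp: l2_def)
  then show ?thesis by (simp add: L2_set_def l2_norm_def)
qed

text \<open>A uniform bound on finite partial sums yields square summability and the norm bound
  together, so the finite-dimensional inequalities for \<open>L2_set\<close> carry over to
  \<open>l2\<close>.\<close>

lemma
  assumes "\<And>x. x \<notin> S \<Longrightarrow> f x = 0"
    and le: "\<And>F. finite F \<Longrightarrow> F \<subseteq> S \<Longrightarrow> L2_set (\<lambda>x. cmod (f x)) F \<le> C"
  shows l2I: "f \<in> l2 S" and l2_norm_leI: "l2_norm S f \<le> C"
proof -
  have C: "0 \<le> C" using le[of "{}"] by simp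
  have bound: "(\<Sum>x\<in>F. (cmod (f x))\<^sup>2) \<le> C\<^sup>2" if "finite F" "F \<subseteq> S" for F
    using le[OF that] unfolding L2_set_def by (rule sqrt_le_D)
  have "(\<lambda>x. (cmod (f x))\<^sup>2) summable_on S"
    by (rule nonneg_bdd_above_summable_on) (use bound in \<open>auto intro!: bdd_aboveI[of _ "C\<^sup>2"]\<close>)
  then show "f \<in> l2 S" using assms(1) by (simp add: l2_def)
  have "(\<Sum>\<^sub>\<infinity>x\<in>S. (cmod (f x))\<^sup>2) \<le> C\<^sup>2"
    by (rule infsum_le_finite_sums[OF \<open>_ summable_on S\<close>]) (rule bound)
  then show "l2_norm S f \<le> C" using C unfolding l2_norm_def by (simp add: real_le_lsqrt)
qed

lemma l2_zero [simp]: "(\<lambda>x. 0) \<in> l2 S"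
  by (simp add: l2_def)

lemma l2_norm_zero [simp]: "l2_norm S (\<lambda>x. 0) = 0"
  by (simp add: l2_norm_def)

lemma
  assumes "f \<in> l2 S" "g \<in> l2 S"
  shows l2_add [simp]: "(\<lambda>x. f x + g x) \<in> l2 S"
    and l2_norm_triangle: "l2_norm S (\<lambda>x. f x + g x) \<le> l2_norm S f + l2_norm S g"
proof -
  have "L2_set (\<lambda>x. cmod (f x + g x)) F \<le> l2_norm S f + l2_norm S g" if "finite F" "F \<subseteq> S" for F
  proof -
    have "L2_set (\<lambda>x. cmod (f x + g x)) F \<le> L2_set (\<lambda>x. cmod (f x) + cmod (g x)) F"
      by (rule L2_set_mono) (auto simp: norm_triangle_ineq)
    also have "\<dots> \<le> L2_set (\<lambda>x. cmod (f x)) F + L2_set (\<lambda>x. cmod (g x)) F"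
      by (rule L2_set_triangle_ineq)
    also have "\<dots> \<le> l2_norm S f + l2_norm S g"
      using assms that by (intro add_mono L2_set_le_l2_norm)
    finally show ?thesis .
  qed
  then show "(\<lambda>x. f x + g x) \<in> l2 S" "l2_norm S (\<lambda>x. f x + g x) \<le> l2_norm S f + l2_norm S g"
    using l2_off[OF assms(1)] l2_off[OF assms(2)] by (auto intro!: l2I l2_norm_leI)
qed

lemma l2_smult [simp]: "f \<in> l2 S \<Longrightarrow> (\<lambda>x. c * f x) \<in> l2 S"
  by (auto simp: l2_def norm_mult power_mult_distrib intro!: summable_on_cmult_right)

lemma l2_norm_smult: "l2_norm S (\<lambda>x. c * f x) = cmod c * l2_norm S f"
  by (simp add: l2_norm_def norm_mult power_mult_distrib infsum_cmult_right' real_sqrt_mult)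

lemma l2_uminus [simp]: "f \<in> l2 S \<Longrightarrow> (\<lambda>x. - f x) \<in> l2 S"
  using l2_smult[of f S "-1"] by simp

lemma l2_diff [simp]: "f \<in> l2 S \<Longrightarrow> g \<in> l2 S \<Longrightarrow> (\<lambda>x. f x - g x) \<in> l2 S"
  using l2_add[of f S "\<lambda>x. - g x"] by simp

lemma cmod_le_l2_norm:
  assumes "f \<in> l2 S"
  shows "cmod (f x) \<le> l2_norm S f"
  using L2_set_le_l2_norm[OF assms, of "{x}"] l2_off[OF assms, of x] by (cases "x \<in> S") auto

lemma l2_norm_eq_0: "f \<in> l2 S \<Longrightarrow> l2_norm S f = 0 \<longleftrightarrow> f = (\<lambda>x. 0)"
  using cmod_le_l2_norm[of f S] by fastforce

lemma
  assumes f: "f \<in> l2 S" and g: "g \<in> l2 S"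
  shows l2_inner_abs_summable: "(\<lambda>x. norm (f x * cnj (g x))) summable_on S"
    and cmod_l2_inner_le: "cmod (l2_inner S f g) \<le> l2_norm S f * l2_norm S g"
proof -
  have bound: "(\<Sum>x\<in>F. norm (f x * cnj (g x))) \<le> l2_norm S f * l2_norm S g" if "finite F" "F \<subseteq> S" for F
  proof -
    have "(\<Sum>x\<in>F. norm (f x * cnj (g x))) = (\<Sum>x\<in>F. \<bar>cmod (f x)\<bar> * \<bar>cmod (g x)\<bar>)"
      by (simp add: norm_mult)
    also have "\<dots> \<le> L2_set (\<lambda>x. cmod (f x)) F * L2_set (\<lambda>x. cmod (g x)) F"
      by (rule L2_set_mult_ineq)
    also have "\<dots> \<le> l2_norm S f * l2_norm S g"
      using assms that by (intro mult_mono L2_set_le_l2_norm) auto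
    finally show ?thesis .
  qed
  show *: "(\<lambda>x. norm (f x * cnj (g x))) summable_on S"
    by (rule nonneg_bdd_above_summable_on)
       (use bound in \<open>auto intro!: bdd_aboveI[of _ "l2_norm S f * l2_norm S g"]\<close>)
  have "cmod (l2_inner S f g) \<le> (\<Sum>\<^sub>\<infinity>x\<in>S. norm (f x * cnj (g x)))"
    unfolding l2_inner_def using * by (rule norm_infsum_bound)
  also have "\<dots> \<le> l2_norm S f * l2_norm S g"
    using * bound by (rule infsum_le_finite_sums)
  finally show "cmod (l2_inner S f g) \<le> l2_norm S f * l2_norm S g" .
qed

lemmas l2_inner_summable = l2_inner_abs_summable[THEN abs_summable_summable]

lemma l2_inner_commute: "l2_inner S g f = cnj (l2_inner S f g)"
  unfolding l2_inner_def by (simp add: mult.commute flip: infsum_cnj)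

lemma l2_inner_add_left:
  "f \<in> l2 S \<Longrightarrow> f' \<in> l2 S \<Longrightarrow> g \<in> l2 S \<Longrightarrow>
    l2_inner S (\<lambda>x. f x + f' x) g = l2_inner S f g + l2_inner S f' g"
  by (simp add: l2_inner_def ring_distribs infsum_add l2_inner_summable)

lemma l2_inner_smult_left: "l2_inner S (\<lambda>x. c * f x) g = c * l2_inner S f g"
  by (simp add: l2_inner_def infsum_cmult_right' mult.assoc)

lemma l2_inner_diff_left:
  "f \<in> l2 S \<Longrightarrow> f' \<in> l2 S \<Longrightarrow> g \<in> l2 S \<Longrightarrow>
    l2_inner S (\<lambda>x. f x - f' x) g = l2_inner S f g - l2_inner S f' g"
  using l2_inner_add_left[of f S "\<lambda>x. - f' x" g] l2_inner_smult_left[of S "-1" f' g] by simp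

lemma l2_inner_add_right:
  "f \<in> l2 S \<Longrightarrow> g \<in> l2 S \<Longrightarrow> g' \<in> l2 S \<Longrightarrow>
    l2_inner S f (\<lambda>x. g x + g' x) = l2_inner S f g + l2_inner S f g'"
  by (subst (1 2 3) l2_inner_commute) (simp add: l2_inner_add_left)

lemma l2_inner_smult_right: "l2_inner S f (\<lambda>x. c * g x) = cnj c * l2_inner S f g"
  by (subst (1 2) l2_inner_commute) (simp add: l2_inner_smult_left)

lemma l2_inner_self: "f \<in> l2 S \<Longrightarrow> l2_inner S f f = complex_of_real ((l2_norm S f)\<^sup>2)"
  unfolding l2_norm_square l2_inner_def l2_def
  by (auto simp: complex_norm_square[symmetric] simp flip: of_real_power
      intro!: infsumI has_sum_of_real)

lemma infsum_single:
  fixes f :: "'i \<Rightarrow> 'b :: {comm_monoid_add, t2_space}"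
  assumes "h \<in> S" "\<And>x. x \<in> S \<Longrightarrow> x \<noteq> h \<Longrightarrow> f x = 0"
  shows "infsum f S = f h"
proof -
  have "infsum f S = infsum f {h}"
    by (rule infsum_cong_neutral) (use assms in auto)
  then show ?thesis by simp
qed

lemma l2_inner_basis_right: "h \<in> S \<Longrightarrow> l2_inner S f (l2_basis h) = f h"
  unfolding l2_inner_def by (subst infsum_single[of h]) (auto simp: l2_basis_def)

lemma l2_inner_basis_left: "h \<in> S \<Longrightarrow> l2_inner S (l2_basis h) f = cnj (f h)"
  by (subst l2_inner_commute) (simp add: l2_inner_basis_right)

lemma l2_norm_basis: "h \<in> S \<Longrightarrow> l2_norm S (l2_basis h) = 1"
  unfolding l2_norm_def by (subst infsum_single[of h]) (auto simp: l2_basis_def)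

text \<open>Finite combinations of basis vectors are dense. The rule serves both for identities
  continuous in the vector and for membership in a norm closed set.\<close>

lemma l2_dense_induct [consumes 1, case_names zero basis add smult closed]:
  assumes f: "f \<in> l2 S"
    and zero: "P (\<lambda>x. 0)"
    and basis: "\<And>h. h \<in> S \<Longrightarrow> P (l2_basis h)"
    and add: "\<And>f g. f \<in> l2 S \<Longrightarrow> g \<in> l2 S \<Longrightarrow> P f \<Longrightarrow> P g \<Longrightarrow> P (\<lambda>x. f x + g x)"
    and smult: "\<And>c f. f \<in> l2 S \<Longrightarrow> P f \<Longrightarrow> P (\<lambda>x. c * f x)"
    and closed: "\<And>f. f \<in> l2 S \<Longrightarrow>
      (\<And>e. e > 0 \<Longrightarrow> \<exists>g. g \<in> l2 S \<and> P g \<and> l2_norm S (\<lambda>x. f x - g x) < e) \<Longrightarrow> P f"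
  shows "P f"
proof (rule closed[OF f])
  have fin: "(\<lambda>x. if x \<in> F then f x else 0) \<in> l2 S \<and> P (\<lambda>x. if x \<in> F then f x else 0)"
    if "finite F" "F \<subseteq> S" for F
    using that
  proof (induction F)
    case (insert h F)
    let ?g = "\<lambda>x. if x \<in> F then f x else 0" and ?b = "\<lambda>x. f h * l2_basis h x"
    have "(\<lambda>x. if x \<in> insert h F then f x else 0) = (\<lambda>x. ?g x + ?b x)"
      using insert.hyps by (auto simp: l2_basis_def)
    moreover have "?b \<in> l2 S" "P ?b"
      using insert.prems by (auto intro!: smult basis l2_smult l2_basis_in_l2)
    ultimately show ?case using insert add[of ?g ?b] by simp
  qed (simp add: zero)
  fix e :: real assume e: "e > 0"
  have sum: "(\<lambda>x. (cmod (f x))\<^sup>2) summable_on S" using f by (simp add: l2_def)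
  \<comment> \<open>The squared distance to the truncation is the tail of the series; aiming at half
    of e^2 makes the final inequality strict.\<close>
  obtain F where F: "finite F" "F \<subseteq> S"
    and approx: "dist (\<Sum>x\<in>F. (cmod (f x))\<^sup>2) (\<Sum>\<^sub>\<infinity>x\<in>S. (cmod (f x))\<^sup>2) \<le> e\<^sup>2 / 2"
    using infsum_finite_approximation[OF sum, of "e\<^sup>2 / 2"] e by auto
  let ?g = "\<lambda>x. if x \<in> F then f x else 0"
  have "(l2_norm S (\<lambda>x. f x - ?g x))\<^sup>2 = (\<Sum>\<^sub>\<infinity>x\<in>S - F. (cmod (f x))\<^sup>2)"
    unfolding l2_norm_square by (rule infsum_cong_neutral) auto
  also have "\<dots> = (\<Sum>\<^sub>\<infinity>x\<in>S. (cmod (f x))\<^sup>2) - (\<Sum>x\<in>F. (cmod (f x))\<^sup>2)"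
    using infsum_Diff[OF sum, of F] F by (simp add: summable_on_finite)
  also have "\<dots> \<le> e\<^sup>2 / 2" using approx unfolding dist_real_def by linarith
  also have "\<dots> < e\<^sup>2" using e by simp
  finally have "l2_norm S (\<lambda>x. f x - ?g x) < e" using e by (simp add: power2_less_imp_less)
  then show "\<exists>g. g \<in> l2 S \<and> P g \<and> l2_norm S (\<lambda>x. f x - g x) < e" using fin[OF F] by blast
qed

section \<open>The algebra of bounded operators\<close>

lemma bounded_opsD:
  assumes "A \<in> bounded_ops S"
  shows bounded_ops_closed: "f \<in> l2 S \<Longrightarrow> A f \<in> l2 S"
    and bounded_ops_add: "f \<in> l2 S \<Longrightarrow> g \<in> l2 S \<Longrightarrow> A (\<lambda>x. f x + g x) = (\<lambda>x. A f x + A g x)"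
    and bounded_ops_smult: "f \<in> l2 S \<Longrightarrow> A (\<lambda>x. c * f x) = (\<lambda>x. c * A f x)"
    and bounded_ops_off: "f \<notin> l2 S \<Longrightarrow> A f = (\<lambda>x. 0)"
  using assms by (auto simp: bounded_ops_def)

lemma bounded_ops_zero: "A \<in> bounded_ops S \<Longrightarrow> A (\<lambda>x. 0) = (\<lambda>x. 0)"
  using bounded_ops_smult[of A S "\<lambda>x. 0" 0] by simp

lemma bounded_ops_diff:
  "A \<in> bounded_ops S \<Longrightarrow> f \<in> l2 S \<Longrightarrow> g \<in> l2 S \<Longrightarrow> A (\<lambda>x. f x - g x) = (\<lambda>x. A f x - A g x)"
  using bounded_ops_add[of A S f "\<lambda>x. -1 * g x"] bounded_ops_smult[of A S g "-1"] by simp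

lemma bounded_opsI:
  assumes "\<And>f. f \<in> l2 S \<Longrightarrow> A f \<in> l2 S"
    and "\<And>f g. f \<in> l2 S \<Longrightarrow> g \<in> l2 S \<Longrightarrow> A (\<lambda>x. f x + g x) = (\<lambda>x. A f x + A g x)"
    and "\<And>c f. f \<in> l2 S \<Longrightarrow> A (\<lambda>x. c * f x) = (\<lambda>x. c * A f x)"
    and "\<And>f. f \<in> l2 S \<Longrightarrow> l2_norm S (A f) \<le> C * l2_norm S f"
    and "\<And>f. f \<notin> l2 S \<Longrightarrow> A f = (\<lambda>x. 0)"
  shows "A \<in> bounded_ops S"
  using assms by (auto simp: bounded_ops_def intro!: exI[of _ C])

lemma bounded_ops_eqI:
  "A \<in> bounded_ops S \<Longrightarrow> B \<in> bounded_ops S \<Longrightarrow> (\<And>f. f \<in> l2 S \<Longrightarrow> A f = B f) \<Longrightarrow> A = B"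
proof (rule ext)
  fix f assume *: "A \<in> bounded_ops S" "B \<in> bounded_ops S" "\<And>f. f \<in> l2 S \<Longrightarrow> A f = B f"
  show "A f = B f"
    by (cases "f \<in> l2 S") (use * in \<open>simp_all add: bounded_ops_off\<close>)
qed

text \<open>Boundedness makes the supremum over the unit ball finite, and scaling a nonzero vector
  into the ball gives the inequality for all vectors.\<close>

lemma
  assumes A: "A \<in> bounded_ops S"
  shows op_norm_nonneg: "0 \<le> op_norm S A"
    and l2_norm_le_op_norm: "f \<in> l2 S \<Longrightarrow> l2_norm S (A f) \<le> op_norm S A * l2_norm S f"
proof -
  obtain C where C: "\<And>f. f \<in> l2 S \<Longrightarrow> l2_norm S (A f) \<le> C * l2_norm S f"
    using A unfolding bounded_ops_def by blast
  have C': "l2_norm S (A f) \<le> \<bar>C\<bar> * 1" if "f \<in> l2 S" "l2_norm S f \<le> 1" for f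
    using C[OF that(1)] mult_mono[OF abs_ge_self[of C] that(2)] by simp
  have bdd: "bdd_above ((\<lambda>f. l2_norm S (A f)) ` {f \<in> l2 S. l2_norm S f \<le> 1})"
    using C' by (auto intro!: bdd_aboveI[of _ "\<bar>C\<bar>"])
  have unit: "l2_norm S (A f) \<le> op_norm S A" if "f \<in> l2 S" "l2_norm S f \<le> 1" for f
    unfolding op_norm_def by (rule cSUP_upper[OF _ bdd]) (use that in auto)
  show "0 \<le> op_norm S A" using unit[of "\<lambda>x. 0"] by (simp add: bounded_ops_zero[OF A])
  show "l2_norm S (A f) \<le> op_norm S A * l2_norm S f" if f: "f \<in> l2 S"
  proof (cases "l2_norm S f = 0")
    case True
    then show ?thesis using f by (simp add: l2_norm_eq_0 bounded_ops_zero[OF A])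
  next
    case False
    let ?c = "complex_of_real (1 / l2_norm S f)"
    have pos: "0 < l2_norm S f" using False l2_norm_nonneg[of S f] by linarith
    have "l2_norm S (\<lambda>x. ?c * f x) \<le> 1" using pos by (simp only: l2_norm_smult norm_of_real) simp
    from unit[OF l2_smult[OF f] this] have "1 / l2_norm S f * l2_norm S (A f) \<le> op_norm S A"
      using pos by (simp only: bounded_ops_smult[OF A f] l2_norm_smult norm_of_real) simp
    then show ?thesis using pos by (simp add: field_simps)
  qed
qed

lemma op_norm_leI:
  assumes "0 \<le> C" "\<And>f. f \<in> l2 S \<Longrightarrow> l2_norm S (A f) \<le> C * l2_norm S f"
  shows "op_norm S A \<le> C"
  unfolding op_norm_def
proof (rule cSUP_least)
  have "(\<lambda>x. 0) \<in> {f \<in> l2 S. l2_norm S f \<le> 1}" by simp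
  then show "{f \<in> l2 S. l2_norm S f \<le> 1} \<noteq> {}" by blast
  show "l2_norm S (A f) \<le> C" if "f \<in> {f \<in> l2 S. l2_norm S f \<le> 1}" for f
    using assms(2)[of f] mult_left_mono[of "l2_norm S f" 1 C] assms(1) that by auto
qed

lemma op_norm_eq_0: "A \<in> bounded_ops S \<Longrightarrow> op_norm S A = 0 \<longleftrightarrow> A = (\<lambda>f x. 0)"
proof
  assume A: "A \<in> bounded_ops S" and 0: "op_norm S A = 0"
  show "A = (\<lambda>f x. 0)"
  proof
    fix f show "A f = (\<lambda>x. 0)"
    proof (cases "f \<in> l2 S")
      case True
      have "l2_norm S (A f) = 0" 
        using l2_norm_le_op_norm[OF A True] 0 l2_norm_nonneg[of S "A f"] by simp
      then show ?thesis by (simp add: l2_norm_eq_0 bounded_ops_closed[OF A True])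
    qed (simp add: bounded_ops_off[OF A])
  qed
next
  assume A: "A \<in> bounded_ops S" and "A = (\<lambda>f x. 0)"
  then have "op_norm S A \<le> 0" by (intro op_norm_leI) auto
  then show "op_norm S A = 0" using op_norm_nonneg[OF A] by simp
qed

lemma op_add_closed:
  assumes "A \<in> bounded_ops S" "B \<in> bounded_ops S"
  shows "(\<lambda>f x. A f x + B f x) \<in> bounded_ops S"
    and "op_norm S (\<lambda>f x. A f x + B f x) \<le> op_norm S A + op_norm S B"
proof -
  have le: "l2_norm S (\<lambda>x. A f x + B f x) \<le> (op_norm S A + op_norm S B) * l2_norm S f" if "f \<in> l2 S" for f
    using l2_norm_triangle[of "A f" S "B f"] that l2_norm_le_op_norm[OF assms(1) that]
      l2_norm_le_op_norm[OF assms(2) that] assms by (simp add: bounded_ops_closed distrib_right)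
  show "(\<lambda>f x. A f x + B f x) \<in> bounded_ops S"
    by (rule bounded_opsI[OF _ _ _ le])
       (simp_all add: bounded_opsD[OF assms(1)] bounded_opsD[OF assms(2)] algebra_simps)
  show "op_norm S (\<lambda>f x. A f x + B f x) \<le> op_norm S A + op_norm S B"
    using le assms by (intro op_norm_leI) (auto simp: op_norm_nonneg)
qed

text \<open>Homogeneity of the norm comes from the upper bound used twice, for \<open>c\<close> and
  for \<open>inverse c\<close>.\<close>

lemma op_smult_closed:
  assumes "A \<in> bounded_ops S"
  shows "(\<lambda>f x. c * A f x) \<in> bounded_ops S"
    and "op_norm S (\<lambda>f x. c * A f x) = cmod c * op_norm S A"
proof -
  have le: "l2_norm S (\<lambda>x. c * B f x) \<le> (cmod c * op_norm S B) * l2_norm S f"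
    if "f \<in> l2 S" "B \<in> bounded_ops S" for f c B
    using l2_norm_le_op_norm[OF that(2,1)] by (simp add: l2_norm_smult mult_left_mono mult.assoc)
  have closed: "(\<lambda>f x. c * A f x) \<in> bounded_ops S" for c
    by (rule bounded_opsI[OF _ _ _ le]) (simp_all add: assms bounded_opsD[OF assms] algebra_simps)
  have norm_le: "op_norm S (\<lambda>f x. c * B f x) \<le> cmod c * op_norm S B" if "B \<in> bounded_ops S" for c B
    using le[OF _ that] that by (intro op_norm_leI) (auto simp: op_norm_nonneg)
  show "(\<lambda>f x. c * A f x) \<in> bounded_ops S" by (rule closed)
  show "op_norm S (\<lambda>f x. c * A f x) = cmod c * op_norm S A"
  proof (cases "c = 0")
    case True
    then show ?thesis using norm_le[OF assms, of c] op_norm_nonneg[OF closed[of c]] by simp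
  next
    case False
    have "op_norm S A = op_norm S (\<lambda>f x. inverse c * (c * A f x))"
      using False by (simp add: mult.assoc[symmetric])
    also have "\<dots> \<le> cmod (inverse c) * op_norm S (\<lambda>f x. c * A f x)"
      by (rule norm_le[OF closed])
    finally have "cmod c * op_norm S A \<le> op_norm S (\<lambda>f x. c * A f x)"
      using False by (simp add: norm_inverse norm_divide field_simps)
    then show ?thesis using norm_le[OF assms, of c] by simp
  qed
qed

lemma op_mult_closed:
  assumes "A \<in> bounded_ops S" "B \<in> bounded_ops S"
  shows "A \<circ> B \<in> bounded_ops S"
    and "op_norm S (A \<circ> B) \<le> op_norm S A * op_norm S B"
proof -
  have le: "l2_norm S ((A \<circ> B) f) \<le> (op_norm S A * op_norm S B) * l2_norm S f" if "f \<in> l2 S" for f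
  proof -
    have "l2_norm S ((A \<circ> B) f) \<le> op_norm S A * l2_norm S (B f)"
      using l2_norm_le_op_norm[OF assms(1) bounded_ops_closed[OF assms(2) that]] by simp
    also have "\<dots> \<le> op_norm S A * (op_norm S B * l2_norm S f)"
      using l2_norm_le_op_norm[OF assms(2) that] op_norm_nonneg[OF assms(1)] by (rule mult_left_mono)
    finally show ?thesis by (simp add: mult.assoc)
  qed
  show "A \<circ> B \<in> bounded_ops S"
    by (rule bounded_opsI[OF _ _ _ le])
       (simp_all add: bounded_opsD[OF assms(1)] bounded_opsD[OF assms(2)] bounded_ops_zero[OF assms(1)])
  show "op_norm S (A \<circ> B) \<le> op_norm S A * op_norm S B"
    using le assms by (intro op_norm_leI) (auto simp: op_norm_nonneg)
qed

lemma op_one_closed: "(\<lambda>f. if f \<in> l2 S then f else (\<lambda>x. 0)) \<in> bounded_ops S"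
  by (rule bounded_opsI[of _ _ 1]) auto

lemma op_zero_closed: "(\<lambda>f x. 0) \<in> bounded_ops S"
  by (rule bounded_opsI[of _ _ 0]) auto

lemma op_adjoint_unique:
  assumes "B \<in> bounded_ops S" "B' \<in> bounded_ops S"
    and "\<And>f g. f \<in> l2 S \<Longrightarrow> g \<in> l2 S \<Longrightarrow> l2_inner S f (B g) = l2_inner S f (B' g)"
  shows "B = B'"
proof (rule bounded_ops_eqI[OF assms(1,2)])
  fix g assume g: "g \<in> l2 S"
  have "B g x = B' g x" if "x \<in> S" for x
    using assms(3)[OF l2_basis_in_l2[OF that] g] that by (simp add: l2_inner_basis_left)
  then show "B g = B' g"
    using bounded_ops_closed[OF assms(1) g] bounded_ops_closed[OF assms(2) g] by (rule l2_eqI[rotated 2])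
qed

text \<open>The coordinate of \<open>A\<^sup>* g\<close> at \<open>x\<close> is \<open>\<langle>g, A e\<^sub>x\<rangle>\<close>.\<close>
lemma op_adjoint_exists:
  assumes A: "A \<in> bounded_ops S"
  shows "\<exists>B. B \<in> bounded_ops S \<and> (\<forall>f\<in>l2 S. \<forall>g\<in>l2 S. l2_inner S (A f) g = l2_inner S f (B g))"
proof -
  define B where "B g = (if g \<in> l2 S then (\<lambda>x. if x \<in> S then l2_inner S g (A (l2_basis x)) else 0) else (\<lambda>x. 0))"
    for g :: "'a \<Rightarrow> complex"
  let ?C = "op_norm S A"
  have C: "0 \<le> ?C" by (rule op_norm_nonneg[OF A])
  note Ab = bounded_ops_closed[OF A l2_basis_in_l2]
  \<comment> \<open>Test against the truncation h of \<open>B g\<close> to F: |h|^2 = <g, A h> <=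
    |g| |A| |h|, and one factor |h| cancels. The bound is uniform in F, so \<open>B g\<close> is
    square summable.\<close>
  have bound: "L2_set (\<lambda>x. cmod (B g x)) F \<le> ?C * l2_norm S g"
    if g: "g \<in> l2 S" and F: "finite F" "F \<subseteq> S" for g F
  proof -
    let ?h = "\<lambda>F x. if x \<in> F then B g x else 0"
    have h: "?h F \<in> l2 S \<and> l2_inner S g (A (?h F)) = of_real (\<Sum>x\<in>F. (cmod (B g x))\<^sup>2)"
      using F
    proof (induction F)
      case empty
      then show ?case by (simp add: bounded_ops_zero[OF A] l2_inner_def)
    next
      case (insert y F)
      have eq: "?h (insert y F) = (\<lambda>x. B g y * l2_basis y x + ?h F x)"
        using insert.hyps by (auto simp: l2_basis_def)
      have y: "y \<in> S" using insert.prems by simp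
      have "l2_inner S g (A (?h (insert y F))) = cnj (B g y) * l2_inner S g (A (l2_basis y)) + l2_inner S g (A (?h F))"
        unfolding eq using insert y g Ab[OF y]
        by (simp add: bounded_ops_add[OF A] bounded_ops_smult[OF A] l2_basis_in_l2
            l2_inner_add_right l2_inner_smult_right bounded_ops_closed[OF A])
      also have "l2_inner S g (A (l2_basis y)) = B g y" using g y by (simp add: B_def)
      also have "cnj (B g y) * B g y = of_real ((cmod (B g y))\<^sup>2)"
        by (simp add: complex_norm_square mult.commute del: of_real_power)
      finally have "l2_inner S g (A (?h (insert y F))) = of_real (\<Sum>x\<in>insert y F. (cmod (B g x))\<^sup>2)"
        using insert by simp
      moreover have "?h (insert y F) \<in> l2 S"
        unfolding eq using insert y by (intro l2_add l2_smult l2_basis_in_l2) auto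
      ultimately show ?case by blast
    qed
    let ?L = "L2_set (\<lambda>x. cmod (B g x)) F"
    have L2: "?L\<^sup>2 = (\<Sum>x\<in>F. (cmod (B g x))\<^sup>2)" by (simp add: L2_set_def sum_nonneg)
    have "(l2_norm S (?h F))\<^sup>2 = ?L\<^sup>2"
    proof -
      have "(l2_norm S (?h F))\<^sup>2 = (\<Sum>\<^sub>\<infinity>x\<in>F. (cmod (B g x))\<^sup>2)"
        unfolding l2_norm_square by (rule infsum_cong_neutral) (use F in auto)
      then show ?thesis using F by (simp add: L2)
    qed
    then have nh: "l2_norm S (?h F) = ?L" by (simp add: L2_set_nonneg power2_eq_iff_nonneg)
    have "?L\<^sup>2 = cmod (l2_inner S g (A (?h F)))" using h L2 by (simp del: of_real_sum add: sum_nonneg)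
    also have "\<dots> \<le> l2_norm S g * l2_norm S (A (?h F))"
      using g h by (intro cmod_l2_inner_le) (auto simp: bounded_ops_closed[OF A])
    also have "\<dots> \<le> l2_norm S g * (?C * ?L)"
      using l2_norm_le_op_norm[OF A conjunct1[OF h]] nh by (intro mult_left_mono) auto
    finally have "?L * ?L \<le> (?C * l2_norm S g) * ?L" by (simp add: power2_eq_square mult_ac)
    then show ?thesis
    proof (cases "?L = 0")
      case False
      then have "?L > 0" using L2_set_nonneg[of "\<lambda>x. cmod (B g x)" F] by linarith
      then show ?thesis using \<open>?L * ?L \<le> _\<close> by (rule_tac mult_right_le_imp_le)
    qed (use C in simp)
  qed
  have off: "B g x = 0" if "x \<notin> S" for g x using that by (simp add: B_def)
  have B_l2: "B g \<in> l2 S" and B_norm: "l2_norm S (B g) \<le> ?C * l2_norm S g" if "g \<in> l2 S" for g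
    by (rule l2I l2_norm_leI, erule off, erule (1) bound[OF that])+
  have B: "B \<in> bounded_ops S"
  proof (rule bounded_opsI[OF B_l2 _ _ B_norm])
    fix f g assume fg: "f \<in> l2 S" "g \<in> l2 S"
    show "B (\<lambda>x. f x + g x) = (\<lambda>x. B f x + B g x)"
      using fg by (auto simp: B_def l2_inner_add_left Ab)
    show "B (\<lambda>x. c * f x) = (\<lambda>x. c * B f x)" for c
      using fg by (auto simp: B_def l2_inner_smult_left)
  qed (simp_all add: B_def)
  \<comment> \<open>Both sides are linear and bounded in \<open>f\<close>, and they agree on basis
    vectors by the choice of \<open>B\<close>.\<close>
  moreover have "l2_inner S (A f) g = l2_inner S f (B g)" if f: "f \<in> l2 S" and g: "g \<in> l2 S" for f g
    using f
  proof (induction f rule: l2_dense_induct)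
    case zero
    then show ?case by (simp add: bounded_ops_zero[OF A] l2_inner_def)
  next
    case (basis h)
    then show ?case using g
      by (simp add: l2_inner_basis_left B_def l2_inner_commute[of S "A (l2_basis h)"])
  next
    case (add f f')
    then show ?case using g B_l2[OF g] by (simp add: bounded_opsD[OF A] l2_inner_add_left)
  next
    case (smult c f)
    then show ?case by (simp add: bounded_opsD[OF A] l2_inner_smult_left)
  next
    case (closed f)
    \<comment> \<open>\<open>?K\<close> is the total error per unit of distance; dividing by
      \<open>?K + 1\<close> keeps the quotient meaningful when \<open>?K\<close> is 0.\<close>
    let ?K = "2 * ?C * l2_norm S g"
    have "cmod (l2_inner S (A f) g - l2_inner S f (B g)) \<le> e" if e: "e > 0" for e
    proof -
      have K: "0 \<le> ?K" using C by simp
      obtain h where h: "h \<in> l2 S" "l2_inner S (A h) g = l2_inner S h (B g)"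
        "l2_norm S (\<lambda>x. f x - h x) < e / (?K + 1)"
        using closed(2)[of "e / (?K + 1)"] e K by auto
      let ?d = "\<lambda>x. f x - h x"
      have d: "?d \<in> l2 S" using closed h by simp
      have "l2_inner S (A f) g - l2_inner S f (B g) = l2_inner S (A ?d) g - l2_inner S ?d (B g)"
        using closed(1) h g B_l2[OF g]
        by (simp add: bounded_ops_diff[OF A] l2_inner_diff_left bounded_ops_closed[OF A])
      also have "cmod \<dots> \<le> cmod (l2_inner S (A ?d) g) + cmod (l2_inner S ?d (B g))"
        by (rule norm_triangle_ineq4)
      also have "\<dots> \<le> l2_norm S (A ?d) * l2_norm S g + l2_norm S ?d * l2_norm S (B g)"
        using d g B_l2[OF g] bounded_ops_closed[OF A d] by (intro add_mono cmod_l2_inner_le)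
      also have "\<dots> \<le> (?C * l2_norm S ?d) * l2_norm S g + l2_norm S ?d * (?C * l2_norm S g)"
        using l2_norm_le_op_norm[OF A d] B_norm[OF g] by (intro add_mono mult_mono) (auto simp: C)
      also have "\<dots> = ?K * l2_norm S ?d" by simp
      also have "\<dots> \<le> ?K * (e / (?K + 1))" using h(3) K by (intro mult_left_mono) auto
      also have "\<dots> \<le> e" using e K by (simp add: field_simps)
      finally show ?thesis .
    qed
    then have "cmod (l2_inner S (A f) g - l2_inner S f (B g)) \<le> 0" by (rule field_le_epsilon[of _ 0, simplified])
    then show ?case by simp
  qed
  ultimately show ?thesis by blast
qed

lemma
  assumes "A \<in> bounded_ops S"
  shows op_adjoint_closed: "op_adjoint S A \<in> bounded_ops S"
    and op_adjoint_inner: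
      "f \<in> l2 S \<Longrightarrow> g \<in> l2 S \<Longrightarrow> l2_inner S (A f) g = l2_inner S f (op_adjoint S A g)"
proof -
  have "\<exists>!B. B \<in> bounded_ops S \<and> (\<forall>f\<in>l2 S. \<forall>g\<in>l2 S. l2_inner S (A f) g = l2_inner S f (B g))"
    using op_adjoint_exists[OF assms] by (metis op_adjoint_unique)
  from theI'[OF this] show "op_adjoint S A \<in> bounded_ops S"
    "f \<in> l2 S \<Longrightarrow> g \<in> l2 S \<Longrightarrow> l2_inner S (A f) g = l2_inner S f (op_adjoint S A g)"
    unfolding op_adjoint_def by blast+
qed

lemma op_adjoint_eqI:
  assumes "A \<in> bounded_ops S" "B \<in> bounded_ops S"
    and "\<And>f g. f \<in> l2 S \<Longrightarrow> g \<in> l2 S \<Longrightarrow> l2_inner S (A f) g = l2_inner S f (B g)"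
  shows "op_adjoint S A = B"
  using assms op_adjoint_closed[OF assms(1)] op_adjoint_inner[OF assms(1)]
  by (intro op_adjoint_unique) auto

lemma op_adjoint_inner':
  assumes "A \<in> bounded_ops S" "f \<in> l2 S" "g \<in> l2 S"
  shows "l2_inner S (op_adjoint S A f) g = l2_inner S f (A g)"
  using op_adjoint_inner[OF assms(1,3,2)] l2_inner_commute by metis

text \<open>|A^* g|^2 = <A A^* g, g> <= |A| |A^* g| |g|, and one factor cancels.\<close>

lemma op_norm_adjoint_le: "A \<in> bounded_ops S \<Longrightarrow> op_norm S (op_adjoint S A) \<le> op_norm S A"
proof (rule op_norm_leI)
  assume A: "A \<in> bounded_ops S"
  show "0 \<le> op_norm S A" by (rule op_norm_nonneg[OF A])
  fix g assume g: "g \<in> l2 S"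
  let ?h = "op_adjoint S A g"
  have h: "?h \<in> l2 S" by (rule bounded_ops_closed[OF op_adjoint_closed[OF A] g])
  have "(l2_norm S ?h)\<^sup>2 = cmod (l2_inner S ?h ?h)" using h by (simp add: l2_inner_self norm_power)
  also have "\<dots> = cmod (l2_inner S (A ?h) g)" using op_adjoint_inner[OF A h g] by simp
  also have "\<dots> \<le> l2_norm S (A ?h) * l2_norm S g"
    using h g by (intro cmod_l2_inner_le) (simp_all add: bounded_ops_closed[OF A])
  also have "\<dots> \<le> (op_norm S A * l2_norm S ?h) * l2_norm S g"
    using l2_norm_le_op_norm[OF A h] by (intro mult_right_mono) auto
  finally have *: "l2_norm S ?h * l2_norm S ?h \<le> (op_norm S A * l2_norm S g) * l2_norm S ?h"
    by (simp add: power2_eq_square mult_ac)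
  show "l2_norm S ?h \<le> op_norm S A * l2_norm S g"
  proof (cases "l2_norm S ?h = 0")
    case False
    then have "l2_norm S ?h > 0" using l2_norm_nonneg[of S ?h] by linarith
    then show ?thesis using * by (rule_tac mult_right_le_imp_le)
  qed (use op_norm_nonneg[OF A] in simp)
qed

text \<open>The half particular to Hilbert space is |A f|^2 = <f, A^* A f> <= |A^* A| |f|^2.\<close>

lemma op_norm_adjoint_mult:
  assumes A: "A \<in> bounded_ops S"
  shows "op_norm S (op_adjoint S A \<circ> A) = (op_norm S A)\<^sup>2"
proof (rule antisym)
  note A' = op_adjoint_closed[OF A]
  let ?N = "op_norm S (op_adjoint S A \<circ> A)"
  have N: "0 \<le> ?N" by (rule op_norm_nonneg[OF op_mult_closed(1)[OF A' A]])
  have "?N \<le> op_norm S (op_adjoint S A) * op_norm S A" by (rule op_mult_closed(2)[OF A' A])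
  also have "\<dots> \<le> op_norm S A * op_norm S A"
    using op_norm_adjoint_le[OF A] op_norm_nonneg[OF A] by (rule mult_right_mono)
  finally show "?N \<le> (op_norm S A)\<^sup>2" by (simp add: power2_eq_square)
  have "op_norm S A \<le> sqrt ?N"
  proof (rule op_norm_leI)
    fix f assume f: "f \<in> l2 S"
    note Af = bounded_ops_closed[OF A f] and AAf = bounded_ops_closed[OF A' bounded_ops_closed[OF A f]]
    have "(l2_norm S (A f))\<^sup>2 = cmod (l2_inner S (A f) (A f))" using Af by (simp add: l2_inner_self norm_power)
    also have "\<dots> = cmod (l2_inner S f (op_adjoint S A (A f)))" using op_adjoint_inner[OF A f Af] by simp
    also have "\<dots> \<le> l2_norm S f * l2_norm S (op_adjoint S A (A f))" using f AAf by (rule cmod_l2_inner_le)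
    also have "\<dots> \<le> l2_norm S f * (?N * l2_norm S f)"
      using l2_norm_le_op_norm[OF op_mult_closed(1)[OF A' A] f] by (intro mult_left_mono) auto
    also have "\<dots> = (sqrt ?N * l2_norm S f)\<^sup>2" using N by (simp add: power2_eq_square)
    finally show "l2_norm S (A f) \<le> sqrt ?N * l2_norm S f" 
      by (rule power2_le_imp_le) (use N in simp)
  qed (use N in simp)
  then have "(op_norm S A)\<^sup>2 \<le> (sqrt ?N)\<^sup>2" using op_norm_nonneg[OF A] by (rule power_mono)
  then show "(op_norm S A)\<^sup>2 \<le> ?N" using N by simp
qed

lemma op_algebra_simps [simp]:
  "carrier (op_algebra S) = bounded_ops S"
  "A \<otimes>\<^bsub>op_algebra S\<^esub> B = A \<circ> B"
  "\<one>\<^bsub>op_algebra S\<^esub> = (\<lambda>f. if f \<in> l2 S then f else (\<lambda>x. 0))"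
  "\<zero>\<^bsub>op_algebra S\<^esub> = (\<lambda>f x. 0)"
  "A \<oplus>\<^bsub>op_algebra S\<^esub> B = (\<lambda>f x. A f x + B f x)"
  "c \<odot>\<^bsub>op_algebra S\<^esub> A = (\<lambda>f x. c * A f x)"
  "adj (op_algebra S) A = op_adjoint S A"
  "cnorm (op_algebra S) A = op_norm S A"
  by (simp_all add: op_algebra_def)

lemma ring_op_algebra: "ring (op_algebra S)"
proof (intro ringI abelian_groupI monoidI)
  fix A assume A: "A \<in> carrier (op_algebra S)"
  then have A': "A \<in> bounded_ops S" by simp
  show "\<exists>B\<in>carrier (op_algebra S). B \<oplus>\<^bsub>op_algebra S\<^esub> A = \<zero>\<^bsub>op_algebra S\<^esub>"
    using op_smult_closed(1)[OF A', of "-1"] by (intro bexI[of _ "\<lambda>f x. -1 * A f x"]) auto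
  show "\<one>\<^bsub>op_algebra S\<^esub> \<otimes>\<^bsub>op_algebra S\<^esub> A = A"
    by (rule ext, rename_tac f, case_tac "f \<in> l2 S")
       (simp_all add: bounded_ops_closed[OF A'] bounded_ops_off[OF A'])
  show "A \<otimes>\<^bsub>op_algebra S\<^esub> \<one>\<^bsub>op_algebra S\<^esub> = A"
    by (rule ext) (use bounded_ops_off[OF A'] bounded_ops_zero[OF A'] in auto)
  fix B C assume "B \<in> carrier (op_algebra S)" "C \<in> carrier (op_algebra S)"
  then have B: "B \<in> bounded_ops S" and C: "C \<in> bounded_ops S" by simp_all
  show "C \<otimes>\<^bsub>op_algebra S\<^esub> (A \<oplus>\<^bsub>op_algebra S\<^esub> B) =
      C \<otimes>\<^bsub>op_algebra S\<^esub> A \<oplus>\<^bsub>op_algebra S\<^esub> C \<otimes>\<^bsub>op_algebra S\<^esub> B"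
  proof
    fix f show "(C \<otimes>\<^bsub>op_algebra S\<^esub> (A \<oplus>\<^bsub>op_algebra S\<^esub> B)) f =
        (C \<otimes>\<^bsub>op_algebra S\<^esub> A \<oplus>\<^bsub>op_algebra S\<^esub> C \<otimes>\<^bsub>op_algebra S\<^esub> B) f"
      by (cases "f \<in> l2 S")
         (simp_all add: bounded_ops_add[OF C] bounded_ops_closed[OF A'] bounded_ops_closed[OF B]
           bounded_ops_off[OF A'] bounded_ops_off[OF B] bounded_ops_zero[OF C])
  qed
qed (auto simp: op_add_closed op_mult_closed op_one_closed op_zero_closed add_ac o_assoc)

lemma pre_cstar_alg_op_algebra: "pre_cstar_alg (op_algebra S)"
proof (intro pre_cstar_alg.intro pre_cstar_alg_axioms.intro ring_op_algebra)
  interpret ring "op_algebra S" by (rule ring_op_algebra)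
  show "Module.module (ring_of_type_algebra :: complex ring) (op_algebra S)"
    by (rule moduleI[OF cring_from_type_algebra abelian_group_axioms])
       (auto simp: op_smult_closed ring_of_type_algebra_def algebra_simps)
next
  fix A B :: "'a operator" and c :: complex
  assume "A \<in> carrier (op_algebra S)" "B \<in> carrier (op_algebra S)"
  then have A: "A \<in> bounded_ops S" and B: "B \<in> bounded_ops S" by simp_all
  note A' = op_adjoint_closed[OF A] and B' = op_adjoint_closed[OF B]
  show "A \<otimes>\<^bsub>op_algebra S\<^esub> (c \<odot>\<^bsub>op_algebra S\<^esub> B) = c \<odot>\<^bsub>op_algebra S\<^esub> (A \<otimes>\<^bsub>op_algebra S\<^esub> B)"
  proof
    fix f show "(A \<otimes>\<^bsub>op_algebra S\<^esub> (c \<odot>\<^bsub>op_algebra S\<^esub> B)) f = (c \<odot>\<^bsub>op_algebra S\<^esub> (A \<otimes>\<^bsub>op_algebra S\<^esub> B)) f"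
      by (cases "f \<in> l2 S")
         (simp_all add: bounded_ops_smult[OF A] bounded_ops_closed[OF B] bounded_ops_off[OF B]
           bounded_ops_zero[OF A])
  qed
  have "op_adjoint S (\<lambda>f x. A f x + B f x) = (\<lambda>f x. op_adjoint S A f x + op_adjoint S B f x)"
    by (rule op_adjoint_eqI)
       (simp_all add: op_add_closed A B A' B' bounded_ops_closed[OF A] bounded_ops_closed[OF B]
         bounded_ops_closed[OF A'] bounded_ops_closed[OF B']
         l2_inner_add_left l2_inner_add_right op_adjoint_inner[OF A] op_adjoint_inner[OF B])
  then show "adj (op_algebra S) (A \<oplus>\<^bsub>op_algebra S\<^esub> B) =
      adj (op_algebra S) A \<oplus>\<^bsub>op_algebra S\<^esub> adj (op_algebra S) B"
    by simp
  have "op_adjoint S (A \<circ> B) = op_adjoint S B \<circ> op_adjoint S A"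
    by (rule op_adjoint_eqI)
       (simp_all add: op_mult_closed A B A' B' bounded_ops_closed[OF B] bounded_ops_closed[OF A']
         op_adjoint_inner[OF A] op_adjoint_inner[OF B])
  then show "adj (op_algebra S) (A \<otimes>\<^bsub>op_algebra S\<^esub> B) =
      adj (op_algebra S) B \<otimes>\<^bsub>op_algebra S\<^esub> adj (op_algebra S) A"
    by simp
next
  fix A :: "'a operator" and c :: complex
  assume "A \<in> carrier (op_algebra S)"
  then have A: "A \<in> bounded_ops S" by simp
  note A' = op_adjoint_closed[OF A]
  have "op_adjoint S (\<lambda>f x. c * A f x) = (\<lambda>f x. cnj c * op_adjoint S A f x)"
    by (rule op_adjoint_eqI)
       (simp_all add: op_smult_closed A A' l2_inner_smult_left l2_inner_smult_right op_adjoint_inner[OF A])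
  then show "adj (op_algebra S) (c \<odot>\<^bsub>op_algebra S\<^esub> A) = cnj c \<odot>\<^bsub>op_algebra S\<^esub> adj (op_algebra S) A"
    by simp
  have "op_adjoint S (op_adjoint S A) = A"
    by (rule op_adjoint_eqI) (simp_all add: A A' op_adjoint_inner'[OF A])
  then show "adj (op_algebra S) (adj (op_algebra S) A) = A" by simp
qed (auto simp: op_adjoint_closed op_norm_nonneg op_norm_eq_0 op_smult_closed op_add_closed
    op_mult_closed op_norm_adjoint_mult)

lemma op_minus:
  assumes "A \<in> bounded_ops S" "B \<in> bounded_ops S"
  shows "A \<ominus>\<^bsub>op_algebra S\<^esub> B = (\<lambda>f x. A f x - B f x)"
proof -
  interpret pre_cstar_alg "op_algebra S" by (rule pre_cstar_alg_op_algebra)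
  have "\<ominus>\<^bsub>op_algebra S\<^esub> B = (\<lambda>f x. - B f x)"
    using smult_minus_1[of B] assms by simp
  then show ?thesis by (simp add: a_minus_def)
qed

text \<open>A norm Cauchy sequence of operators converges in every coordinate. The coordinatewise
  limit is bounded, and is a limit in norm, because Cauchy estimates on finite sets of coordinates
  survive the passage to the limit.\<close>

lemma cstar_alg_op_algebra: "cstar_alg (op_algebra S)"
proof -
  interpret pre_cstar_alg "op_algebra S" by (rule pre_cstar_alg_op_algebra)
  show ?thesis
  proof (rule cstar_algI, rule unital_cstar_algebraI)
    fix s :: "nat \<Rightarrow> 'a operator"
    assume "\<And>n. s n \<in> carrier (op_algebra S)"
    then have s: "s n \<in> bounded_ops S" for n by simp
    assume "\<And>e. e > 0 \<Longrightarrow> \<exists>N. \<forall>m\<ge>N. \<forall>n\<ge>N. cnorm (op_algebra S) (s m \<ominus>\<^bsub>op_algebra S\<^esub> s n) < e"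
    then have Cauchy: "\<exists>N. \<forall>m\<ge>N. \<forall>n\<ge>N. op_norm S (\<lambda>f x. s m f x - s n f x) < e" if "e > 0" for e
      using that by (simp add: op_minus s)
    have diff: "(\<lambda>f x. s m f x - s n f x) \<in> bounded_ops S" for m n
      using op_add_closed(1)[OF s op_smult_closed(1)[OF s, of "-1"], of m n] by simp
    have diff_le: "l2_norm S (\<lambda>x. s m f x - s n f x) \<le> op_norm S (\<lambda>f x. s m f x - s n f x) * l2_norm S f"
      if "f \<in> l2 S" for f m n
      using l2_norm_le_op_norm[OF diff that] .
    define L where "L f = (if f \<in> l2 S then (\<lambda>x. lim (\<lambda>n. s n f x)) else (\<lambda>x. 0))" for f
    have lim: "(\<lambda>n. s n f x) \<longlonglongrightarrow> L f x" if f: "f \<in> l2 S" for f x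
    proof -
      have "Cauchy (\<lambda>n. s n f x)"
      proof (rule metric_CauchyI)
        fix e :: real assume e: "e > 0"
        \<comment> \<open>The summand 1 keeps the denominator positive for \<open>f\<close> of norm
          0.\<close>
        have pos: "0 < e / (l2_norm S f + 1)" using e l2_norm_nonneg[of S f] by (simp add: add_nonneg_pos)
        then obtain N where N: "\<forall>m\<ge>N. \<forall>n\<ge>N. op_norm S (\<lambda>f x. s m f x - s n f x) < e / (l2_norm S f + 1)"
          using Cauchy by blast
        have "dist (s m f x) (s n f x) < e" if "m \<ge> N" "n \<ge> N" for m n
        proof -
          have "dist (s m f x) (s n f x) \<le> l2_norm S (\<lambda>x. s m f x - s n f x)"
            using cmod_le_l2_norm[OF bounded_ops_closed[OF diff f, of m n], of x] by (simp add: dist_norm)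
          also have "\<dots> \<le> e / (l2_norm S f + 1) * l2_norm S f"
            using diff_le[OF f, of m n] N that
            by (meson order_trans mult_right_mono less_imp_le l2_norm_nonneg)
          also have "\<dots> < e"
            using e l2_norm_nonneg[of S f] by (simp add: divide_less_eq add_nonneg_pos)
          finally show ?thesis .
        qed
        then show "\<exists>N. \<forall>m\<ge>N. \<forall>n\<ge>N. dist (s m f x) (s n f x) < e" by blast
      qed
      then show ?thesis using f by (simp add: L_def Cauchy_convergent convergent_LIMSEQ_iff[symmetric])
    qed
    have off: "s n f x = 0" if "x \<notin> S" for n f x
      using l2_off[OF bounded_ops_closed[OF s] that] bounded_ops_off[OF s] by (cases "f \<in> l2 S") auto
    have L_off: "L f x = 0" if "x \<notin> S" "f \<in> l2 S" for f x
      using lim[OF that(2), of x] off[OF that(1)] by (simp add: LIMSEQ_const_iff)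
    \<comment> \<open>On a finite set of coordinates n tends to infinity in the bound for the
      difference of stages m and n; uniformity in the finite set gives the estimate in
      \<open>l2\<close>.\<close>
    have close: "(\<lambda>x. s m f x - L f x) \<in> l2 S \<and> l2_norm S (\<lambda>x. s m f x - L f x) \<le> e * l2_norm S f"
      if f: "f \<in> l2 S" and N: "\<forall>m\<ge>N. \<forall>n\<ge>N. op_norm S (\<lambda>f x. s m f x - s n f x) < e" "m \<ge> N" for f e N m
    proof -
      have "L2_set (\<lambda>x. cmod (s m f x - L f x)) F \<le> e * l2_norm S f" if F: "finite F" "F \<subseteq> S" for F
      proof (rule tendsto_upperbound)
        show "(\<lambda>n. L2_set (\<lambda>x. cmod (s m f x - s n f x)) F) \<longlonglongrightarrow> L2_set (\<lambda>x. cmod (s m f x - L f x)) F"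
          unfolding L2_set_def by (intro tendsto_intros lim f)
        show "\<forall>\<^sub>F n in sequentially. L2_set (\<lambda>x. cmod (s m f x - s n f x)) F \<le> e * l2_norm S f"
          unfolding eventually_sequentially
        proof (intro exI allI impI)
          fix n assume n: "N \<le> n"
          have "L2_set (\<lambda>x. cmod (s m f x - s n f x)) F \<le> l2_norm S (\<lambda>x. s m f x - s n f x)"
            using bounded_ops_closed[OF diff f] F by (rule L2_set_le_l2_norm)
          also have "\<dots> \<le> op_norm S (\<lambda>f x. s m f x - s n f x) * l2_norm S f" by (rule diff_le[OF f])
          also have "\<dots> \<le> e * l2_norm S f" using N n by (intro mult_right_mono) (auto intro: less_imp_le)
          finally show "L2_set (\<lambda>x. cmod (s m f x - s n f x)) F \<le> e * l2_norm S f" .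
        qed
      qed simp
      moreover have "s m f x - L f x = 0" if "x \<notin> S" for x using off[OF that] L_off[OF that f] by simp
      ultimately show ?thesis by (auto intro!: l2I l2_norm_leI)
    qed
    \<comment> \<open>Stage \<open>N1\<close> is within 1 of all later ones, hence of the limit;
      this bounds the limit by \<open>op_norm S (s N1) + 1\<close>.\<close>
    obtain N1 where N1: "\<forall>m\<ge>N1. \<forall>n\<ge>N1. op_norm S (\<lambda>f x. s m f x - s n f x) < 1"
      using Cauchy[of 1] by auto
    have L_eq: "L f = (\<lambda>x. s N1 f x - (s N1 f x - L f x))" for f by simp
    have L: "L \<in> bounded_ops S"
    proof (rule bounded_opsI)
      fix f assume f: "f \<in> l2 S"
      note c = close[OF f N1 order_refl] and sf = bounded_ops_closed[OF s f, of N1]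
      show "L f \<in> l2 S" using l2_diff[OF sf conjunct1[OF c]] by simp
      have "l2_norm S (L f) = l2_norm S (\<lambda>x. s N1 f x + (-1) * (s N1 f x - L f x))" by simp
      also have "\<dots> \<le> l2_norm S (s N1 f) + l2_norm S (\<lambda>x. (-1) * (s N1 f x - L f x))"
        using sf c by (intro l2_norm_triangle l2_smult) auto
      also have "\<dots> \<le> op_norm S (s N1) * l2_norm S f + 1 * l2_norm S f"
        using c l2_norm_le_op_norm[OF s f, of N1] l2_norm_smult[of S "-1" "\<lambda>x. s N1 f x - L f x"]
        by (intro add_mono) simp_all
      finally show "l2_norm S (L f) \<le> (op_norm S (s N1) + 1) * l2_norm S f" by (simp add: distrib_right)
      show "L (\<lambda>x. c * f x) = (\<lambda>x. c * L f x)" for c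
      proof
        fix x
        have "(\<lambda>n. s n (\<lambda>x. c * f x) x) \<longlonglongrightarrow> c * L f x"
          unfolding bounded_ops_smult[OF s f] by (intro tendsto_intros lim f)
        then show "L (\<lambda>x. c * f x) x = c * L f x"
          using lim[OF l2_smult[OF f], of c x] LIMSEQ_unique by blast
      qed
      fix g assume g: "g \<in> l2 S"
      show "L (\<lambda>x. f x + g x) = (\<lambda>x. L f x + L g x)"
      proof
        fix x
        have "(\<lambda>n. s n (\<lambda>x. f x + g x) x) \<longlonglongrightarrow> L f x + L g x"
          unfolding bounded_ops_add[OF s f g] by (intro tendsto_intros lim f g)
        then show "L (\<lambda>x. f x + g x) x = L f x + L g x"
          using lim[OF l2_add[OF f g], of x] LIMSEQ_unique by blast
      qed
    qed (simp add: L_def)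
    have "(\<lambda>n. op_norm S (\<lambda>f x. s n f x - L f x)) \<longlonglongrightarrow> 0"
    proof (rule LIMSEQ_I)
      fix e :: real assume e: "e > 0"
      then obtain N where N: "\<forall>m\<ge>N. \<forall>n\<ge>N. op_norm S (\<lambda>f x. s m f x - s n f x) < e/2"
        using Cauchy[of "e/2"] by auto
      have "norm (op_norm S (\<lambda>f x. s m f x - L f x) - 0) < e" if "m \<ge> N" for m
      proof -
        have "(\<lambda>f x. s m f x - L f x) \<in> bounded_ops S"
          using op_add_closed(1)[OF s op_smult_closed(1)[OF L, of "-1"], of m] by simp
        then have "0 \<le> op_norm S (\<lambda>f x. s m f x - L f x)" by (rule op_norm_nonneg)
        moreover have "op_norm S (\<lambda>f x. s m f x - L f x) \<le> e/2"
          using close[OF _ N that] e by (intro op_norm_leI) auto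
        ultimately show ?thesis using e by simp
      qed
      then show "\<exists>no. \<forall>n\<ge>no. norm (op_norm S (\<lambda>f x. s n f x - L f x) - 0) < e" by blast
    qed
    then have "conv s L" using s L by (auto simp: conv_def op_minus)
    then show "\<exists>x. conv s x" by blast
  qed
qed

section \<open>Amplifications\<close>

text \<open>\<open>p\<close> cuts \<open>S\<close> into copies of \<open>N\<close> indexed by
  \<open>I\<close>, so l2(S) becomes the tensor product of l2(I) and l2(N), and
  \<open>slice i f\<close> is the component of \<open>f\<close> in the i-th copy.\<close>

locale l2_decomposition =
  fixes I :: "'j set" and N :: "'i set" and S :: "'s set" and p :: "'j \<Rightarrow> 'i \<Rightarrow> 's"
  assumes bij: "bij_betw (\<lambda>(i, k). p i k) (I \<times> N) S"
begin

definition idx :: "'s \<Rightarrow> 'j \<times> 'i" where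
  "idx = inv_into (I \<times> N) (\<lambda>(i, k). p i k)"

definition slice :: "'j \<Rightarrow> ('s \<Rightarrow> complex) \<Rightarrow> 'i \<Rightarrow> complex" where
  "slice i f = (\<lambda>k. if k \<in> N then f (p i k) else 0)"

definition glue :: "('j \<Rightarrow> 'i \<Rightarrow> complex) \<Rightarrow> 's \<Rightarrow> complex" where
  "glue G = (\<lambda>x. if x \<in> S then G (fst (idx x)) (snd (idx x)) else 0)"

text \<open>Under \<open>l\<^sup>2(S) = l\<^sup>2(I) \<otimes> l\<^sup>2(N)\<close> this is the operator \<open>1 \<otimes> Z\<close>.\<close>
definition amp :: "'i operator \<Rightarrow> 's operator" where
  "amp Z = (\<lambda>f. if f \<in> l2 S then glue (\<lambda>i. Z (slice i f)) else (\<lambda>x. 0))"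

lemma p_in: "i \<in> I \<Longrightarrow> k \<in> N \<Longrightarrow> p i k \<in> S"
  using bij by (auto simp: bij_betw_def)

lemma idx_p: "i \<in> I \<Longrightarrow> k \<in> N \<Longrightarrow> idx (p i k) = (i, k)"
  using bij_betw_inv_into_left[OF bij, of "(i, k)"] by (simp add: idx_def)

lemma p_cases:
  assumes "x \<in> S"
  obtains i k where "i \<in> I" "k \<in> N" "x = p i k"
  using assms bij by (auto simp: bij_betw_def)

lemma slice_glue: "i \<in> I \<Longrightarrow> (\<And>k. k \<notin> N \<Longrightarrow> G i k = 0) \<Longrightarrow> slice i (glue G) = G i"
  by (rule ext) (simp add: slice_def glue_def p_in idx_p)

lemma glue_off: "x \<notin> S \<Longrightarrow> glue G x = 0"
  by (simp add: glue_def)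

lemma eq_if_slices_eq:
  assumes "f \<in> l2 S" "g \<in> l2 S" "\<And>i. i \<in> I \<Longrightarrow> slice i f = slice i g"
  shows "f = g"
proof (rule l2_eqI[OF assms(1,2)])
  fix x assume "x \<in> S"
  then obtain i k where *: "i \<in> I" "k \<in> N" "x = p i k" by (rule p_cases)
  then show "f x = g x" using fun_cong[OF assms(3)[OF *(1)], of k] by (simp add: slice_def)
qed

lemma slice_square: "(l2_norm N (slice i f))\<^sup>2 = (\<Sum>\<^sub>\<infinity>k\<in>N. (cmod (f (p i k)))\<^sup>2)"
  unfolding l2_norm_square by (rule infsum_cong) (simp add: slice_def)

text \<open>Tonelli's theorem for a nonnegative family on \<open>I \<times> N\<close>, transported
  along \<open>p\<close>. It decides whether a glued family belongs to \<open>l2 S\<close>.\<close>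

lemma summable_slices:
  "(\<lambda>x. (cmod (f x))\<^sup>2) summable_on S \<longleftrightarrow>
    (\<forall>i\<in>I. slice i f \<in> l2 N) \<and> (\<lambda>i. (l2_norm N (slice i f))\<^sup>2) summable_on I"
proof -
  let ?F = "\<lambda>(i, k). (cmod (f (p i k)))\<^sup>2"
  have F: "norm (?F z) = ?F z" for z by (simp add: case_prod_unfold)
  have "(\<lambda>x. (cmod (f x))\<^sup>2) summable_on S \<longleftrightarrow> ?F summable_on (I \<times> N)"
    by (subst summable_on_reindex_bij_betw[OF bij, symmetric]) (simp add: case_prod_unfold)
  also have "\<dots> \<longleftrightarrow> (\<lambda>z. norm (?F z)) summable_on (I \<times> N)"
    by (simp only: F)
  also have "\<dots> \<longleftrightarrow> (\<forall>i\<in>I. (\<lambda>k. norm (?F (i, k))) summable_on N) \<and>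
      (\<lambda>i. norm (infsum (\<lambda>k. norm (?F (i, k))) N)) summable_on I"
    by (rule Infinite_Sum.abs_summable_on_Sigma_iff)
  also have "(\<lambda>i. norm (infsum (\<lambda>k. norm (?F (i, k))) N)) = (\<lambda>i. (l2_norm N (slice i f))\<^sup>2)"
    by (simp add: slice_square infsum_nonneg)
  also have "(\<forall>i\<in>I. (\<lambda>k. norm (?F (i, k))) summable_on N) \<longleftrightarrow> (\<forall>i\<in>I. slice i f \<in> l2 N)"
    by (auto simp: l2_def slice_def cong: summable_on_cong)
  finally show ?thesis .
qed

lemma
  assumes "f \<in> l2 S"
  shows slice_l2: "i \<in> I \<Longrightarrow> slice i f \<in> l2 N"
    and summable_slice_norms: "(\<lambda>i. (l2_norm N (slice i f))\<^sup>2) summable_on I"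
  using assms summable_slices[of f] by (auto simp: l2_def)

lemma l2_norm_slices:
  assumes "f \<in> l2 S"
  shows "(l2_norm S f)\<^sup>2 = (\<Sum>\<^sub>\<infinity>i\<in>I. (l2_norm N (slice i f))\<^sup>2)"
proof -
  have sum: "(\<lambda>x. (cmod (f x))\<^sup>2) summable_on S" using assms by (simp add: l2_def)
  then have "(\<lambda>(i, k). (cmod (f (p i k)))\<^sup>2) summable_on I \<times> N"
    by (subst (asm) summable_on_reindex_bij_betw[OF bij, symmetric]) (simp add: case_prod_unfold)
  from infsum_Sigma'_banach[OF this] infsum_reindex_bij_betw[OF bij, of "\<lambda>x. (cmod (f x))\<^sup>2"]
  show ?thesis by (simp add: l2_norm_square[of S] slice_square case_prod_unfold)
qed

lemma l2_inner_slices: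
  assumes "f \<in> l2 S" "g \<in> l2 S"
  shows "l2_inner S f g = (\<Sum>\<^sub>\<infinity>i\<in>I. l2_inner N (slice i f) (slice i g))"
proof -
  have "(\<lambda>x. f x * cnj (g x)) summable_on S" by (rule l2_inner_summable[OF assms])
  then have "(\<lambda>(i, k). f (p i k) * cnj (g (p i k))) summable_on I \<times> N"
    by (subst (asm) summable_on_reindex_bij_betw[OF bij, symmetric]) (simp add: case_prod_unfold)
  from infsum_Sigma'_banach[OF this] infsum_reindex_bij_betw[OF bij, of "\<lambda>x. f x * cnj (g x)"]
  have "l2_inner S f g = (\<Sum>\<^sub>\<infinity>i\<in>I. \<Sum>\<^sub>\<infinity>k\<in>N. f (p i k) * cnj (g (p i k)))"
    by (simp add: l2_inner_def case_prod_unfold)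
  also have "\<dots> = (\<Sum>\<^sub>\<infinity>i\<in>I. l2_inner N (slice i f) (slice i g))"
    unfolding l2_inner_def by (intro infsum_cong) (simp add: slice_def)
  finally show ?thesis .
qed

lemma slice_add: "slice i (\<lambda>x. f x + g x) = (\<lambda>k. slice i f k + slice i g k)"
  and slice_smult: "slice i (\<lambda>x. c * f x) = (\<lambda>k. c * slice i f k)"
  by (auto simp: slice_def)

context
  fixes Z
  assumes Z: "Z \<in> bounded_ops N"
begin

lemma slice_glue_op:
  assumes "f \<in> l2 S" "i \<in> I"
  shows "slice i (glue (\<lambda>i. Z (slice i f))) = Z (slice i f)"
  using l2_off[OF bounded_ops_closed[OF Z slice_l2[OF assms]]] assms(2) by (intro slice_glue)

lemma slice_norm_le:
  assumes "f \<in> l2 S" "i \<in> I"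
  shows "(l2_norm N (slice i (glue (\<lambda>i. Z (slice i f)))))\<^sup>2 \<le> (op_norm N Z)\<^sup>2 * (l2_norm N (slice i f))\<^sup>2"
  unfolding slice_glue_op[OF assms] power_mult_distrib[symmetric]
  using l2_norm_le_op_norm[OF Z slice_l2[OF assms]] by (rule power_mono) simp

lemma glue_op_l2:
  assumes "f \<in> l2 S"
  shows "glue (\<lambda>i. Z (slice i f)) \<in> l2 S"
proof -
  have "(\<lambda>i. (l2_norm N (slice i (glue (\<lambda>i. Z (slice i f)))))\<^sup>2) summable_on I"
  proof (rule summable_on_comparison_test)
    show "(\<lambda>i. (op_norm N Z)\<^sup>2 * (l2_norm N (slice i f))\<^sup>2) summable_on I"
      by (intro summable_on_cmult_right summable_slice_norms assms)
  qed (use slice_norm_le[OF assms] in auto)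
  moreover have "slice i (glue (\<lambda>i. Z (slice i f))) \<in> l2 N" if "i \<in> I" for i
    unfolding slice_glue_op[OF assms that] by (rule bounded_ops_closed[OF Z slice_l2[OF assms that]])
  ultimately show ?thesis
    using summable_slices[of "glue (\<lambda>i. Z (slice i f))"] by (auto simp: l2_def glue_off)
qed

lemma amp_l2: "f \<in> l2 S \<Longrightarrow> amp Z f \<in> l2 S"
  by (simp add: amp_def glue_op_l2)

lemma slice_amp: "f \<in> l2 S \<Longrightarrow> i \<in> I \<Longrightarrow> slice i (amp Z f) = Z (slice i f)"
  by (simp add: amp_def slice_glue_op)

lemma amp_closed: "amp Z \<in> bounded_ops S"
proof (rule bounded_opsI)
  fix f assume f: "f \<in> l2 S"
  show "amp Z f \<in> l2 S" by (rule amp_l2[OF f])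
  show "amp Z (\<lambda>x. c * f x) = (\<lambda>x. c * amp Z f x)" for c
    by (rule eq_if_slices_eq)
       (use f in \<open>simp_all add: amp_l2 slice_amp slice_smult bounded_ops_smult[OF Z] slice_l2\<close>)
  show "amp Z (\<lambda>x. f x + g x) = (\<lambda>x. amp Z f x + amp Z g x)" if "g \<in> l2 S" for g
    by (rule eq_if_slices_eq)
       (use f that in \<open>simp_all add: amp_l2 slice_amp slice_add bounded_ops_add[OF Z] slice_l2\<close>)
  have "(l2_norm S (amp Z f))\<^sup>2 = (\<Sum>\<^sub>\<infinity>i\<in>I. (l2_norm N (slice i (amp Z f)))\<^sup>2)"
    by (rule l2_norm_slices[OF amp_l2[OF f]])
  also have "\<dots> \<le> (\<Sum>\<^sub>\<infinity>i\<in>I. (op_norm N Z)\<^sup>2 * (l2_norm N (slice i f))\<^sup>2)"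
    using slice_norm_le[OF f] f
    by (intro infsum_mono summable_slice_norms amp_l2 summable_on_cmult_right) (auto simp: amp_def)
  also have "\<dots> = (op_norm N Z * l2_norm S f)\<^sup>2"
    by (simp add: infsum_cmult_right' l2_norm_slices[OF f] power_mult_distrib)
  finally show "l2_norm S (amp Z f) \<le> op_norm N Z * l2_norm S f"
    by (rule power2_le_imp_le) (simp add: op_norm_nonneg[OF Z])
qed (simp add: amp_def)

end

text \<open>Slices separate vectors, so acting by \<open>Z\<close> on every slice characterises
  \<open>amp Z\<close>. The morphism laws for products, sums, scalars and the unit reduce to
  this.\<close>

lemma amp_eqI:
  assumes "Z \<in> bounded_ops N" "Y \<in> bounded_ops S"
    and "\<And>f i. f \<in> l2 S \<Longrightarrow> i \<in> I \<Longrightarrow> slice i (Y f) = Z (slice i f)"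
  shows "amp Z = Y"
proof (rule bounded_ops_eqI[OF amp_closed[OF assms(1)] assms(2)])
  fix f assume f: "f \<in> l2 S"
  show "amp Z f = Y f"
    by (rule eq_if_slices_eq)
       (use assms f bounded_ops_closed[OF assms(2) f] in \<open>simp_all add: amp_l2 slice_amp\<close>)
qed

lemma amp_star_hom: "amp \<in> unital_star_hom (op_algebra N) (op_algebra S)"
proof -
  have "op_adjoint S (amp Z) = amp (op_adjoint N Z)" if Z: "Z \<in> bounded_ops N" for Z
  proof (rule op_adjoint_eqI)
    note Z' = op_adjoint_closed[OF Z]
    show "amp Z \<in> bounded_ops S" "amp (op_adjoint N Z) \<in> bounded_ops S"
      by (simp_all add: amp_closed Z Z')
    \<comment> \<open>The inner product is the sum of the inner products of slices, and
      \<open>Z\<close> moves across each of these separately.\<close>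
    show "l2_inner S (amp Z f) g = l2_inner S f (amp (op_adjoint N Z) g)"
      if "f \<in> l2 S" "g \<in> l2 S" for f g
      using that
      by (simp add: l2_inner_slices amp_l2 slice_amp slice_l2 Z Z' op_adjoint_inner[OF Z]
          cong: infsum_cong)
  qed
  moreover have "amp (Z \<circ> Y) = amp Z \<circ> amp Y" if "Z \<in> bounded_ops N" "Y \<in> bounded_ops N" for Z Y
    by (rule amp_eqI) (use that in \<open>simp_all add: op_mult_closed amp_closed slice_amp amp_l2\<close>)
  moreover have "amp (\<lambda>f x. Z f x + Y f x) = (\<lambda>f x. amp Z f x + amp Y f x)"
    if "Z \<in> bounded_ops N" "Y \<in> bounded_ops N" for Z Y
    by (rule amp_eqI) (use that in \<open>simp_all add: op_add_closed amp_closed slice_amp slice_add\<close>)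
  moreover have "amp (\<lambda>f x. c * Z f x) = (\<lambda>f x. c * amp Z f x)" if "Z \<in> bounded_ops N" for Z c
    by (rule amp_eqI) (use that in \<open>simp_all add: op_smult_closed amp_closed slice_amp slice_smult\<close>)
  moreover have "amp (\<lambda>f. if f \<in> l2 N then f else (\<lambda>x. 0)) = (\<lambda>f. if f \<in> l2 S then f else (\<lambda>x. 0))"
    by (rule amp_eqI) (simp_all add: op_one_closed slice_l2)
  ultimately show ?thesis
    by (auto simp: unital_star_hom_def ring_hom_def amp_closed)
qed

text \<open>Placing a vector \<open>g\<close> in the single slice \<open>j\<close> recovers
  \<open>Z g\<close> from \<open>amp Z\<close>.\<close>

lemma amp_inj:
  assumes "I \<noteq> {}"
  shows "inj_on amp (bounded_ops N)"
proof (rule inj_onI)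
  fix Z Y assume Z: "Z \<in> bounded_ops N" and Y: "Y \<in> bounded_ops N" and eq: "amp Z = amp Y"
  obtain j where j: "j \<in> I" using assms by auto
  show "Z = Y"
  proof (rule bounded_ops_eqI[OF Z Y])
    fix g assume g: "g \<in> l2 N"
    let ?f = "glue (\<lambda>i. if i = j then g else (\<lambda>k. 0))"
    have sl: "slice i ?f = (if i = j then g else (\<lambda>k. 0))" if "i \<in> I" for i
      using that l2_off[OF g] by (subst slice_glue) auto
    have "(\<lambda>i. (l2_norm N (slice i ?f))\<^sup>2) summable_on I"
      by (rule finite_nonzero_values_imp_summable_on, rule finite_subset[of _ "{j}"]) (auto simp: sl split: if_splits)
    then have "?f \<in> l2 S"
      using summable_slices[of ?f] g by (auto simp: l2_def[of S] glue_off sl)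
    then have "Z (slice j ?f) = Y (slice j ?f)"
      using slice_amp[OF Z] slice_amp[OF Y] eq j by metis
    then show "Z g = Y g" using sl[OF j] by simp
  qed
qed

end

section \<open>Reduced semigroup algebras\<close>

definition rat_subgroup :: "rat set \<Rightarrow> bool" where
  "rat_subgroup \<Gamma> \<longleftrightarrow> 0 \<in> \<Gamma> \<and> (\<forall>x\<in>\<Gamma>. \<forall>y\<in>\<Gamma>. x + y \<in> \<Gamma> \<and> x - y \<in> \<Gamma>)"

lemma rat_subgroup_Ints: "rat_subgroup \<int>"
  by (simp add: rat_subgroup_def)

lemma rat_subgroup_mult_nat: "rat_subgroup \<Gamma> \<Longrightarrow> q \<in> \<Gamma> \<Longrightarrow> of_nat k * q \<in> \<Gamma>"
  by (induction k) (auto simp: rat_subgroup_def distrib_right)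

lemma pos_cone_add: "rat_subgroup \<Gamma> \<Longrightarrow> g \<in> pos_cone \<Gamma> \<Longrightarrow> h \<in> pos_cone \<Gamma> \<Longrightarrow> g + h \<in> pos_cone \<Gamma>"
  by (auto simp: pos_cone_def rat_subgroup_def)

lemma pos_cone_Ints: "pos_cone \<int> = range of_nat"
proof -
  have "x \<in> range of_nat" if "x \<in> \<int>" "0 \<le> x" for x :: rat
    using that by (metis Ints_cases of_int_0_le_iff of_int_of_nat_eq rangeI zero_le_imp_eq_int)
  then show ?thesis by (auto simp: pos_cone_def)
qed

context
  fixes \<Gamma> :: "rat set"
  assumes \<Gamma>: "rat_subgroup \<Gamma>"
begin

text \<open>Translation carries finite sets of coordinates to finite sets, and coordinates that land
  outside the cone contribute nothing, so partial sums do not exceed the norm of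
  \<open>f\<close>.\<close>

lemma
  assumes g: "g \<in> pos_cone \<Gamma>" and f: "f \<in> l2 (pos_cone \<Gamma>)"
  shows shift_l2: "(\<lambda>x. f (x - g)) \<in> l2 (pos_cone \<Gamma>)"
    and shift_norm_le: "l2_norm (pos_cone \<Gamma>) (\<lambda>x. f (x - g)) \<le> l2_norm (pos_cone \<Gamma>) f"
proof -
  let ?S = "pos_cone \<Gamma>"
  have off: "f (x - g) = 0" if "x \<notin> ?S" for x
    using pos_cone_add[OF \<Gamma> g, of "x - g"] that l2_off[OF f, of "x - g"] by auto
  have bound: "L2_set (\<lambda>x. cmod (f (x - g))) F \<le> l2_norm ?S f" if F: "finite F" "F \<subseteq> ?S" for F
  proof -
    let ?G = "(\<lambda>x. x - g) ` F"
    have "(\<Sum>x\<in>F. (cmod (f (x - g)))\<^sup>2) = (\<Sum>x\<in>?G. (cmod (f x))\<^sup>2)"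
      by (subst sum.reindex) (auto simp: inj_on_def)
    also have "\<dots> = (\<Sum>x\<in>?G \<inter> ?S. (cmod (f x))\<^sup>2)"
      by (rule sum.mono_neutral_right) (use F l2_off[OF f] in auto)
    finally have "L2_set (\<lambda>x. cmod (f (x - g))) F = L2_set (\<lambda>x. cmod (f x)) (?G \<inter> ?S)"
      by (simp add: L2_set_def)
    also have "\<dots> \<le> l2_norm ?S f" by (rule L2_set_le_l2_norm[OF f]) (use F in auto)
    finally show ?thesis .
  qed
  show "(\<lambda>x. f (x - g)) \<in> l2 ?S" by (rule l2I[OF off bound])
  show "l2_norm ?S (\<lambda>x. f (x - g)) \<le> l2_norm ?S f" by (rule l2_norm_leI[OF off bound])
qed

lemma shift_closed: "g \<in> pos_cone \<Gamma> \<Longrightarrow> shift \<Gamma> g \<in> bounded_ops (pos_cone \<Gamma>)"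
  by (rule bounded_opsI[of _ _ 1]) (auto simp: shift_def shift_l2 shift_norm_le)

lemma shift_comp: "g \<in> pos_cone \<Gamma> \<Longrightarrow> h \<in> pos_cone \<Gamma> \<Longrightarrow> shift \<Gamma> g \<circ> shift \<Gamma> h = shift \<Gamma> (g + h)"
  by (rule ext) (auto simp: shift_def shift_l2 diff_diff_eq)

lemma shift_0: "shift \<Gamma> 0 = (\<lambda>f. if f \<in> l2 (pos_cone \<Gamma>) then f else (\<lambda>x. 0))"
  by (rule ext) (simp add: shift_def)

lemma zero_in_pos_cone: "0 \<in> pos_cone \<Gamma>"
  using \<Gamma> by (simp add: pos_cone_def rat_subgroup_def)

lemma reduced_cstar_eq:
  "reduced_cstar \<Gamma> = (op_algebra (pos_cone \<Gamma>))\<lparr>carrier := carrier (reduced_cstar \<Gamma>)\<rparr>"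
  unfolding reduced_cstar_def by (rule cstar_generated_eq)

lemma reduced_cstar_subalgebra: "cstar_subalgebra (carrier (reduced_cstar \<Gamma>)) (op_algebra (pos_cone \<Gamma>))"
proof -
  interpret cstar_alg "op_algebra (pos_cone \<Gamma>)" by (rule cstar_alg_op_algebra)
  show ?thesis
    unfolding reduced_cstar_def by (rule cstar_subalgebra_generated) (auto simp: shift_closed)
qed

lemma shift_in_reduced_cstar: "g \<in> pos_cone \<Gamma> \<Longrightarrow> shift \<Gamma> g \<in> carrier (reduced_cstar \<Gamma>)"
  unfolding reduced_cstar_def by (rule subsetD[OF cstar_generated_superset imageI])

lemma one_in_reduced_cstar: "\<one>\<^bsub>op_algebra (pos_cone \<Gamma>)\<^esub> \<in> carrier (reduced_cstar \<Gamma>)"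
  using shift_in_reduced_cstar[OF zero_in_pos_cone] by (simp add: shift_0)

lemma reduced_cstar_least:
  "cstar_subalgebra C (op_algebra (pos_cone \<Gamma>)) \<Longrightarrow> (\<And>g. g \<in> pos_cone \<Gamma> \<Longrightarrow> shift \<Gamma> g \<in> C) \<Longrightarrow>
    carrier (reduced_cstar \<Gamma>) \<subseteq> C"
  unfolding reduced_cstar_def by (rule cstar_generated_least) auto

lemma cstar_alg_reduced_cstar: "cstar_alg (reduced_cstar \<Gamma>)"
proof -
  interpret cstar_alg "op_algebra (pos_cone \<Gamma>)" by (rule cstar_alg_op_algebra)
  show ?thesis
    by (subst reduced_cstar_eq) (rule subalg_cstar[OF reduced_cstar_subalgebra one_in_reduced_cstar])
qed

lemma reduced_cstar_in_bounded_ops: "x \<in> carrier (reduced_cstar \<Gamma>) \<Longrightarrow> x \<in> bounded_ops (pos_cone \<Gamma>)"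
  using reduced_cstar_subalgebra by (auto simp: cstar_subalgebra_def)

lemma reduced_cstar_simps [simp]:
  "A \<otimes>\<^bsub>reduced_cstar \<Gamma>\<^esub> B = A \<circ> B"
  "\<one>\<^bsub>reduced_cstar \<Gamma>\<^esub> = (\<lambda>f. if f \<in> l2 (pos_cone \<Gamma>) then f else (\<lambda>x. 0))"
  "\<zero>\<^bsub>reduced_cstar \<Gamma>\<^esub> = (\<lambda>f x. 0)"
  "A \<oplus>\<^bsub>reduced_cstar \<Gamma>\<^esub> B = (\<lambda>f x. A f x + B f x)"
  "c \<odot>\<^bsub>reduced_cstar \<Gamma>\<^esub> A = (\<lambda>f x. c * A f x)"
  "adj (reduced_cstar \<Gamma>) A = op_adjoint (pos_cone \<Gamma>) A"
  "cnorm (reduced_cstar \<Gamma>) A = op_norm (pos_cone \<Gamma>) A"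
  by (subst reduced_cstar_eq, simp)+

text \<open>Closedness must be moved between two metric spaces: a limit in \<open>op_algebra\<close>
  of points of \<open>C\<close> lies in the closed set
  \<open>carrier (reduced_cstar \<Gamma>)\<close>, hence is a limit there as well. Minimality of the
  generated algebra then applies to subalgebras found inside it.\<close>

lemma cstar_subalgebra_of_reduced:
  assumes "cstar_subalgebra C (reduced_cstar \<Gamma>)"
  shows "cstar_subalgebra C (op_algebra (pos_cone \<Gamma>))"
proof -
  interpret op: cstar_alg "op_algebra (pos_cone \<Gamma>)" by (rule cstar_alg_op_algebra)
  interpret R: cstar_alg "reduced_cstar \<Gamma>" by (rule cstar_alg_reduced_cstar)
  note C = assms[unfolded R.cstar_subalgebra_iff_conv]
  have conv_iff: "R.conv s x \<longleftrightarrow> op.conv s x"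
    if "range s \<subseteq> carrier (reduced_cstar \<Gamma>)" "x \<in> carrier (reduced_cstar \<Gamma>)" for s x
    using op.subalg_conv[OF reduced_cstar_subalgebra one_in_reduced_cstar that]
    by (simp add: reduced_cstar_eq[symmetric])
  have "x \<in> C" if s: "range s \<subseteq> C" "op.conv s x" for s x
  proof -
    have "range s \<subseteq> carrier (reduced_cstar \<Gamma>)" using s C by blast
    moreover from this have "x \<in> carrier (reduced_cstar \<Gamma>)"
      using s reduced_cstar_subalgebra unfolding op.cstar_subalgebra_iff_conv by meson
    ultimately show ?thesis using conv_iff s C by blast
  qed
  then have "\<forall>s x. range s \<subseteq> C \<longrightarrow> op.conv s x \<longrightarrow> x \<in> C" by blast
  moreover have "C \<subseteq> carrier (op_algebra (pos_cone \<Gamma>))"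
    using conjunct1[OF C] reduced_cstar_in_bounded_ops by auto
  ultimately show ?thesis
    using conjunct2[OF C] unfolding op.cstar_subalgebra_iff_conv by simp
qed

end

section \<open>The Toeplitz algebra and uniqueness of its morphisms\<close>

lemmas toeplitz_cstar = cstar_alg_reduced_cstar[OF rat_subgroup_Ints, folded toeplitz_def]
lemmas toeplitz_simps [simp] = reduced_cstar_simps[OF rat_subgroup_Ints, folded toeplitz_def]
lemmas shift_in_toeplitz = shift_in_reduced_cstar[OF rat_subgroup_Ints, folded toeplitz_def]
lemmas toeplitz_in_bounded_ops = reduced_cstar_in_bounded_ops[OF rat_subgroup_Ints, folded toeplitz_def]
lemmas toeplitz_subalgebra = reduced_cstar_subalgebra[OF rat_subgroup_Ints, folded toeplitz_def]

lemma of_nat_in_pos_cone [simp]: "of_nat k \<in> pos_cone \<int>" "0 \<in> pos_cone \<int>" "1 \<in> pos_cone \<int>"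
  by (simp_all add: pos_cone_def)

lemma toeplitz_gen_closed: "toeplitz_gen \<in> carrier toeplitz"
  by (simp add: toeplitz_gen_def shift_in_toeplitz)

lemma toeplitz_gen_pow: "toeplitz_gen [^]\<^bsub>toeplitz\<^esub> k = shift \<int> (of_nat k)"
proof (induction k)
  case (Suc k)
  then show ?case
    by (simp add: nat_pow_def toeplitz_gen_def shift_comp[OF rat_subgroup_Ints] add.commute)
qed (simp add: nat_pow_def shift_0[OF rat_subgroup_Ints])

lemma (in star_hom) hom_nat_pow:
  assumes "x \<in> carrier A"
  shows "\<phi> (x [^]\<^bsub>A\<^esub> (k::nat)) = \<phi> x [^]\<^bsub>B\<^esub> k"
  by (induction k) (use assms in \<open>simp_all add: hom_mult\<close>)

text \<open>The set of agreement is a closed star subalgebra and contains every V_k, these being the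
  powers of the generator.\<close>

lemma toeplitz_hom_unique:
  assumes B: "cstar_alg B" and hom: "\<phi> \<in> unital_star_hom toeplitz B" "\<psi> \<in> unital_star_hom toeplitz B"
    and gen: "\<phi> toeplitz_gen = \<psi> toeplitz_gen" and x: "x \<in> carrier toeplitz"
  shows "\<phi> x = \<psi> x"
proof -
  interpret phi: star_hom toeplitz B \<phi>
    using toeplitz_cstar B hom by (simp add: star_hom_def star_hom_axioms_def)
  interpret psi: star_hom toeplitz B \<psi>
    using toeplitz_cstar B hom by (simp add: star_hom_def star_hom_axioms_def)
  let ?C = "{x \<in> carrier toeplitz. \<phi> x = \<psi> x}"
  have "carrier toeplitz \<subseteq> ?C"
    unfolding toeplitz_def
  proof (rule reduced_cstar_least[OF rat_subgroup_Ints], fold toeplitz_def)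
    show "cstar_subalgebra ?C (op_algebra (pos_cone \<int>))"
      using phi.cstar_subalgebra_equalizer[OF hom(2)]
      by (rule cstar_subalgebra_of_reduced[OF rat_subgroup_Ints, folded toeplitz_def])
    fix g :: rat assume g: "g \<in> pos_cone \<int>"
    then obtain k where k: "g = of_nat k" by (auto simp: pos_cone_Ints)
    have "\<phi> (toeplitz_gen [^]\<^bsub>toeplitz\<^esub> k) = \<psi> (toeplitz_gen [^]\<^bsub>toeplitz\<^esub> k)"
      by (simp only: phi.hom_nat_pow[OF toeplitz_gen_closed] psi.hom_nat_pow[OF toeplitz_gen_closed] gen)
    then show "shift \<int> g \<in> ?C" using shift_in_toeplitz[OF g] by (simp add: toeplitz_gen_pow k)
  qed
  then show ?thesis using x by blast
qed

section \<open>The morphisms \<open>T \<mapsto> V\<^sub>q\<close>\<close>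

text \<open>The copies are indexed by a fundamental domain of the cone under translation by
  \<open>q\<close>. The copy at \<open>h\<close> is the progression h, h + q, h + 2q, ..., on which
  V_q acts as the unilateral shift.\<close>

definition cone_map :: "rat set \<Rightarrow> rat \<Rightarrow> rat operator \<Rightarrow> rat operator" where
  "cone_map \<Gamma> q = l2_decomposition.amp {h \<in> pos_cone \<Gamma>. h < q} (pos_cone \<int>) (pos_cone \<Gamma>) (\<lambda>h k. h + k * q)"

context
  fixes \<Gamma> :: "rat set" and q :: rat
  assumes \<Gamma>: "rat_subgroup \<Gamma>" and q: "q \<in> \<Gamma>" "0 < q"
begin

lemma mult_q_in_pos_cone: "k \<in> pos_cone \<int> \<Longrightarrow> k * q \<in> pos_cone \<Gamma>"
  using rat_subgroup_mult_nat[OF \<Gamma> q(1)] q by (auto simp: pos_cone_Ints) (auto simp: pos_cone_def)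

text \<open>Division with remainder: \<open>k\<close> is the floor of \<open>x / q\<close>, and the
  remainder \<open>h\<close> stays in the group.\<close>

lemma cone_decomposition:
  "l2_decomposition {h \<in> pos_cone \<Gamma>. h < q} (pos_cone \<int>) (pos_cone \<Gamma>) (\<lambda>h k. h + k * q)"
proof
  have inj: "h = h' \<and> k = k'"
    if eq: "h + of_nat k * q = h' + of_nat k' * q" and "0 \<le> h" "h < q" "0 \<le> h'" "h' < q" for h h' k k'
  proof -
    have "\<lfloor>(h + of_nat k * q) / q\<rfloor> = int k" if "0 \<le> h" "h < q" for h k
      using that q by (simp add: floor_eq_iff add_divide_distrib)
    from this[of h k] this[of h' k'] that have "k = k'" by simp
    then show ?thesis using eq by simp
  qed
  have surj: "\<exists>h k. h \<in> pos_cone \<Gamma> \<and> h < q \<and> x = h + of_nat k * q" if x: "x \<in> pos_cone \<Gamma>" for x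
  proof -
    define k where "k = nat \<lfloor>x / q\<rfloor>"
    have "0 \<le> x / q" using x q by (simp add: pos_cone_def)
    then have k: "of_nat k = (of_int \<lfloor>x / q\<rfloor> :: rat)" by (simp add: k_def)
    have "of_nat k \<le> x / q" "x / q < of_nat k + 1" unfolding k by linarith+
    then have "0 \<le> x - of_nat k * q" "x - of_nat k * q < q"
      using q by (simp_all add: field_simps)
    moreover have "x - of_nat k * q \<in> \<Gamma>"
      using x rat_subgroup_mult_nat[OF \<Gamma> q(1), of k] \<Gamma> by (simp add: pos_cone_def rat_subgroup_def)
    ultimately show ?thesis
      by (intro exI[of _ "x - of_nat k * q"] exI[of _ k]) (simp add: pos_cone_def)
  qed
  show "bij_betw (\<lambda>(h, k). h + k * q) ({h \<in> pos_cone \<Gamma>. h < q} \<times> pos_cone \<int>) (pos_cone \<Gamma>)"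
    unfolding bij_betw_def
  proof
    show "inj_on (\<lambda>(h, k). h + k * q) ({h \<in> pos_cone \<Gamma>. h < q} \<times> pos_cone \<int>)"
      by (rule inj_onI) (auto simp: pos_cone_Ints dest!: inj simp: pos_cone_def[of \<Gamma>])
    show "(\<lambda>(h, k). h + k * q) ` ({h \<in> pos_cone \<Gamma>. h < q} \<times> pos_cone \<int>) = pos_cone \<Gamma>"
    proof (intro equalityI subsetI)
      fix x assume "x \<in> pos_cone \<Gamma>"
      then obtain h k where "h \<in> pos_cone \<Gamma>" "h < q" "x = h + of_nat k * q" using surj by blast
      then show "x \<in> (\<lambda>(h, k). h + k * q) ` ({h \<in> pos_cone \<Gamma>. h < q} \<times> pos_cone \<int>)"
        by (intro image_eqI[of _ _ "(h, of_nat k)"]) auto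
    qed (auto intro: pos_cone_add[OF \<Gamma>] mult_q_in_pos_cone)
  qed
qed

interpretation D: l2_decomposition "{h \<in> pos_cone \<Gamma>. h < q}" "pos_cone \<int>" "pos_cone \<Gamma>" "\<lambda>h k. h + k * q"
  by (rule cone_decomposition)

lemma cone_map_shift:
  assumes m: "m \<in> pos_cone \<int>"
  shows "cone_map \<Gamma> q (shift \<int> m) = shift \<Gamma> (m * q)"
  unfolding cone_map_def
proof (rule D.amp_eqI)
  show "shift \<int> m \<in> bounded_ops (pos_cone \<int>)" by (rule shift_closed[OF rat_subgroup_Ints m])
  show "shift \<Gamma> (m * q) \<in> bounded_ops (pos_cone \<Gamma>)" by (rule shift_closed[OF \<Gamma> mult_q_in_pos_cone[OF m]])
  fix f h assume f: "f \<in> l2 (pos_cone \<Gamma>)" and h: "h \<in> {h \<in> pos_cone \<Gamma>. h < q}"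
  show "D.slice h (shift \<Gamma> (m * q) f) = shift \<int> m (D.slice h f)"
  proof
    fix k
    \<comment> \<open>This is where \<open>h < q\<close> matters: k - m <= -1 puts h + (k - m) q
      below 0, so a progression receives nothing from before its starting point.\<close>
    have "f (h + k * q - m * q) = 0" if "k \<in> pos_cone \<int>" "k - m \<notin> pos_cone \<int>"
    proof -
      have "k - m \<in> \<int>" using that m by (auto simp: pos_cone_def)
      with that have "k - m < 0" by (auto simp: pos_cone_def)
      obtain z where z: "k - m = of_int z" using \<open>k - m \<in> \<int>\<close> by (auto elim: Ints_cases)
      with \<open>k - m < 0\<close> have "z \<le> -1" by simp
      then have "(of_int z :: rat) \<le> of_int (-1)" by (simp only: of_int_le_iff)
      then have "k - m \<le> -1" using z by simp
      then have "h + (k - m) * q \<le> h + (-1) * q" using q by (intro add_left_mono mult_right_mono) auto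
      then have "h + k * q - m * q < 0" using h by (simp add: algebra_simps)
      then show ?thesis using l2_off[OF f] by (auto simp: pos_cone_def)
    qed
    moreover have "k \<in> pos_cone \<int>" if "k - m \<in> pos_cone \<int>"
      using pos_cone_add[OF rat_subgroup_Ints that m] by simp
    ultimately show "D.slice h (shift \<Gamma> (m * q) f) k = shift \<int> m (D.slice h f) k"
      using f D.slice_l2[OF f h] by (auto simp: shift_def D.slice_def algebra_simps)
  qed
qed

lemma cone_map_gen: "cone_map \<Gamma> q toeplitz_gen = shift \<Gamma> q"
  using cone_map_shift[of 1] by (simp add: toeplitz_gen_def)

lemma cone_map_op_hom: "cone_map \<Gamma> q \<in> unital_star_hom (op_algebra (pos_cone \<int>)) (op_algebra (pos_cone \<Gamma>))"
  unfolding cone_map_def by (rule D.amp_star_hom)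

text \<open>The operators sent into \<open>reduced_cstar \<Gamma>\<close> form a closed star
  subalgebra, which contains the generators since V_m goes to V_{m q}.\<close>

lemma cone_map_closed:
  assumes "x \<in> carrier toeplitz"
  shows "cone_map \<Gamma> q x \<in> carrier (reduced_cstar \<Gamma>)"
proof -
  interpret phi: star_hom "op_algebra (pos_cone \<int>)" "op_algebra (pos_cone \<Gamma>)" "cone_map \<Gamma> q"
    by (simp add: star_hom_def star_hom_axioms_def cstar_alg_op_algebra cone_map_op_hom)
  have "carrier toeplitz \<subseteq> {x \<in> carrier (op_algebra (pos_cone \<int>)). cone_map \<Gamma> q x \<in> carrier (reduced_cstar \<Gamma>)}"
    unfolding toeplitz_def
  proof (rule reduced_cstar_least[OF rat_subgroup_Ints])
    show "cstar_subalgebra {x \<in> carrier (op_algebra (pos_cone \<int>)). cone_map \<Gamma> q x \<in> carrier (reduced_cstar \<Gamma>)}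
        (op_algebra (pos_cone \<int>))"
      by (rule phi.cstar_subalgebra_preimage[OF reduced_cstar_subalgebra[OF \<Gamma>]])
  qed (simp add: cone_map_shift shift_closed[OF rat_subgroup_Ints] shift_in_reduced_cstar[OF \<Gamma>] mult_q_in_pos_cone)
  then show ?thesis using assms by blast
qed

lemma cone_map_hom: "cone_map \<Gamma> q \<in> unital_star_hom toeplitz (reduced_cstar \<Gamma>)"
  using cone_map_op_hom cone_map_closed
  by (auto simp: unital_star_hom_def ring_hom_def toeplitz_in_bounded_ops reduced_cstar_simps[OF \<Gamma>])

lemma cone_map_inj: "inj_on (cone_map \<Gamma> q) (carrier toeplitz)"
proof -
  have "0 \<in> {h \<in> pos_cone \<Gamma>. h < q}" using q zero_in_pos_cone[OF \<Gamma>] by simp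
  then have "inj_on (cone_map \<Gamma> q) (bounded_ops (pos_cone \<int>))"
    unfolding cone_map_def by (intro D.amp_inj) blast
  then show ?thesis by (rule inj_on_subset) (auto simp: toeplitz_in_bounded_ops)
qed

end

text \<open>Discharges the definite description: the amplification for the integers with q = k gives
  existence, and the value at the generator gives uniqueness. The bound on \<open>k\<close> makes q
  positive.\<close>

lemma toeplitz_endo:
  assumes "k \<ge> 1"
  shows "toeplitz_endo k \<in> unital_star_hom toeplitz toeplitz"
    and "toeplitz_endo k toeplitz_gen = shift \<int> (of_nat k)"
proof -
  let ?P = "\<lambda>\<phi>. \<phi> \<in> unital_star_hom toeplitz toeplitz \<and> \<phi> \<in> extensional (carrier toeplitz) \<and>
     \<phi> toeplitz_gen = toeplitz_gen [^]\<^bsub>toeplitz\<^esub> k"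
  let ?q = "of_nat k :: rat"
  have q: "?q \<in> \<int>" "0 < ?q" using assms by auto
  note hom = cone_map_hom[OF rat_subgroup_Ints q, folded toeplitz_def]
  interpret T: cstar_alg toeplitz by (rule toeplitz_cstar)
  \<comment> \<open>Cutting down to the carrier supplies the extensionality demanded by the
    description; the closure rules keep the morphism laws intact.\<close>
  have "restrict (cone_map \<int> ?q) (carrier toeplitz) \<in> unital_star_hom toeplitz toeplitz"
    using hom T.adj_closed T.smult_closed by (auto simp: unital_star_hom_def ring_hom_def simp del: toeplitz_simps)
  then have "?P (restrict (cone_map \<int> ?q) (carrier toeplitz))"
    by (simp add: toeplitz_gen_closed toeplitz_gen_pow cone_map_gen[OF rat_subgroup_Ints q])
  moreover have "\<phi> = \<psi>" if "?P \<phi>" "?P \<psi>" for \<phi> \<psi>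
    using that toeplitz_hom_unique[OF toeplitz_cstar, of \<phi> \<psi>] by (auto intro: extensionalityI)
  ultimately have "\<exists>!\<phi>. ?P \<phi>" by blast
  then have "?P (toeplitz_endo k)"
    unfolding toeplitz_endo_def by (rule theI')
  then show "toeplitz_endo k \<in> unital_star_hom toeplitz toeplitz"
    "toeplitz_endo k toeplitz_gen = shift \<int> (of_nat k)"
    by (simp_all add: toeplitz_gen_pow)
qed

section \<open>Injective morphisms of the Toeplitz algebra are isometric\<close>

abbreviation NN :: "rat set" where "NN \<equiv> pos_cone \<int>"

text \<open>\<open>rank_one g\<close> is the operator \<open>g \<otimes> e\<^sub>0\<^sup>*\<close>.\<close>
definition rank_one :: "(rat \<Rightarrow> complex) \<Rightarrow> rat operator" where
  "rank_one g = (\<lambda>f. if f \<in> l2 NN then (\<lambda>x. f 0 * g x) else (\<lambda>x. 0))"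

lemma
  assumes g: "g \<in> l2 NN"
  shows rank_one_closed: "rank_one g \<in> bounded_ops NN"
    and rank_one_norm: "op_norm NN (rank_one g) \<le> l2_norm NN g"
proof -
  have le: "l2_norm NN (rank_one g f) \<le> l2_norm NN g * l2_norm NN f" if f: "f \<in> l2 NN" for f
    using f mult_right_mono[OF cmod_le_l2_norm[OF f, of 0] l2_norm_nonneg[of NN g]]
    by (simp add: rank_one_def l2_norm_smult mult.commute)
  show "rank_one g \<in> bounded_ops NN"
    by (rule bounded_opsI[OF _ _ _ le]) (use g in \<open>auto simp: rank_one_def algebra_simps\<close>)
  show "op_norm NN (rank_one g) \<le> l2_norm NN g"
    by (rule op_norm_leI[OF _ le]) auto
qed

lemma adj_toeplitz_gen:
  assumes "f \<in> l2 NN"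
  shows "op_adjoint NN toeplitz_gen f = (\<lambda>x. if x \<in> NN then f (x + 1) else 0)"
proof -
  have T: "toeplitz_gen \<in> bounded_ops NN" by (rule toeplitz_in_bounded_ops[OF toeplitz_gen_closed])
  note Tf = bounded_ops_closed[OF op_adjoint_closed[OF T] assms]
  have "op_adjoint NN toeplitz_gen f x = f (x + 1)" if x: "x \<in> NN" for x
  proof -
    have x1: "x + 1 \<in> NN" using pos_cone_add[OF rat_subgroup_Ints x] by simp
    have "op_adjoint NN toeplitz_gen f x = l2_inner NN (op_adjoint NN toeplitz_gen f) (l2_basis x)"
      using x by (simp add: l2_inner_basis_right)
    also have "\<dots> = l2_inner NN f (toeplitz_gen (l2_basis x))"
      by (rule op_adjoint_inner'[OF T assms l2_basis_in_l2[OF x]])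
    also have "\<dots> = f (x + 1)"
      using x1 by (simp add: toeplitz_gen_def shift_basis[OF x] add.commute l2_inner_basis_right)
    finally show ?thesis .
  qed
  then show ?thesis using l2_off[OF Tf] by auto
qed

text \<open>T T^* annihilates e_0 and fixes the other basis vectors, so 1 - T T^* is the projection
  onto e_0. Through this identity rank one operators enter the Toeplitz algebra.\<close>

lemma rank_one_basis_0:
  "rank_one (l2_basis 0) = \<one>\<^bsub>toeplitz\<^esub> \<ominus>\<^bsub>toeplitz\<^esub> toeplitz_gen \<otimes>\<^bsub>toeplitz\<^esub> adj toeplitz toeplitz_gen"
proof -
  interpret T: cstar_alg toeplitz by (rule toeplitz_cstar)
  have c: "toeplitz_gen \<circ> op_adjoint NN toeplitz_gen \<in> carrier toeplitz"
    using T.m_closed[OF toeplitz_gen_closed T.adj_closed[OF toeplitz_gen_closed]] by simp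
  have T: "toeplitz_gen \<in> bounded_ops NN" by (rule toeplitz_in_bounded_ops[OF toeplitz_gen_closed])
  have "(\<ominus>\<^bsub>toeplitz\<^esub> (toeplitz_gen \<circ> op_adjoint NN toeplitz_gen)) =
      (\<lambda>f x. - toeplitz_gen (op_adjoint NN toeplitz_gen f) x)"
    using T.smult_minus_1[OF c] by (simp add: fun_eq_iff)
  then have "\<one>\<^bsub>toeplitz\<^esub> \<ominus>\<^bsub>toeplitz\<^esub> toeplitz_gen \<otimes>\<^bsub>toeplitz\<^esub> adj toeplitz toeplitz_gen =
      (\<lambda>f x. (if f \<in> l2 NN then f else (\<lambda>x. 0)) x - toeplitz_gen (op_adjoint NN toeplitz_gen f) x)"
    by (simp add: a_minus_def)
  moreover have "rank_one (l2_basis 0) f x =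
      (if f \<in> l2 NN then f else (\<lambda>x. 0)) x - toeplitz_gen (op_adjoint NN toeplitz_gen f) x" for f x
  proof (cases "f \<in> l2 NN")
    case True
    have "x = 0" if x: "x \<in> NN" "x - 1 \<notin> NN"
    proof -
      obtain k where k: "x = of_nat k" using x by (auto simp: pos_cone_Ints)
      show "x = 0"
      proof (cases k)
        case (Suc j)
        then have "x - 1 = of_nat j" by (simp add: k)
        then show ?thesis using x by (simp add: pos_cone_Ints)
      qed (simp add: k)
    qed
    moreover have "- 1 \<notin> NN" by (simp add: pos_cone_def)
    moreover have "x \<in> NN" if "x - 1 \<in> NN" using pos_cone_add[OF rat_subgroup_Ints that, of 1] by simp
    moreover have "toeplitz_gen (op_adjoint NN toeplitz_gen f) x = (if x - 1 \<in> NN then f x else 0)"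
    proof -
      have "toeplitz_gen h x = (if h \<in> l2 NN then h (x - 1) else 0)" for h
        by (simp add: toeplitz_gen_def shift_def)
      then show ?thesis
        using bounded_ops_closed[OF op_adjoint_closed[OF T] True]
        by (simp add: adj_toeplitz_gen[OF True])
    qed
    ultimately show ?thesis
      using True l2_off[OF True, of x] by (auto simp: rank_one_def l2_basis_def)
  next
    case False
    then show ?thesis
      by (simp add: rank_one_def bounded_ops_off[OF op_adjoint_closed[OF T]] bounded_ops_zero[OF T])
  qed
  ultimately show ?thesis by (simp add: fun_eq_iff)
qed

text \<open>V_h carries the projection onto e_0 to \<open>rank_one (l2_basis h)\<close>; the rest is
  linearity in \<open>g\<close>, the bound \<open>rank_one_norm\<close> and closedness of the
  algebra.\<close>

lemma rank_one_in_toeplitz: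
  assumes "g \<in> l2 NN"
  shows "rank_one g \<in> carrier toeplitz"
proof -
  interpret op: cstar_alg "op_algebra NN" by (rule cstar_alg_op_algebra)
  interpret T: cstar_alg toeplitz by (rule toeplitz_cstar)
  note C = toeplitz_subalgebra[unfolded op.cstar_subalgebra_iff_conv]
  have basis_0: "rank_one (l2_basis 0) \<in> carrier toeplitz"
    unfolding rank_one_basis_0
    by (intro T.minus_closed T.one_closed T.m_closed T.adj_closed toeplitz_gen_closed)
  from assms show ?thesis
  proof (induction g rule: l2_dense_induct)
    case zero
    have "rank_one (\<lambda>x. 0) = \<zero>\<^bsub>toeplitz\<^esub>" by (rule ext) (simp add: rank_one_def)
    then show ?case using T.zero_closed by (simp del: toeplitz_simps)
  next
    case (basis h)
    have "rank_one (l2_basis h) = shift \<int> h \<otimes>\<^bsub>toeplitz\<^esub> rank_one (l2_basis 0)"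
    proof
      fix f show "rank_one (l2_basis h) f = (shift \<int> h \<otimes>\<^bsub>toeplitz\<^esub> rank_one (l2_basis 0)) f"
        using l2_basis_in_l2[of 0 NN] by (auto simp: rank_one_def shift_def l2_basis_def fun_eq_iff)
    qed
    then show ?case
      using T.m_closed[OF shift_in_toeplitz[OF basis] basis_0] by (simp del: toeplitz_simps)
  next
    case (add f g)
    have "rank_one (\<lambda>x. f x + g x) = rank_one f \<oplus>\<^bsub>toeplitz\<^esub> rank_one g"
      by (rule ext) (simp add: rank_one_def algebra_simps)
    then show ?case using T.a_closed[OF add(3,4)] by (simp del: toeplitz_simps)
  next
    case (smult c f)
    have "rank_one (\<lambda>x. c * f x) = c \<odot>\<^bsub>toeplitz\<^esub> rank_one f"
      by (rule ext) (simp add: rank_one_def algebra_simps)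
    then show ?case using T.smult_closed[OF smult(2)] by (simp del: toeplitz_simps)
  next
    case (closed f)
    have "\<exists>g. g \<in> l2 NN \<and> rank_one g \<in> carrier toeplitz \<and> l2_norm NN (\<lambda>x. f x - g x) < inverse (Suc n)" for n
      by (rule closed(2)) simp
    then obtain s where s: "\<And>n. s n \<in> l2 NN" "\<And>n. rank_one (s n) \<in> carrier toeplitz"
      "\<And>n. l2_norm NN (\<lambda>x. f x - s n x) < inverse (Suc n)" by metis
    have "op.conv (\<lambda>n. rank_one (s n)) (rank_one f)"
    proof (rule op.convI_le[OF _ _ _ LIMSEQ_inverse_real_of_nat])
      fix n
      have "rank_one (s n) \<ominus>\<^bsub>op_algebra NN\<^esub> rank_one f = rank_one (\<lambda>x. s n x - f x)"
        unfolding op_minus[OF rank_one_closed[OF s(1)] rank_one_closed[OF closed(1)]]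
        by (rule ext) (simp add: rank_one_def algebra_simps)
      then have "cnorm (op_algebra NN) (rank_one (s n) \<ominus>\<^bsub>op_algebra NN\<^esub> rank_one f) \<le> l2_norm NN (\<lambda>x. s n x - f x)"
        using rank_one_norm[OF l2_diff[OF s(1) closed(1)]] by simp
      also have "\<dots> = l2_norm NN (\<lambda>x. f x - s n x)"
        using l2_norm_smult[of NN "-1" "\<lambda>x. f x - s n x"] by simp
      finally show "cnorm (op_algebra NN) (rank_one (s n) \<ominus>\<^bsub>op_algebra NN\<^esub> rank_one f) \<le> inverse (real (Suc n))"
        using s(3)[of n] by linarith
    qed (simp_all add: rank_one_closed s closed)
    moreover have "range (\<lambda>n. rank_one (s n)) \<subseteq> carrier toeplitz" using s(2) by blast
    ultimately show ?case using C by blast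
  qed
qed

lemma adj_rank_one_mult:
  assumes g: "g \<in> l2 NN"
  shows "op_adjoint NN (rank_one g) \<circ> rank_one g = (\<lambda>f x. of_real ((l2_norm NN g)\<^sup>2) * rank_one (l2_basis 0) f x)"
    (is "?L = ?R")
proof -
  \<comment> \<open>The candidate for the adjoint; composed with \<open>rank_one g\<close> it
    produces the squared norm of \<open>g\<close> as a scalar.\<close>
  let ?B = "\<lambda>f. if f \<in> l2 NN then (\<lambda>x. l2_inner NN f g * l2_basis 0 x) else (\<lambda>x. 0)"
  have B: "?B \<in> bounded_ops NN"
  proof (rule bounded_opsI)
    fix f assume f: "f \<in> l2 NN"
    have "l2_norm NN (?B f) = cmod (l2_inner NN f g)"
      using f by (simp add: l2_norm_smult l2_norm_basis)
    also have "\<dots> \<le> l2_norm NN g * l2_norm NN f"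
      using cmod_l2_inner_le[OF f g] by (simp add: mult.commute)
    finally show "l2_norm NN (?B f) \<le> l2_norm NN g * l2_norm NN f" .
    show "?B f \<in> l2 NN" using f by (simp add: l2_basis_in_l2)
  qed (use g in \<open>auto simp: l2_basis_in_l2 l2_inner_add_left l2_inner_smult_left algebra_simps\<close>)
  have adj: "op_adjoint NN (rank_one g) = ?B"
    by (rule op_adjoint_eqI[OF rank_one_closed[OF g] B])
       (simp add: rank_one_def l2_inner_smult_left l2_inner_smult_right l2_inner_basis_right
         l2_inner_commute[of NN g])
  have "l2_inner NN (\<lambda>x. 0) g = 0" by (simp add: l2_inner_def)
  then show ?thesis
    unfolding adj by (auto simp: fun_eq_iff rank_one_def g l2_inner_smult_left l2_inner_self)
qed

text \<open>Since \<open>x (g \<otimes> e\<^sub>0\<^sup>*) = x g \<otimes> e\<^sub>0\<^sup>*\<close> and \<open>\<parallel>\<tau> (g \<otimes> e\<^sub>0\<^sup>*)\<parallel>\<^sup>2 = \<parallel>g\<parallel>\<^sup>2 \<parallel>\<tau> (1 - T T\<^sup>*)\<parallel>\<close>, the norm of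
  \<open>\<tau> x\<close> dominates that of \<open>x\<close> as soon as \<open>\<tau> (1 - T T\<^sup>*) \<noteq> 0\<close>.\<close>
lemma toeplitz_hom_isometric:
  assumes B: "cstar_alg B" and hom: "\<tau> \<in> unital_star_hom toeplitz B" and inj: "inj_on \<tau> (carrier toeplitz)"
    and x: "x \<in> carrier toeplitz"
  shows "cnorm B (\<tau> x) = cnorm toeplitz x"
proof (rule antisym)
  interpret tau: star_hom toeplitz B \<tau>
    using toeplitz_cstar B hom by (simp add: star_hom_def star_hom_axioms_def)
  note [simp del] = toeplitz_simps
  show "cnorm B (\<tau> x) \<le> cnorm toeplitz x" by (rule tau.cnorm_hom_le[OF x])
  let ?E = "rank_one (l2_basis 0)"
  note R = rank_one_in_toeplitz
  have E: "?E \<in> carrier toeplitz" by (intro R l2_basis_in_l2) simp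
  let ?c = "cnorm B (\<tau> ?E)"
  have "?E (l2_basis 0) 0 = 1" by (simp add: rank_one_def l2_basis_in_l2) (simp add: l2_basis_def)
  then have "?E \<noteq> \<zero>\<^bsub>toeplitz\<^esub>" by (auto simp: toeplitz_simps)
  \<comment> \<open>Injectivity enters here, through the nonzero projection
    \<open>?E\<close>.\<close>
  then have "\<tau> ?E \<noteq> \<zero>\<^bsub>B\<^esub>"
    using inj E tau.A.zero_closed tau.hom_zero unfolding inj_on_def by metis
  then have c: "?c > 0" using E tau.B.cnorm_eq_0 tau.B.cnorm_nonneg by (metis tau.hom_closed less_eq_real_def)
  have norm_R: "(cnorm B (\<tau> (rank_one g)))\<^sup>2 = (l2_norm NN g)\<^sup>2 * ?c" if g: "g \<in> l2 NN" for g
  proof -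
    have "(cnorm B (\<tau> (rank_one g)))\<^sup>2 = cnorm B (\<tau> (adj toeplitz (rank_one g) \<otimes>\<^bsub>toeplitz\<^esub> rank_one g))"
      using R[OF g] by (simp add: tau.hom_mult tau.hom_adj tau.B.cnorm_adj_mult)
    also have "adj toeplitz (rank_one g) \<otimes>\<^bsub>toeplitz\<^esub> rank_one g = of_real ((l2_norm NN g)\<^sup>2) \<odot>\<^bsub>toeplitz\<^esub> ?E"
      using adj_rank_one_mult[OF g] by (simp add: toeplitz_simps)
    finally show ?thesis using E by (simp add: tau.hom_smult tau.B.cnorm_smult norm_power)
  qed
  have xb: "x \<in> bounded_ops NN" by (rule toeplitz_in_bounded_ops[OF x])
  have "op_norm NN x \<le> cnorm B (\<tau> x)"
  proof (rule op_norm_leI)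
    show "0 \<le> cnorm B (\<tau> x)" using x by simp
    fix g assume g: "g \<in> l2 NN"
    note xg = bounded_ops_closed[OF xb g]
    have "rank_one (x g) = x \<otimes>\<^bsub>toeplitz\<^esub> rank_one g"
      by (rule ext) (use g in \<open>auto simp: rank_one_def toeplitz_simps bounded_ops_smult[OF xb] bounded_ops_zero[OF xb]\<close>)
    then have "cnorm B (\<tau> (rank_one (x g))) \<le> cnorm B (\<tau> x) * cnorm B (\<tau> (rank_one g))"
      using x R[OF g] by (simp add: tau.hom_mult tau.B.cnorm_mult)
    then have "(cnorm B (\<tau> (rank_one (x g))))\<^sup>2 \<le> (cnorm B (\<tau> x) * cnorm B (\<tau> (rank_one g)))\<^sup>2"
      using R[OF xg] by (intro power_mono) auto
    then have "(l2_norm NN (x g))\<^sup>2 * ?c \<le> (cnorm B (\<tau> x) * l2_norm NN g)\<^sup>2 * ?c"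
      by (simp add: norm_R[OF xg] norm_R[OF g] power_mult_distrib mult.assoc)
    \<comment> \<open>The common factor \<open>?c\<close> cancels, which turns the estimate in
      \<open>B\<close> into one between vectors.\<close>
    then have "(l2_norm NN (x g))\<^sup>2 \<le> (cnorm B (\<tau> x) * l2_norm NN g)\<^sup>2" using c by simp
    then show "l2_norm NN (x g) \<le> cnorm B (\<tau> x) * l2_norm NN g"
      by (rule power2_le_imp_le) (use x in simp)
  qed
  then show "cnorm toeplitz x \<le> cnorm B (\<tau> x)" by (simp add: toeplitz_simps)
qed

section \<open>Inductive limits\<close>

text \<open>On the dense unions the isomorphism must send \<tau> a x to \<tau>' a x. Injectivity
  makes this well defined, as two representations of one element coincide at a common upper index;
  \<open>isometric\<close> lets it extend to the closures.\<close>

lemma inductive_limit_unique: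
  assumes dir: "directed_set K r"
    and A: "\<And>a. a \<in> K \<Longrightarrow> cstar_alg (A a)"
    and \<sigma>: "\<And>a b x. (a, b) \<in> r \<Longrightarrow> x \<in> carrier (A a) \<Longrightarrow> \<sigma> b a x \<in> carrier (A b)"
    and L: "inductive_limit K r A \<sigma> L \<tau>" and L': "inductive_limit K r A \<sigma> L' \<tau>'"
    and isometric: "\<And>a x. a \<in> K \<Longrightarrow> x \<in> carrier (A a) \<Longrightarrow> cnorm L' (\<tau>' a x) = cnorm L (\<tau> a x)"
  shows "cstar_isomorphic L L'"
proof -
  have cL: "cstar_alg L" and cL': "cstar_alg L'"
    using L L' by (auto simp: inductive_limit_def intro: cstar_algI)
  have hom: "star_hom (A a) L (\<tau> a)" "star_hom (A a) L' (\<tau>' a)" if "a \<in> K" for a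
    using L L' A[OF that] cL cL' that by (auto simp: inductive_limit_def star_hom_def star_hom_axioms_def)
  have compat: "\<tau> a x = \<tau> b (\<sigma> b a x)" "\<tau>' a x = \<tau>' b (\<sigma> b a x)"
    if "(a, b) \<in> r" "x \<in> carrier (A a)" for a b x
    using L L' that by (auto simp: inductive_limit_def)
  have inj: "inj_on (\<tau> a) (carrier (A a))" if "a \<in> K" for a
    using L that by (simp add: inductive_limit_def)
  let ?D = "\<Union>a\<in>K. \<tau> a ` carrier (A a)"
  define \<psi> where "\<psi> y = (SOME z. \<exists>a\<in>K. \<exists>x\<in>carrier (A a). y = \<tau> a x \<and> z = \<tau>' a x)" for y
  \<comment> \<open>Elements from two indices move to a common upper bound simultaneously in both
    limits. Well-definedness and closure of the union under sums and products both rest on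
    this.\<close>
  have pair: "\<exists>c\<in>K. \<exists>x'\<in>carrier (A c). \<exists>y'\<in>carrier (A c). \<tau> a x = \<tau> c x' \<and> \<tau>' a x = \<tau>' c x' \<and>
      \<tau> b y = \<tau> c y' \<and> \<tau>' b y = \<tau>' c y'"
    if ab: "a \<in> K" "b \<in> K" "x \<in> carrier (A a)" "y \<in> carrier (A b)" for a b x y
  proof -
    obtain c where c: "c \<in> K" "(a, c) \<in> r" "(b, c) \<in> r"
      using dir ab by (auto simp: directed_set_def)
    show ?thesis
      using c ab compat[OF c(2) ab(3)] compat[OF c(3) ab(4)] \<sigma>[OF c(2) ab(3)] \<sigma>[OF c(3) ab(4)]
      by blast
  qed
  have psi: "\<psi> (\<tau> a x) = \<tau>' a x" if a: "a \<in> K" "x \<in> carrier (A a)" for a x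
    unfolding \<psi>_def
  proof (rule some_equality)
    fix z assume "\<exists>b\<in>K. \<exists>y\<in>carrier (A b). \<tau> a x = \<tau> b y \<and> z = \<tau>' b y"
    then obtain b y where b: "b \<in> K" "y \<in> carrier (A b)" "\<tau> a x = \<tau> b y" "z = \<tau>' b y" by blast
    obtain c x' y' where c: "c \<in> K" "x' \<in> carrier (A c)" "y' \<in> carrier (A c)"
      "\<tau> a x = \<tau> c x'" "\<tau>' a x = \<tau>' c x'" "\<tau> b y = \<tau> c y'" "\<tau>' b y = \<tau>' c y'"
      using pair[OF a(1) b(1) a(2) b(2)] by metis
    then have "x' = y'" using inj[OF c(1)] b(3) by (simp add: inj_on_def)
    then show "z = \<tau>' a x" using b c by simp
  qed (use a in blast)
  have D1: "\<exists>a\<in>K. \<exists>x\<in>carrier (A a). u = \<tau> a x" if "u \<in> ?D" for u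
    using that by blast
  have D2: "\<exists>a\<in>K. \<exists>x\<in>carrier (A a). \<exists>y\<in>carrier (A a). u = \<tau> a x \<and> v = \<tau> a y" if uv: "u \<in> ?D" "v \<in> ?D" for u v
  proof -
    obtain a x where a: "a \<in> K" "x \<in> carrier (A a)" "u = \<tau> a x" using uv by blast
    obtain b y where b: "b \<in> K" "y \<in> carrier (A b)" "v = \<tau> b y" using uv by blast
    show ?thesis using pair[OF a(1) b(1) a(2) b(2)] a(3) b(3) by metis
  qed
  show ?thesis
  proof (rule cstar_isomorphic_of_dense_isometry[OF cL cL'])
    obtain a where a: "a \<in> K" using dir by (auto simp: directed_set_def)
    interpret t: star_hom "A a" L "\<tau> a" by (rule hom[OF a])
    interpret t': star_hom "A a" L' "\<tau>' a" by (rule hom[OF a])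
    show "\<one>\<^bsub>L\<^esub> \<in> ?D" using a t.hom_one t.A.one_closed by (metis UN_iff image_eqI)
    show "\<psi> \<one>\<^bsub>L\<^esub> = \<one>\<^bsub>L'\<^esub>" using psi[OF a t.A.one_closed] by simp
  next
    show "?D \<subseteq> carrier L"
      using star_hom.hom_closed[OF hom(1)] by blast
    show "carrier L = cstar_topology L closure_of ?D" using L by (simp add: inductive_limit_def)
    have "\<psi> ` ?D = (\<Union>a\<in>K. \<tau>' a ` carrier (A a))"
      using psi by (force simp: image_iff)
    then show "carrier L' = cstar_topology L' closure_of (\<psi> ` ?D)" using L' by (simp add: inductive_limit_def)
  next
    fix u assume u: "u \<in> ?D"
    then obtain a x where a: "a \<in> K" "x \<in> carrier (A a)" "u = \<tau> a x" using D1 by blast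
    interpret t: star_hom "A a" L "\<tau> a" by (rule hom[OF a(1)])
    interpret t': star_hom "A a" L' "\<tau>' a" by (rule hom[OF a(1)])
    show "\<psi> u \<in> carrier L'" using a psi by simp
    show "cnorm L' (\<psi> u) = cnorm L u" using a psi isometric by simp
    show "adj L u \<in> ?D \<and> \<psi> (adj L u) = adj L' (\<psi> u)"
      using a psi[OF a(1,2)] psi[OF a(1) t.A.adj_closed[OF a(2)]] t.A.adj_closed[OF a(2)] t.hom_adj[OF a(2)] t'.hom_adj[OF a(2)]
      by (metis (no_types, lifting) UN_iff image_eqI)
    show "c \<odot>\<^bsub>L\<^esub> u \<in> ?D \<and> \<psi> (c \<odot>\<^bsub>L\<^esub> u) = c \<odot>\<^bsub>L'\<^esub> \<psi> u" for c :: complex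
      using a psi[OF a(1,2)] psi[OF a(1) t.A.smult_closed[OF a(2), of c]] t.A.smult_closed[OF a(2), of c]
        t.hom_smult[OF a(2), of c] t'.hom_smult[OF a(2), of c]
      by (metis (no_types, lifting) UN_iff image_eqI)
  next
    fix u v assume "u \<in> ?D" "v \<in> ?D"
    then obtain a x y where a: "a \<in> K" "x \<in> carrier (A a)" "y \<in> carrier (A a)" "u = \<tau> a x" "v = \<tau> a y"
      using D2 by blast
    interpret t: star_hom "A a" L "\<tau> a" by (rule hom[OF a(1)])
    interpret t': star_hom "A a" L' "\<tau>' a" by (rule hom[OF a(1)])
    note xy = a(2,3)
    show "u \<oplus>\<^bsub>L\<^esub> v \<in> ?D \<and> \<psi> (u \<oplus>\<^bsub>L\<^esub> v) = \<psi> u \<oplus>\<^bsub>L'\<^esub> \<psi> v"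
      using a psi[OF a(1) a(2)] psi[OF a(1) a(3)] psi[OF a(1) t.A.a_closed[OF xy]] t.A.a_closed[OF xy]
        t.hom_add[OF xy] t'.hom_add[OF xy]
      by (metis (no_types, lifting) UN_iff image_eqI)
    show "u \<otimes>\<^bsub>L\<^esub> v \<in> ?D \<and> \<psi> (u \<otimes>\<^bsub>L\<^esub> v) = \<psi> u \<otimes>\<^bsub>L'\<^esub> \<psi> v"
      using a psi[OF a(1) a(2)] psi[OF a(1) a(3)] psi[OF a(1) t.A.m_closed[OF xy]] t.A.m_closed[OF xy]
        t.hom_mult[OF xy] t'.hom_mult[OF xy]
      by (metis (no_types, lifting) UN_iff image_eqI)
  qed
qed

text \<open>The canonical morphisms into either limit are injective, so both preserve the Toeplitz
  norm and hence agree in norm with each other.\<close>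

lemma toeplitz_limits_isomorphic:
  assumes dir: "directed_set K r" and n: "\<And>a b. (a, b) \<in> r \<Longrightarrow> n b a \<ge> 1"
    and L: "inductive_limit K r (\<lambda>_. toeplitz) (\<lambda>b a. toeplitz_endo (n b a)) L \<tau>"
    and L': "inductive_limit K r (\<lambda>_. toeplitz) (\<lambda>b a. toeplitz_endo (n b a)) L' \<tau>'"
  shows "cstar_isomorphic L L'"
proof (rule inductive_limit_unique[OF dir _ _ L L'])
  show "cstar_alg toeplitz" by (rule toeplitz_cstar)
  show "toeplitz_endo (n b a) x \<in> carrier toeplitz" if "(a, b) \<in> r" "x \<in> carrier toeplitz" for a b x
    using toeplitz_endo(1)[OF n[OF that(1)]] that(2) by (auto simp: unital_star_hom_def ring_hom_def)
  show "cnorm L' (\<tau>' a x) = cnorm L (\<tau> a x)" if "a \<in> K" "x \<in> carrier toeplitz" for a x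
    using L L' that toeplitz_hom_isometric[of L "\<tau> a" x] toeplitz_hom_isometric[of L' "\<tau>' a" x]
    by (simp add: inductive_limit_def cstar_algI)
qed

text \<open>\<open>q_compat\<close> makes the triangles commute, because V_{q_a} is the power
  V_{q_b}^{n_ba}; \<open>q_cofinal\<close> makes the union dense, because every generator V_g is a
  power of some V_{q_a}.\<close>

lemma inductive_limit_reduced_cstar:
  assumes dir: "directed_set K r" and n: "\<And>a b. (a, b) \<in> r \<Longrightarrow> n b a \<ge> 1"
    and \<Gamma>: "rat_subgroup \<Gamma>" and q: "\<And>a. a \<in> K \<Longrightarrow> q a \<in> \<Gamma>" "\<And>a. a \<in> K \<Longrightarrow> 0 < q a"
    and q_compat: "\<And>a b. (a, b) \<in> r \<Longrightarrow> q a = of_nat (n b a) * q b"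
    and q_cofinal: "\<And>g. g \<in> pos_cone \<Gamma> \<Longrightarrow> \<exists>a\<in>K. \<exists>m. g = of_nat m * q a"
  shows "inductive_limit K r (\<lambda>_. toeplitz) (\<lambda>b a. toeplitz_endo (n b a)) (reduced_cstar \<Gamma>) (\<lambda>a. cone_map \<Gamma> (q a))"
proof -
  interpret R: cstar_alg "reduced_cstar \<Gamma>" by (rule cstar_alg_reduced_cstar[OF \<Gamma>])
  have rK: "a \<in> K" "b \<in> K" if "(a, b) \<in> r" for a b
    using dir that by (auto simp: directed_set_def partial_order_on_def preorder_on_def)
  note hom = cone_map_hom[OF \<Gamma> q]
  note endo = toeplitz_endo[OF n]
  have sh: "star_hom toeplitz (reduced_cstar \<Gamma>) (cone_map \<Gamma> (q a))" if "a \<in> K" for a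
    using hom[OF that that] toeplitz_cstar R.cstar_alg_axioms by (simp add: star_hom_def star_hom_axioms_def)
  have endo_closed: "toeplitz_endo (n b a) x \<in> carrier toeplitz" if "(a, b) \<in> r" "x \<in> carrier toeplitz" for a b x
    using endo(1)[OF that(1)] that(2) by (auto simp: unital_star_hom_def ring_hom_def)
  \<comment> \<open>Both sides are morphisms of the Toeplitz algebra, so it is enough to compare
    them on its generator.\<close>
  have compat: "cone_map \<Gamma> (q a) x = cone_map \<Gamma> (q b) (toeplitz_endo (n b a) x)"
    if ab: "(a, b) \<in> r" and x: "x \<in> carrier toeplitz" for a b x
  proof -
    note ab' = rK[OF ab]
    have "(\<lambda>x. cone_map \<Gamma> (q b) (toeplitz_endo (n b a) x)) \<in> unital_star_hom toeplitz (reduced_cstar \<Gamma>)"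
      using hom[OF ab'(2) ab'(2)] endo(1)[OF ab]
      by (auto simp: unital_star_hom_def ring_hom_def Pi_iff simp del: toeplitz_simps)
    moreover have "cone_map \<Gamma> (q a) toeplitz_gen = cone_map \<Gamma> (q b) (toeplitz_endo (n b a) toeplitz_gen)"
      by (simp add: endo(2)[OF ab] cone_map_gen[OF \<Gamma> q(1)[OF ab'(1)] q(2)[OF ab'(1)]] q_compat[OF ab, symmetric]
          cone_map_shift[OF \<Gamma> q(1)[OF ab'(2)] q(2)[OF ab'(2)]])
    ultimately show ?thesis
      using toeplitz_hom_unique[OF R.cstar_alg_axioms hom[OF ab'(1) ab'(1)] _ _ x] by blast
  qed
  let ?D = "\<Union>a\<in>K. cone_map \<Gamma> (q a) ` carrier toeplitz"
  have D1: "\<exists>a\<in>K. \<exists>x\<in>carrier toeplitz. u = cone_map \<Gamma> (q a) x" if "u \<in> ?D" for u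
    using that by blast
  have D2: "\<exists>a\<in>K. \<exists>x\<in>carrier toeplitz. \<exists>y\<in>carrier toeplitz. u = cone_map \<Gamma> (q a) x \<and> v = cone_map \<Gamma> (q a) y"
    if uv: "u \<in> ?D" "v \<in> ?D" for u v
  proof -
    obtain a x where a: "a \<in> K" "x \<in> carrier toeplitz" "u = cone_map \<Gamma> (q a) x" using uv by blast
    obtain b y where b: "b \<in> K" "y \<in> carrier toeplitz" "v = cone_map \<Gamma> (q b) y" using uv by blast
    obtain c where c: "c \<in> K" "(a, c) \<in> r" "(b, c) \<in> r" using dir a b by (auto simp: directed_set_def)
    show ?thesis
      unfolding a(3) b(3) compat[OF c(2) a(2)] compat[OF c(3) b(2)]
      using c(1) endo_closed[OF c(2) a(2)] endo_closed[OF c(3) b(2)] by blast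
  qed
  have D_sub: "?D \<subseteq> carrier (reduced_cstar \<Gamma>)"
    using cone_map_closed[OF \<Gamma> q] by blast
  have closure: "cstar_subalgebra (R.mtopology closure_of ?D) (reduced_cstar \<Gamma>)"
  proof (rule R.cstar_subalgebra_closure[OF D_sub])
    obtain a where a: "a \<in> K" using dir by (auto simp: directed_set_def)
    interpret t: star_hom toeplitz "reduced_cstar \<Gamma>" "cone_map \<Gamma> (q a)" by (rule sh[OF a])
    have "cone_map \<Gamma> (q a) \<zero>\<^bsub>toeplitz\<^esub> \<in> ?D" using a t.A.zero_closed by blast
    then show "\<zero>\<^bsub>reduced_cstar \<Gamma>\<^esub> \<in> ?D" by (simp only: t.hom_zero)
  next
    fix u assume "u \<in> ?D"
    then obtain a x where a: "a \<in> K" "x \<in> carrier toeplitz" "u = cone_map \<Gamma> (q a) x" using D1 by blast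
    interpret t: star_hom toeplitz "reduced_cstar \<Gamma>" "cone_map \<Gamma> (q a)" by (rule sh[OF a(1)])
    show "c \<odot>\<^bsub>reduced_cstar \<Gamma>\<^esub> u \<in> ?D" for c
      using a t.hom_smult[OF a(2), of c] t.A.smult_closed[OF a(2), of c] by (metis (no_types, lifting) UN_iff image_eqI)
    show "adj (reduced_cstar \<Gamma>) u \<in> ?D"
      using a t.hom_adj[OF a(2)] t.A.adj_closed[OF a(2)] by (metis (no_types, lifting) UN_iff image_eqI)
  next
    fix u v assume "u \<in> ?D" "v \<in> ?D"
    then obtain a x y where a: "a \<in> K" "x \<in> carrier toeplitz" "y \<in> carrier toeplitz"
      "u = cone_map \<Gamma> (q a) x" "v = cone_map \<Gamma> (q a) y" using D2 by blast
    interpret t: star_hom toeplitz "reduced_cstar \<Gamma>" "cone_map \<Gamma> (q a)" by (rule sh[OF a(1)])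
    show "u \<oplus>\<^bsub>reduced_cstar \<Gamma>\<^esub> v \<in> ?D"
      using a t.hom_add[OF a(2,3)] t.A.a_closed[OF a(2,3)] by (metis (no_types, lifting) UN_iff image_eqI)
    show "u \<otimes>\<^bsub>reduced_cstar \<Gamma>\<^esub> v \<in> ?D"
      using a t.hom_mult[OF a(2,3)] t.A.m_closed[OF a(2,3)] by (metis (no_types, lifting) UN_iff image_eqI)
  qed
  have "carrier (reduced_cstar \<Gamma>) \<subseteq> R.mtopology closure_of ?D"
  proof (rule reduced_cstar_least[OF \<Gamma> cstar_subalgebra_of_reduced[OF \<Gamma> closure]])
    fix g assume "g \<in> pos_cone \<Gamma>"
    then obtain a m where a: "a \<in> K" "g = of_nat m * q a" using q_cofinal by blast
    have "shift \<Gamma> g = cone_map \<Gamma> (q a) (shift \<int> (of_nat m))"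
      using a q by (simp add: cone_map_shift[OF \<Gamma>])
    then have "shift \<Gamma> g \<in> ?D" using a(1) shift_in_toeplitz[OF of_nat_in_pos_cone(1)] by blast
    then show "shift \<Gamma> g \<in> R.mtopology closure_of ?D"
      using closure_of_subset[of ?D R.mtopology] D_sub by auto
  qed
  moreover have "R.mtopology closure_of ?D \<subseteq> carrier (reduced_cstar \<Gamma>)"
    using closure by (simp add: cstar_subalgebra_def)
  ultimately show ?thesis
    unfolding inductive_limit_def
    using R.unital hom cone_map_inj[OF \<Gamma> q] compat by auto
qed

lemma cstar_isomorphic_refl: "cstar_isomorphic A A"
  unfolding cstar_isomorphic_def unital_star_hom_def ring_hom_def by (rule bexI[of _ id]) auto

section \<open>The sequence of denominators\<close>

text \<open>Partial products divide later ones, so any two elements have a common denominator among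
  them.\<close>

lemma rat_group_subgroup:
  assumes M: "\<And>s. s \<ge> 1 \<Longrightarrow> M s \<ge> 1"
  shows "rat_subgroup (rat_group M)"
proof -
  let ?P = "\<lambda>s. \<Prod>i=1..s. M i"
  have P0: "?P s \<noteq> 0" for s using M by (fastforce simp: prod_zero_iff)
  have extend: "\<exists>m'. of_int m / of_nat (?P s) = (of_int m' / of_nat (?P t) :: rat)" if "s \<le> t" for m s t
  proof -
    have "?P s dvd ?P t" using that by (intro prod_dvd_prod_subset) auto
    then obtain k where k: "?P t = ?P s * k" by (elim dvdE)
    then have "k \<noteq> 0" using P0[of t] by auto
    then have "of_int m / of_nat (?P s) = (of_int (m * int k) / of_nat (?P t) :: rat)"
      unfolding k by simp
    then show ?thesis by blast
  qed
  have common: "\<exists>m m' s. s \<ge> 1 \<and> x = of_int m / of_nat (?P s) \<and> y = of_int m' / of_nat (?P s)"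
    if xy: "x \<in> rat_group M" "y \<in> rat_group M" for x y :: rat
  proof -
    obtain m s m' s' where *: "s \<ge> 1" "x = of_int m / of_nat (?P s)" "s' \<ge> 1" "y = of_int m' / of_nat (?P s')"
      using xy unfolding rat_group_def by blast
    then show ?thesis
      using extend[of s "max s s'" m] extend[of s' "max s s'" m'] by (metis max.cobounded1 max.cobounded2 order_trans)
  qed
  have "x + y \<in> rat_group M \<and> x - y \<in> rat_group M" if xy: "x \<in> rat_group M" "y \<in> rat_group M" for x y
  proof -
    obtain m m' s where *: "s \<ge> 1" "x = of_int m / of_nat (?P s)" "y = of_int m' / of_nat (?P s)"
      using common[OF xy] by blast
    have "x + y = of_int (m + m') / of_nat (?P s)" "x - y = of_int (m - m') / of_nat (?P s)"
      unfolding * by (simp_all only: of_int_add of_int_diff add_divide_distrib diff_divide_distrib)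
    then show ?thesis using *(1) unfolding rat_group_def by blast
  qed
  moreover have "0 = (of_int 0 / of_nat (?P 1) :: rat)" by simp
  then have "0 \<in> rat_group M" unfolding rat_group_def by blast
  ultimately show ?thesis by (simp add: rat_subgroup_def)
qed

text \<open>A limit is determined only up to isomorphism, so the last clause ranges over all limits
  on a type \<open>'b\<close>. The clause before it secures existence on one concrete type, with the
  reduced algebra itself as witness.\<close>

theorem theorem4p1:
  fixes K :: "'k set" and r :: "('k \<times> 'k) set" and n :: "'k \<Rightarrow> 'k \<Rightarrow> nat"
  assumes "directed_set K r"
    and "\<And>a b. (a, b) \<in> r \<Longrightarrow> n b a \<ge> 1"
    and "\<And>a b c. (a, b) \<in> r \<Longrightarrow> (b, c) \<in> r \<Longrightarrow> n c a = n c b * n b a"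
  shows "\<exists>M :: nat \<Rightarrow> nat. (\<forall>s\<ge>1. M s \<ge> 1) \<and>
    (\<exists>(L :: rat operator cstar_algebra) \<tau>.
       inductive_limit K r (\<lambda>_. toeplitz) (\<lambda>b a. toeplitz_endo (n b a)) L \<tau> \<and>
       cstar_isomorphic (reduced_cstar (rat_group M)) L) \<and>
    (\<forall>(L :: 'b cstar_algebra) \<tau>.
       inductive_limit K r (\<lambda>_. toeplitz) (\<lambda>b a. toeplitz_endo (n b a)) L \<tau> \<longrightarrow>
       cstar_isomorphic (reduced_cstar (rat_group M)) L)"
proof -
  note n_pos = assms(2) and n_mult = assms(3)
  have dir: "\<exists>c. (a, c) \<in> r \<and> (b, c) \<in> r" if "a \<in> K" "b \<in> K" for a b
    using assms(1) that by (auto simp: directed_set_def)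
  have rK: "a \<in> K" "b \<in> K" if "(a, b) \<in> r" for a b
    using assms(1) that by (auto simp: directed_set_def partial_order_on_def preorder_on_def)
  have r_refl: "(a, a) \<in> r" if "a \<in> K" for a
    using assms(1) that by (auto simp: directed_set_def partial_order_on_def preorder_on_def refl_on_def)
  have r_trans: "(a, c) \<in> r" if "(a, b) \<in> r" "(b, c) \<in> r" for a b c
    using assms(1) that by (auto simp: directed_set_def partial_order_on_def preorder_on_def dest: transD)
  obtain a0 where a0: "a0 \<in> K" using assms(1) by (auto simp: directed_set_def)
  \<comment> \<open>\<open>n a a\<close> is positive and equal to its own square.\<close>
  have n_refl: "n a a = 1" if "a \<in> K" for a
    using n_mult[OF r_refl r_refl, of a] n_pos[OF r_refl, of a] that by simp

  define d where "d b = n b a0" for b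
  \<comment> \<open>Indices are handled through the countably many values of \<open>d\<close>. Stage
    \<open>s\<close> moves up to an index whose \<open>d\<close> is divisible by \<open>s\<close> if
    \<open>s\<close> occurs as a value; otherwise any index above will do.\<close>
  define next_idx where "next_idx s b = (SOME c. (b, c) \<in> r \<and>
      (\<forall>e. (a0, e) \<in> r \<longrightarrow> d e = s \<longrightarrow> s dvd d c))" for s b
  have next_idx: "(b, next_idx s b) \<in> r \<and> (\<forall>e. (a0, e) \<in> r \<longrightarrow> d e = s \<longrightarrow> s dvd d (next_idx s b))"
    if b: "b \<in> K" for s b
  proof -
    have "\<exists>c. (b, c) \<in> r \<and> (\<forall>e. (a0, e) \<in> r \<longrightarrow> d e = s \<longrightarrow> s dvd d c)"
    proof (cases "\<exists>e. (a0, e) \<in> r \<and> d e = s")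
      case True
      then obtain e where e: "(a0, e) \<in> r" "d e = s" by blast
      obtain c where c: "(b, c) \<in> r" "(e, c) \<in> r" using dir[OF b rK(2)[OF e(1)]] by blast
      have "d c = n c e * s" using n_mult[OF e(1) c(2)] e(2) by (simp add: d_def)
      then show ?thesis using c(1) by auto
    next
      case False
      then show ?thesis using r_refl[OF b] by blast
    qed
    then show ?thesis unfolding next_idx_def by (rule someI_ex)
  qed
  define b where "b = rec_nat a0 next_idx"
  have b0: "b 0 = a0" and bS: "b (Suc s) = next_idx s (b s)" for s by (simp_all add: b_def)
  have b_step: "(b s, b (Suc s)) \<in> r \<and> (a0, b s) \<in> r" for s
    by (induction s) (use a0 r_refl next_idx rK r_trans in \<open>metis b0 bS\<close>)+
  \<comment> \<open>The value \<open>d e\<close> is treated at the stage that bears its number, so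
    divisibility holds from the next index on; this explains the successor.\<close>
  have b_dvd: "d e dvd d (b (Suc (d e)))" if "(a0, e) \<in> r" for e
    using next_idx[of "b (d e)" "d e"] b_step[of "d e"] rK that by (metis bS)

  \<comment> \<open>Ratios of consecutive terms: since \<open>d a0\<close> is 1, the partial
    products telescope to \<open>d (b s)\<close>.\<close>
  define M where "M s = n (b s) (b (s - 1))" for s
  let ?\<Gamma> = "rat_group M"
  have M: "M s \<ge> 1" if "s \<ge> 1" for s
    using that n_pos b_step[of "s - 1"] by (simp add: M_def)
  have prod_M: "(\<Prod>i=1..s. M i) = d (b s)" for s
  proof (induction s)
    case (Suc s)
    then show ?case using b_step[of s] n_mult[of a0 "b s" "b (Suc s)"] by (simp add: M_def d_def mult.commute)
  qed (simp add: b0 d_def n_refl[OF a0])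
  have group: "?\<Gamma> = {of_int m / of_nat (d (b s)) | m s. s \<ge> 1}"
    unfolding rat_group_def prod_M ..

  define q :: "'k \<Rightarrow> rat" where "q a = (let c = SOME c. (a, c) \<in> r \<and> (a0, c) \<in> r in of_nat (n c a) / of_nat (d c))" for a
  have d_pos: "d c \<ge> 1" if "(a0, c) \<in> r" for c using n_pos[OF that] by (simp add: d_def)
  \<comment> \<open>Passing from \<open>c\<close> to \<open>e\<close> multiplies numerator and
    denominator by \<open>n e c\<close>.\<close>
  have ratio_mono: "of_nat (n c a) / of_nat (d c) = (of_nat (n e a) / of_nat (d e) :: rat)"
    if "(a, c) \<in> r" "(a0, c) \<in> r" "(c, e) \<in> r" for a c e
    using n_mult[OF that(1,3)] n_mult[OF that(2,3)] n_pos[OF that(3)] by (simp add: d_def)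
  have q_eq: "q a = of_nat (n c a) / of_nat (d c)" if c: "(a, c) \<in> r" "(a0, c) \<in> r" for a c
  proof -
    define c' where "c' = (SOME c. (a, c) \<in> r \<and> (a0, c) \<in> r)"
    have c': "(a, c') \<in> r \<and> (a0, c') \<in> r" unfolding c'_def by (rule someI_ex) (use c in blast)
    obtain e where e: "(c, e) \<in> r" "(c', e) \<in> r" using dir rK(2) c(1) c' by blast
    have "q a = of_nat (n c' a) / of_nat (d c')" by (simp add: q_def Let_def c'_def)
    also have "\<dots> = of_nat (n e a) / of_nat (d e)" using c' e by (intro ratio_mono) auto
    also have "\<dots> = of_nat (n c a) / of_nat (d c)" using ratio_mono[OF c e(1)] by simp
    finally show ?thesis .
  qed
  have limit: "inductive_limit K r (\<lambda>_. toeplitz) (\<lambda>b a. toeplitz_endo (n b a)) (reduced_cstar ?\<Gamma>) (\<lambda>a. cone_map ?\<Gamma> (q a))"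
  proof (rule inductive_limit_reduced_cstar[OF assms(1) n_pos rat_group_subgroup[OF M]])
    fix a assume a: "a \<in> K"
    obtain c where c: "(a, c) \<in> r" "(a0, c) \<in> r" using dir[OF a a0] by blast
    \<comment> \<open>\<open>d c\<close> divides the denominator reached after stage
      \<open>d c\<close>, and \<open>k\<close> is the cofactor that expands the fraction
      \<open>q a\<close>. The successor also provides the index at least 1 that
      \<open>rat_group\<close> asks for.\<close>
    obtain k where k: "d (b (Suc (d c))) = d c * k" using b_dvd[OF c(2)] by (elim dvdE)
    have "k \<noteq> 0" using k d_pos[of "b (Suc (d c))"] b_step by (metis mult_0_right not_one_le_zero)
    then have "q a = of_int (int (n c a * k)) / of_nat (d (b (Suc (d c))))"
      unfolding q_eq[OF c] k by simp
    moreover have "Suc (d c) \<ge> 1" by simp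
    ultimately show "q a \<in> ?\<Gamma>" unfolding group by blast
    show "0 < q a" unfolding q_eq[OF c] using n_pos[OF c(1)] d_pos[OF c(2)] by simp
  next
    fix a a' assume aa': "(a, a') \<in> r"
    obtain c where c: "(a', c) \<in> r" "(a0, c) \<in> r" using dir[OF rK(2)[OF aa'] a0] by blast
    show "q a = of_nat (n a' a) * q a'"
      unfolding q_eq[OF c] q_eq[OF r_trans[OF aa' c(1)] c(2)] n_mult[OF aa' c(1)] by simp
  next
    fix g assume "g \<in> pos_cone ?\<Gamma>"
    then obtain m s where g: "0 \<le> g" "g = of_int m / of_nat (d (b s))"
      unfolding pos_cone_def group by blast
    have bs: "(a0, b s) \<in> r" "b s \<in> K" using b_step[of s] rK by auto
    have "0 \<le> m" using g d_pos[OF bs(1)] by (simp add: zero_le_divide_iff)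
    \<comment> \<open>At the index \<open>b s\<close> itself the numerator
      \<open>n (b s) (b s)\<close> is 1, so \<open>q (b s)\<close> is the unit fraction with
      denominator \<open>d (b s)\<close>.\<close>
    then have "g = of_nat (nat m) * q (b s)"
      using g(2) by (simp add: q_eq[OF r_refl[OF bs(2)] bs(1)] n_refl[OF bs(2)])
    then show "\<exists>a\<in>K. \<exists>m. g = of_nat m * q a" using bs(2) by blast
  qed
  show ?thesis
    using M limit cstar_isomorphic_refl toeplitz_limits_isomorphic[OF assms(1) n_pos limit] by blast
qed

end
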